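(* Let $\alpha$ be a continuous rotationally symmetric norm, let $n\in\mathbb{N}$ ($n\ge 1$), and let $\mathcal{M}$ be a non-trivial ($\alpha$-)closed subspace of $L^\alpha$ which is simply invariant under $T_{z^n}$. Then there exist $n$-unimodular functions $\varphi_1,\ldots,\varphi_r$ with $1\le r\le n$ such that \[ \mathcal{M} = \sum_{j=1}^{r} \oplus\, \varphi_j H^\alpha(z^n) \,\oplus\, \mathcal{K}^{\overline{A}}_{\mathcal{M}}, \] where: (a) $H^\alpha(z^n)$ is the $\alpha$-closure of $H^\infty(z^n)$; (b) $A=(\varphi_{ji})$ is the $r\times n$ matrix determined by $\varphi_j=\sum_{i=1}^{n} z^{i-1}\varphi_{ji}$ with $\varphi_{ji}\in L^2(z^n)$; (c) $\mathcal{K}^{\overline{A}}_{\mathcal{M}} = \left\{ f\in\mathcal{M} : \sum_{i=1}^{n} \overline{\varphi_{ji}}\, f_i = 0 \text{ a.e. for all } 1\le j\le r \right\}$, where $f=\sum_{i=1}^{n} z^{i-1} f_i$ is the decomposition of $f$ with $f_i\in L^\alpha(z^n)$. Here $\oplus$ denotes algebraic direct sum.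
   Context: Let $\mathbb{T}$ be the unit circle in $\mathbb{C}$ with normalized Lebesgue measure $m$; $L^p$ ($1\le p\le\infty$) are the Lebesgue spaces of $(\mathbb{T},m)$, and $H^p\subset L^p$ the Hardy spaces (functions in $L^p$ whose Fourier coefficients of negative index vanish). A rotationally symmetric norm is a norm $\alpha$ on $L^\infty$ such that (1) $\alpha(1)=1$; (2) $\alpha(|f|)=\alpha(f)$ for all $f\in L^\infty$; (3) $\alpha(f_w)=\alpha(f)$ for all $w\in\mathbb{T}$, $f\in L^\infty$, where $f_w(z)=f(\overline{w}z)$. It is extended to all complex measurable functions on $\mathbb{T}$ by $\alpha(f)=\sup\{\alpha(s): s \text{ a simple function},\ |s|\le|f|\}\in[0,\infty]$. It is continuous if $\alpha(\chi_{E_k})\to0$ for every sequence of measurable sets $E_k\subset\mathbb{T}$ with $m(E_k)\to0^+$. Put $\mathcal{L}^\alpha=\{f \text{ measurable}:\alpha(f)<\infty\}$, a Banach space under $\alpha$ contained in $L^1$; $L^\alpha$ is the $\alpha$-closure of $L^\infty$ in $\mathcal{L}^\alpha$. For $X\in\{L^\infty,L^2,H^\infty\}$, $X(z^n)$ denotes the set of functions in $X$ of the form $g(z^n)$, i.e. those whose Fourier coefficients vanish at all indices not divisible by $n$. $L^\alpha(z^n)$ is the $\alpha$-closure of $L^\infty(z^n)$. Every $f\in L^2$ has a unique decomposition $f=\sum_{i=1}^n z^{i-1}f_i$ with $f_i\in L^2(z^n)$, and likewise every $f\in L^\alpha$ has a unique decomposition $f=\sum_{i=1}^n z^{i-1}f_i$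 with $f_i\in L^\alpha(z^n)$. A function $\varphi\in L^\infty$ with decomposition $\varphi=\sum_{i=1}^n z^{i-1}\varphi_i$, $\varphi_i\in L^2(z^n)$, is $n$-unimodular if $\sum_{i=1}^n|\varphi_i|^2=1$ a.e. $T_{z^n}$ is the operator of multiplication by $z^n$. A closed subspace $\mathcal{M}$ of $L^\alpha$ is simply invariant under $T_{z^n}$ if $z^n\mathcal{M}\subsetneq\mathcal{M}$. *)

theory Defs
  imports "HOL-Probability.Probability"
begin

text \<open>
  Functions on the unit circle are total functions on \<^typ>\<open>complex\<close> that are only looked at
  on \<open>sphere 0 1\<close>. Function spaces are sets of representatives: instead of forming quotients,
  every space below contains with a function all measurable functions that agree with it almost
  everywhere, and equality of elements is \<open>AE\<close>-equality. We work on the Borel sets, which gives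
  the same classes modulo null functions as the Lebesgue-measurable sets.
\<close>

definition circle :: "complex measure" where
  "circle = distr (uniform_measure lborel {0..1}) (restrict_space borel (sphere 0 1))
              (\<lambda>t. cis (2 * pi * t))"

lemma prob_space_circle: "prob_space circle"
proof -
  have "prob_space (uniform_measure lborel {0..1::real})"
    by (rule prob_space_uniform_measure) auto
  moreover have "(\<lambda>t. cis (2 * pi * t)) \<in> borel_measurable borel"
    by (intro borel_measurable_continuous_onI continuous_intros)
  then have "(\<lambda>t. cis (2 * pi * t)) \<in>
      uniform_measure lborel {0..1} \<rightarrow>\<^sub>M restrict_space borel (sphere 0 1)"
    by (intro measurable_restrict_space2) (simp_all add: measurable_def)
  ultimately show ?thesis
    unfolding circle_def by (rule prob_space.prob_space_distr)
qed

definition L2 :: "(complex \<Rightarrow> complex) set" where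
  "L2 = {f \<in> borel_measurable circle. integrable circle (\<lambda>z. (cmod (f z))\<^sup>2)}"

definition Linf :: "(complex \<Rightarrow> complex) set" where
  "Linf = {f \<in> borel_measurable circle. \<exists>C. AE z in circle. cmod (f z) \<le> C}"

definition fourier_coeff :: "(complex \<Rightarrow> complex) \<Rightarrow> int \<Rightarrow> complex" where
  "fourier_coeff f k = (LINT z|circle. f z * z powi (- k))"

definition Hinf :: "(complex \<Rightarrow> complex) set" where
  "Hinf = {f \<in> Linf. \<forall>k<0. fourier_coeff f k = 0}"

text \<open>\<open>pow_part n X\<close> is $X(z^n)$.\<close>

definition pow_part :: "nat \<Rightarrow> (complex \<Rightarrow> complex) set \<Rightarrow> (complex \<Rightarrow> complex) set" where
  "pow_part n X = {f \<in> X. \<exists>g \<in> borel_measurable circle. AE z in circle. f z = g (z ^ n)}"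

text \<open>
  A norm on $L^\infty$ is a function on representatives. That it depends only on the \<open>AE\<close>-class
  follows from the second and the fourth clause.
\<close>

definition rot_sym_norm :: "((complex \<Rightarrow> complex) \<Rightarrow> real) \<Rightarrow> bool" where
  "rot_sym_norm \<alpha> \<longleftrightarrow>
     (\<forall>f\<in>Linf. 0 \<le> \<alpha> f) \<and>
     (\<forall>f\<in>Linf. \<alpha> f = 0 \<longleftrightarrow> (AE z in circle. f z = 0)) \<and>
     (\<forall>f\<in>Linf. \<forall>c. \<alpha> (\<lambda>z. c * f z) = cmod c * \<alpha> f) \<and>
     (\<forall>f\<in>Linf. \<forall>g\<in>Linf. \<alpha> (\<lambda>z. f z + g z) \<le> \<alpha> f + \<alpha> g) \<and>
     \<alpha> (\<lambda>z. 1) = 1 \<and>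
     (\<forall>f\<in>Linf. \<alpha> (\<lambda>z. complex_of_real (cmod (f z))) = \<alpha> f) \<and>
     (\<forall>f\<in>Linf. \<forall>w\<in>sphere 0 1. \<alpha> (\<lambda>z. f (cnj w * z)) = \<alpha> f)"

definition continuous_norm :: "((complex \<Rightarrow> complex) \<Rightarrow> real) \<Rightarrow> bool" where
  "continuous_norm \<alpha> \<longleftrightarrow>
     (\<forall>E. (\<forall>k::nat. E k \<in> sets circle) \<longrightarrow> (\<lambda>k. measure circle (E k)) \<longlonglongrightarrow> 0 \<longrightarrow>
        (\<lambda>k. \<alpha> (indicator (E k))) \<longlonglongrightarrow> 0)"

definition norm_ext :: "((complex \<Rightarrow> complex) \<Rightarrow> real) \<Rightarrow> (complex \<Rightarrow> complex) \<Rightarrow> ennreal" where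
  "norm_ext \<alpha> f =
     (SUP s \<in> {s. simple_function circle s \<and> (AE z in circle. cmod (s z) \<le> cmod (f z))}.
        ennreal (\<alpha> s))"

text \<open>
  \<open>calL \<alpha>\<close> is $\mathcal{L}^\alpha$, the space of all functions of finite norm, as opposed to
  \<open>Lalpha \<alpha>\<close>, the closure of $L^\infty$ in it.
\<close>

definition calL :: "((complex \<Rightarrow> complex) \<Rightarrow> real) \<Rightarrow> (complex \<Rightarrow> complex) set" where
  "calL \<alpha> = {f \<in> borel_measurable circle. norm_ext \<alpha> f < \<infinity>}"

definition alpha_closure ::
    "((complex \<Rightarrow> complex) \<Rightarrow> real) \<Rightarrow> (complex \<Rightarrow> complex) set \<Rightarrow> (complex \<Rightarrow> complex) set" where
  "alpha_closure \<alpha> X = {f \<in> calL \<alpha>. \<forall>\<epsilon>>0. \<exists>g\<in>X. norm_ext \<alpha> (\<lambda>z. f z - g z) < \<epsilon>}"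

definition Lalpha :: "((complex \<Rightarrow> complex) \<Rightarrow> real) \<Rightarrow> (complex \<Rightarrow> complex) set" where
  "Lalpha \<alpha> = alpha_closure \<alpha> Linf"

definition Lalpha_pow ::
    "((complex \<Rightarrow> complex) \<Rightarrow> real) \<Rightarrow> nat \<Rightarrow> (complex \<Rightarrow> complex) set" where
  "Lalpha_pow \<alpha> n = alpha_closure \<alpha> (pow_part n Linf)"

definition Halpha_pow ::
    "((complex \<Rightarrow> complex) \<Rightarrow> real) \<Rightarrow> nat \<Rightarrow> (complex \<Rightarrow> complex) set" where
  "Halpha_pow \<alpha> n = alpha_closure \<alpha> (pow_part n Hinf)"

text \<open>
  \<open>decomp n Y f F\<close>: $f = \sum_{i=1}^n z^{i-1} F_i$ with all $F_i$ in $Y$. For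
  \<open>Y = pow_part n L2\<close> and \<open>f \<in> L2\<close>, and for \<open>Y = Lalpha_pow \<alpha> n\<close> and \<open>f \<in> Lalpha \<alpha>\<close>, such \<open>F\<close>
  exists and is unique up to \<open>AE\<close>-equality on \<open>{1..n}\<close>, so it may be bound existentially below.
\<close>

definition decomp ::
    "nat \<Rightarrow> (complex \<Rightarrow> complex) set \<Rightarrow> (complex \<Rightarrow> complex) \<Rightarrow> (nat \<Rightarrow> complex \<Rightarrow> complex) \<Rightarrow> bool" where
  "decomp n Y f F \<longleftrightarrow>
     (\<forall>i\<in>{1..n}. F i \<in> Y) \<and> (AE z in circle. f z = (\<Sum>i=1..n. z ^ (i - 1) * F i z))"

definition n_unimodular :: "nat \<Rightarrow> (complex \<Rightarrow> complex) \<Rightarrow> bool" where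
  "n_unimodular n \<phi> \<longleftrightarrow> \<phi> \<in> Linf \<and>
     (\<exists>F. decomp n (pow_part n L2) \<phi> F \<and> (AE z in circle. (\<Sum>i=1..n. (cmod (F i z))\<^sup>2) = 1))"

text \<open>Closedness under \<^term>\<open>alpha_closure \<alpha>\<close> includes closedness under \<open>AE\<close>-equality.\<close>

definition closed_subspace ::
    "((complex \<Rightarrow> complex) \<Rightarrow> real) \<Rightarrow> (complex \<Rightarrow> complex) set \<Rightarrow> bool" where
  "closed_subspace \<alpha> M \<longleftrightarrow> M \<subseteq> Lalpha \<alpha> \<and> (\<lambda>z. 0) \<in> M \<and>
     (\<forall>f\<in>M. \<forall>g\<in>M. (\<lambda>z. f z + g z) \<in> M) \<and>
     (\<forall>c. \<forall>f\<in>M. (\<lambda>z. c * f z) \<in> M) \<and>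
     alpha_closure \<alpha> M = M"

text \<open>\<open>mult_set \<phi> X\<close> is $\varphi X = \{\varphi h : h \in X\}$.\<close>

definition mult_set ::
    "(complex \<Rightarrow> complex) \<Rightarrow> (complex \<Rightarrow> complex) set \<Rightarrow> (complex \<Rightarrow> complex) set" where
  "mult_set \<phi> X = {f \<in> borel_measurable circle. \<exists>h\<in>X. AE z in circle. f z = \<phi> z * h z}"

definition simply_invariant :: "nat \<Rightarrow> (complex \<Rightarrow> complex) set \<Rightarrow> bool" where
  "simply_invariant n M \<longleftrightarrow> mult_set (\<lambda>z. z ^ n) M \<subset> M"

text \<open>The \<open>j\<close>-th row of the matrix \<open>A\<close>, with rows \<open>1..r\<close> and columns \<open>1..n\<close>, is \<open>A j\<close>.\<close>

definition kernel_part ::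
    "((complex \<Rightarrow> complex) \<Rightarrow> real) \<Rightarrow> nat \<Rightarrow> nat \<Rightarrow> (nat \<Rightarrow> nat \<Rightarrow> complex \<Rightarrow> complex) \<Rightarrow>
      (complex \<Rightarrow> complex) set \<Rightarrow> (complex \<Rightarrow> complex) set" where
  "kernel_part \<alpha> n r A M =
     {f \<in> M. \<exists>F. decomp n (Lalpha_pow \<alpha> n) f F \<and>
        (\<forall>j\<in>{1..r}. AE z in circle. (\<Sum>i=1..n. cnj (A j i z) * F i z) = 0)}"

text \<open>\<open>M\<close> is the internal algebraic direct sum of the finite family of subspaces \<open>X i\<close>, \<open>i \<in> I\<close>.\<close>

definition alg_direct_sum ::
    "nat set \<Rightarrow> (nat \<Rightarrow> (complex \<Rightarrow> complex) set) \<Rightarrow> (complex \<Rightarrow> complex) set \<Rightarrow> bool" where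
  "alg_direct_sum I X M \<longleftrightarrow>
     M = {f \<in> borel_measurable circle.
            \<exists>g. (\<forall>i\<in>I. g i \<in> X i) \<and> (AE z in circle. f z = (\<Sum>i\<in>I. g i z))} \<and>
     (\<forall>g h. (\<forall>i\<in>I. g i \<in> X i) \<and> (\<forall>i\<in>I. h i \<in> X i) \<and>
        (AE z in circle. (\<Sum>i\<in>I. g i z) = (\<Sum>i\<in>I. h i z)) \<longrightarrow>
        (\<forall>i\<in>I. AE z in circle. g i z = h i z))"

end

theory Submission
  imports Defs
begin

text \<open>
  Write $E f(z) = \frac1n \sum_{w^n=1} f(wz)$ for the projection onto the functions of $z^n$. If
  $f = \sum_i z^{i-1} f_i$ and $\varphi = \sum_i z^{i-1} \varphi_i$, then $E(f\bar\varphi) = \sum_i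
  f_i \overline{\varphi_i}$, because $E(z^{i-k}) = 0$ for $i \ne k$. So $\varphi$ is $n$-unimodular iff
  $E(|\varphi|^2) = 1$, and the kernel part belonging to $\varphi$ consists of the $f \in M$ with
  $E(f\bar\varphi) = 0$.

  The decomposition is obtained with a single function, $r = 1$: it is enough to find a bounded
  $\varphi \in M$ with $E(|\varphi|^2) = 1$ that is orthogonal to $z^n u$ for every bounded $u \in M$.
  Then $f = \varphi\,E(f\bar\varphi) + (f - \varphi\,E(f\bar\varphi))$ for $f \in M$. Orthogonality
  makes the Fourier coefficients of $E(f\bar\varphi)$ at negative multiples of $n$ vanish, so that
  $E(f\bar\varphi) \in H^\alpha(z^n)$. Moreover $\varphi H^\alpha(z^n) \subseteq M$, because $M$ is
  closed under multiplication by $z^n$ and under limits, and the second summand is killed by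
  $f \mapsto E(f\bar\varphi)$. The same map recovers the two summands, which gives uniqueness.

  To find $\varphi$ (\<open>exists_wandering_vector\<close>), choose a bounded $g \in M$ outside $z^n M$ and
  subtract from it its projection, in $L^2$, onto the closure of $\{z^n m : m \in M \cap L^\infty\}$.
  The difference $f$ is orthogonal to $z^{nl} f$ for $l \ge 1$; hence $E(|f|^2)$ has no Fourier
  coefficient but the constant one and is a constant $c$. In particular $|f|^2 \le nc$ is bounded.

  The projection is an $L^2$ limit of elements of $M$, but $\alpha$ is not controlled by the $L^2$ norm,
  and the point is to see that $f \in M$. This is the closure property \<open>M_L1_dominated_limit\<close>:
  an a.e. limit $F \in L^\alpha$ of elements of $M$ that are dominated by an integrable $G$ lies in
  $M$. It rests on outer functions. Take a real $v \in L^2$ that depends on $z^n$ only, with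
  $v \ge \sqrt{G}$, and let $V \in H^2$ have real part $v$. The functions $h_m = \exp(-V/m)$ are bounded
  by 1, tend to 1, and make $h_m G$ bounded. They multiply $M$ into itself since $V$ is a limit
  of polynomials in $z^n$ with nonnegative real part, namely of Fejer means. Thus $h_m F$ is a bounded
  limit of elements of $M$, and $F$ is the limit of $h_m F$ dominated by $|F|$; for both kinds of limit
  continuity of $\alpha$ gives convergence in $\alpha$ (\<open>norm_ext_dominated_convergence\<close>).
\<close>

section \<open>Normalized Lebesgue measure on the circle\<close>

interpretation circle: prob_space circle
  by (rule prob_space_circle)

lemma space_circle [simp]: "space circle = sphere 0 1"
  by (simp add: circle_def space_restrict_space)

lemma sets_circle [measurable_cong]: "sets circle = sets (restrict_space borel (sphere 0 1))"
  by (simp add: circle_def)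

lemma AE_circleI: "(\<And>z. cmod z = 1 \<Longrightarrow> P z) \<Longrightarrow> AE z in circle. P z"
  by (rule AE_I2) simp

lemma borel_measurable_circleI: "f \<in> borel_measurable borel \<Longrightarrow> f \<in> borel_measurable circle"
  by (simp add: measurable_cong_sets[OF sets_circle refl] measurable_restrict_space1)

lemma ident_measurable_circle [measurable]: "(\<lambda>z. z) \<in> borel_measurable circle"
  by (rule borel_measurable_circleI) simp

lemma powi_measurable_circle [measurable]: "(\<lambda>z. z powi k) \<in> borel_measurable circle"
  by (cases "k \<ge> 0") (simp_all add: power_int_def)

lemma rotation_measurable_circle:
  "cmod w = 1 \<Longrightarrow> (\<lambda>z. w * z) \<in> circle \<rightarrow>\<^sub>M circle"
  unfolding measurable_cong_sets[OF refl sets_circle]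
  by (intro measurable_restrict_space2) (auto simp: norm_mult)

lemma rotate_measurable:
  "cmod w = 1 \<Longrightarrow> f \<in> borel_measurable circle \<Longrightarrow> (\<lambda>z. f (w * z)) \<in> borel_measurable circle"
  by (rule measurable_compose[OF rotation_measurable_circle])

lemma cis_measurable [measurable]: "(\<lambda>t. cis (2 * pi * t)) \<in> borel \<rightarrow>\<^sub>M circle"
  unfolding measurable_cong_sets[OF refl sets_circle]
  by (intro measurable_restrict_space2 borel_measurable_continuous_onI continuous_intros) auto

lemma nn_integral_circle:
  assumes f: "f \<in> borel_measurable circle"
  shows "(\<integral>\<^sup>+z. f z \<partial>circle) = (\<integral>\<^sup>+t. f (cis (2 * pi * t)) * indicator {0..1} t \<partial>lborel)"
proof -
  have m: "(\<lambda>t. cis (2 * pi * t)) \<in> uniform_measure lborel {0..1} \<rightarrow>\<^sub>M restrict_space borel (sphere 0 1)"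
    using cis_measurable by (simp add: measurable_cong_sets[OF refl sets_circle] cong: measurable_cong_sets)
  have f': "f \<in> borel_measurable (restrict_space borel (sphere 0 1))"
    using f by (simp add: measurable_cong_sets[OF sets_circle refl])
  have "(\<integral>\<^sup>+z. f z \<partial>circle) = (\<integral>\<^sup>+t. f (cis (2 * pi * t)) \<partial>uniform_measure lborel {0..1})"
    unfolding circle_def by (rule nn_integral_distr[OF m]) (use f' in simp)
  also have "\<dots> = (\<integral>\<^sup>+t. f (cis (2 * pi * t)) * indicator {0..1} t \<partial>lborel) / emeasure lborel {0..1::real}"
    by (rule nn_integral_uniform_measure) (use measurable_compose[OF cis_measurable f] in auto)
  finally show ?thesis by (simp add: divide_ennreal_def)
qed

lemma nn_integral_period_shift:
  fixes g :: "real \<Rightarrow> ennreal"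
  assumes [measurable]: "g \<in> borel_measurable borel" and per: "\<And>t. g (t + 1) = g t"
    and s: "0 \<le> s" "s \<le> 1"
  shows "(\<integral>\<^sup>+t. g (s + t) * indicator {0..1} t \<partial>lborel) = (\<integral>\<^sup>+t. g t * indicator {0..1} t \<partial>lborel)"
proof -
  have ae: "AE t in lborel. t \<noteq> 1 - s" "AE t in lborel. t \<noteq> s" by (auto intro: AE_lborel_singleton)
  have "(\<integral>\<^sup>+t. g (s + t) * indicator {0..1} t \<partial>lborel)
      = (\<integral>\<^sup>+t. g (s + t) * indicator {0..1-s} t + g (s + t) * indicator {1-s..1} t \<partial>lborel)"
    by (rule nn_integral_cong_AE, rule AE_mp[OF ae(1)], rule AE_I2) (use s in \<open>auto split: split_indicator\<close>)
  also have "\<dots> = (\<integral>\<^sup>+t. g (s + t) * indicator {0..1-s} t \<partial>lborel) + (\<integral>\<^sup>+t. g (s + t) * indicator {1-s..1} t \<partial>lborel)"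
    by (rule nn_integral_add) auto
  also have "(\<integral>\<^sup>+t. g (s + t) * indicator {0..1-s} t \<partial>lborel) = (\<integral>\<^sup>+t. g t * indicator {s..1} t \<partial>lborel)"
  proof (subst (2) nn_integral_real_affine[where c=1 and t=s])
  qed (auto intro!: nn_integral_cong split: split_indicator)
  also have "(\<integral>\<^sup>+t. g (s + t) * indicator {1-s..1} t \<partial>lborel) = (\<integral>\<^sup>+t. g t * indicator {0..s} t \<partial>lborel)"
  proof (subst (2) nn_integral_real_affine[where c=1 and t="s-1"])
    have "g (s + t) = g (s - 1 + 1 * t)" for t
      using per[of "s - 1 + t"] by (simp add: algebra_simps)
    then show "(\<integral>\<^sup>+t. g (s + t) * indicator {1-s..1} t \<partial>lborel) =
        ennreal \<bar>1\<bar> * (\<integral>\<^sup>+t. g (s - 1 + 1 * t) * indicator {0..s} (s - 1 + 1 * t) \<partial>lborel)"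
      by (auto intro!: nn_integral_cong split: split_indicator)
  qed auto
  also have "(\<integral>\<^sup>+t. g t * indicator {s..1} t \<partial>lborel) + (\<integral>\<^sup>+t. g t * indicator {0..s} t \<partial>lborel)
      = (\<integral>\<^sup>+t. g t * indicator {s..1} t + g t * indicator {0..s} t \<partial>lborel)"
    by (rule nn_integral_add[symmetric]) auto
  also have "\<dots> = (\<integral>\<^sup>+t. g t * indicator {0..1} t \<partial>lborel)"
    by (rule nn_integral_cong_AE, rule AE_mp[OF ae(2)], rule AE_I2) (use s in \<open>auto split: split_indicator\<close>)
  finally show ?thesis .
qed

text \<open>
  On the parameter interval a rotation is a translation modulo 1, so this is translation invariance
  of Lebesgue measure.
\<close>

lemma distr_rotate:
  assumes w: "cmod w = 1"
  shows "distr circle circle (\<lambda>z. w * z) = circle"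
proof (rule measure_eqI)
  fix A assume "A \<in> sets (distr circle circle (\<lambda>z. w * z))"
  then have A [measurable]: "A \<in> sets circle" by simp
  obtain s0 where s0: "0 \<le> s0" "s0 < 2 * pi" "w = cis s0"
    using Arg2pi[of w] w that[of "Arg2pi w"] by (auto simp: cis_conv_exp is_Arg_def mult.commute)
  define s where "s = s0 / (2 * pi)"
  have s: "0 \<le> s" "s \<le> 1" "w = cis (2 * pi * s)" using s0 by (auto simp: s_def field_simps)
  define g where "g t = (indicator A (cis (2 * pi * t)) :: ennreal)" for t
  have gm: "g \<in> borel_measurable borel" unfolding g_def by measurable
  have per: "g (t + 1) = g t" for t
  proof -
    have "cis (2 * pi * (t + 1)) = cis (2 * pi * t)"
      by (simp add: cis.ctr cos_add sin_add ring_distribs)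
    then show ?thesis by (simp add: g_def)
  qed
  have "emeasure (distr circle circle (\<lambda>z. w * z)) A = (\<integral>\<^sup>+z. indicator A z \<partial>distr circle circle (\<lambda>z. w * z))"
    by simp
  also have "\<dots> = (\<integral>\<^sup>+z. indicator A (w * z) \<partial>circle)"
    by (rule nn_integral_distr[OF rotation_measurable_circle[OF w]]) simp
  also have "\<dots> = (\<integral>\<^sup>+t. g (s + t) * indicator {0..1} t \<partial>lborel)"
    using measurable_compose[OF rotation_measurable_circle[OF w] borel_measurable_indicator[OF A]]
    by (subst nn_integral_circle) (auto simp: g_def s(3) cis_mult ring_distribs)
  also have "\<dots> = (\<integral>\<^sup>+t. g t * indicator {0..1} t \<partial>lborel)"
    by (rule nn_integral_period_shift[OF gm per s(1,2)])
  also have "\<dots> = (\<integral>\<^sup>+z. indicator A z \<partial>circle)"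
    by (subst nn_integral_circle) (auto simp: g_def)
  finally show "emeasure (distr circle circle (\<lambda>z. w * z)) A = emeasure circle A" by simp
qed simp

lemma AE_rotate:
  assumes w: "cmod w = 1" and P: "AE z in circle. P z"
  shows "AE z in circle. P (w * z)"
  using AE_distrD[OF rotation_measurable_circle[OF w]] P distr_rotate[OF w] by metis

lemma integral_rotate:
  fixes f :: "complex \<Rightarrow> 'b::{banach, second_countable_topology}"
  assumes w: "cmod w = 1" and f: "f \<in> borel_measurable circle"
  shows "(LINT z|circle. f (w * z)) = (LINT z|circle. f z)"
  using integral_distr[OF rotation_measurable_circle[OF w] f] distr_rotate[OF w] by simp

lemma integrable_rotate:
  fixes f :: "complex \<Rightarrow> 'b::{banach, second_countable_topology}"
  assumes w: "cmod w = 1" and f: "integrable circle f"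
  shows "integrable circle (\<lambda>z. f (w * z))"
  using integrable_distr[OF rotation_measurable_circle[OF w], of f] distr_rotate[OF w] f by simp

lemma norm_powi_circle: "cmod z = 1 \<Longrightarrow> cmod (z powi k) = 1"
  by (simp add: norm_power_int)

lemma cnj_circle: "cmod z = 1 \<Longrightarrow> cnj z = inverse z"
  using complex_norm_square[of z] inverse_unique[of z "cnj z"] by simp

lemma integrable_bounded_mult:
  fixes f g :: "complex \<Rightarrow> complex"
  assumes f: "integrable circle f" and g: "g \<in> borel_measurable circle" "AE z in circle. cmod (g z) \<le> C"
  shows "integrable circle (\<lambda>z. g z * f z)"
proof (rule Bochner_Integration.integrable_bound)
  show "integrable circle (\<lambda>z. C * cmod (f z))" using f by auto
  show "(\<lambda>z. g z * f z) \<in> borel_measurable circle" using f g by measurable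
  show "AE z in circle. norm (g z * f z) \<le> norm (C * cmod (f z))"
    using g(2)
  proof eventually_elim
    case (elim z)
    have "cmod (g z) \<le> \<bar>C\<bar>" using elim by linarith
    then show ?case by (simp add: norm_mult abs_mult mult_right_mono)
  qed
qed

lemma integrable_powi_mult:
  "integrable circle f \<Longrightarrow> integrable circle (\<lambda>z. f z * z powi k)"
  using integrable_bounded_mult[of f "\<lambda>z. z powi k" 1, OF _ _ AE_circleI]
  by (auto simp: mult.commute norm_powi_circle)

lemma integral_powi: "(LINT z|circle. z powi k) = (if k = 0 then 1 else 0)"
proof (cases "k = 0")
  case True
  then show ?thesis using circle.prob_space by simp
next
  case False
  \<comment> \<open>Rotating by a $w$ with $w^k = -1$ changes the sign of the integral.\<close>
  define w where "w = cis (pi / of_int k)"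
  have w: "cmod w = 1" by (simp add: w_def)
  have wk: "w powi k = -1"
    using False by (simp add: w_def cis_power_int)
  have "(LINT z|circle. z powi k) = (LINT z|circle. (w * z) powi k)"
    using integral_rotate[OF w powi_measurable_circle] by simp
  also have "\<dots> = - (LINT z|circle. z powi k)"
    by (simp add: power_int_mult_distrib wk)
  finally show ?thesis using False by simp
qed

section \<open>Uniqueness of Fourier coefficients\<close>

definition fourier_null :: "(complex \<Rightarrow> complex) \<Rightarrow> bool" where
  "fourier_null f \<longleftrightarrow> integrable circle f \<and> (\<forall>k. fourier_coeff f k = 0)"

lemma fourier_coeff_add:
  "integrable circle f \<Longrightarrow> integrable circle g \<Longrightarrow>
    fourier_coeff (\<lambda>z. f z + g z) k = fourier_coeff f k + fourier_coeff g k"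
  unfolding fourier_coeff_def
  by (simp add: ring_distribs integrable_powi_mult)

lemma fourier_coeff_diff:
  "integrable circle f \<Longrightarrow> integrable circle g \<Longrightarrow>
    fourier_coeff (\<lambda>z. f z - g z) k = fourier_coeff f k - fourier_coeff g k"
  unfolding fourier_coeff_def
  by (simp add: ring_distribs left_diff_distrib integrable_powi_mult)

lemma fourier_coeff_cmult: "fourier_coeff (\<lambda>z. c * f z) k = c * fourier_coeff f k"
  by (simp add: fourier_coeff_def mult.assoc)

lemma fourier_coeff_powi_mult: "fourier_coeff (\<lambda>z. z powi j * f z) k = fourier_coeff f (k - j)"
proof -
  have "z powi j * f z * z powi (- k) = f z * z powi (- (k - j))" if "cmod z = 1" for z
  proof -
    have "z \<noteq> 0" using that by auto
    then show ?thesis by (simp add: power_int_diff power_int_minus field_simps)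
  qed
  then show ?thesis unfolding fourier_coeff_def by (intro Bochner_Integration.integral_cong) auto
qed

lemma fourier_coeff_cong:
  assumes "f \<in> borel_measurable circle" "g \<in> borel_measurable circle" "AE z in circle. f z = g z"
  shows "fourier_coeff f k = fourier_coeff g k"
  unfolding fourier_coeff_def using assms by (intro integral_cong_AE) (auto elim!: eventually_mono)

text \<open>
  Having only zero Fourier coefficients survives multiplication by $z$ and $\bar z = z^{-1}$, which
  shift the coefficients, and hence by every polynomial in the real and the imaginary part of $z$.
  Stated as a closure property, this passes through products by mere composition.
\<close>

lemma real_polynomial_fourier_null:
  assumes "real_polynomial_function p" "fourier_null f"
  shows "fourier_null (\<lambda>z. of_real (p z) * f z)"
  using assms
proof (induction p arbitrary: f)
  case (linear p)
  from linear(2) have f: "integrable circle f" "\<And>k. fourier_coeff f k = 0" by (auto simp: fourier_null_def)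
  define a where "a = complex_of_real (p 1)" 
  define b where "b = complex_of_real (p \<i>)"
  define u where "u z = ((a - \<i> * b) / 2) * (z powi 1 * f z) + ((a + \<i> * b) / 2) * (z powi (-1) * f z)" for z
  have pz: "of_real (p z) * f z = u z" if "cmod z = 1" for z
  proof -
    interpret bounded_linear p by fact
    have "z = Re z *\<^sub>R 1 + Im z *\<^sub>R \<i>" by (simp add: complex_eq_iff)
    then have "p z = p (Re z *\<^sub>R 1 + Im z *\<^sub>R \<i>)" by (rule arg_cong)
    also have "\<dots> = Re z * p 1 + Im z * p \<i>" by (simp only: add scaleR) simp
    finally have 1: "of_real (p z) = of_real (Re z) * a + of_real (Im z) * b" by (simp add: a_def b_def)
    have 2: "z powi (-1) = cnj z" using that by (simp add: cnj_circle)
    have 3: "of_real (Re z) = (z + cnj z) / 2" "of_real (Im z) = (z - cnj z) / (2 * \<i>)"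
      by (auto simp: complex_eq_iff)
    show ?thesis unfolding 1 3 u_def 2 by (simp add: field_simps)
  qed
  have i: "integrable circle (\<lambda>z. z powi j * f z)" for j
    using integrable_powi_mult[OF f(1), of j] by (simp add: mult.commute)
  have u: "integrable circle u"
    unfolding u_def by (intro Bochner_Integration.integrable_add integrable_mult_right i)
  have "fourier_coeff u k = 0" for k
    unfolding u_def
    by (subst fourier_coeff_add; (intro integrable_mult_right i)?)
       (simp only: fourier_coeff_cmult fourier_coeff_powi_mult f(2) mult_zero_right add_0)
  moreover have "fourier_coeff (\<lambda>z. of_real (p z) * f z) k = fourier_coeff u k" for k
    unfolding fourier_coeff_def by (intro Bochner_Integration.integral_cong) (auto simp: pz)
  moreover have "integrable circle (\<lambda>z. of_real (p z) * f z)"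
    using u by (subst Bochner_Integration.integrable_cong[where g=u]) (auto simp: pz)
  ultimately show ?case by (simp add: fourier_null_def)
next
  case (const c)
  then show ?case by (auto simp: fourier_null_def fourier_coeff_cmult)
next
  case (add p q)
  from add.IH(1)[OF add.prems] add.IH(2)[OF add.prems]
  show ?case by (auto simp: fourier_null_def ring_distribs fourier_coeff_add)
next
  case (mult p q)
  from mult.IH(1)[OF mult.IH(2)[OF mult.prems]]
  show ?case by (simp add: mult.assoc)
qed

text \<open>
  By Stone--Weierstrass, polynomials are uniformly dense in the continuous functions.
\<close>

lemma fourier_null_continuous:
  assumes f: "fourier_null f" and g: "continuous_on (sphere 0 1) g" "g \<in> borel_measurable circle"
  shows "(LINT z|circle. of_real (g z) * f z) = 0"
proof (rule ccontr)
  assume ne: "(LINT z|circle. of_real (g z) * f z) \<noteq> 0"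
  have fi: "integrable circle f" using f by (simp add: fourier_null_def)
  define L where "L = (LINT z|circle. cmod (f z))"
  have L0: "L \<ge> 0" by (simp add: L_def)
  define e where "e = cmod (LINT z|circle. of_real (g z) * f z) / (L + 1)"
  have e: "e > 0" using ne L0 by (simp add: e_def)
  obtain p where p: "real_polynomial_function p" "\<And>z. z \<in> sphere 0 1 \<Longrightarrow> \<bar>g z - p z\<bar> < e"
    using Stone_Weierstrass_real_polynomial_function[OF compact_sphere g(1) e] by auto
  have pf: "fourier_null (\<lambda>z. of_real (p z) * f z)" by (rule real_polynomial_fourier_null[OF p(1) f])
  have p0: "(LINT z|circle. of_real (p z) * f z) = 0" and pI: "integrable circle (\<lambda>z. of_real (p z) * f z)"
    using pf[unfolded fourier_null_def fourier_coeff_def] by (auto dest: spec[of _ 0])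
  obtain C where C: "\<And>z. z \<in> sphere 0 1 \<Longrightarrow> \<bar>g z\<bar> \<le> C"
    using compact_imp_bounded[OF compact_continuous_image[OF g(1) compact_sphere]]
    unfolding bounded_iff by (metis imageI real_norm_def)
  have gI: "integrable circle (\<lambda>z. of_real (g z) * f z)"
    using C g by (intro integrable_bounded_mult[where C=C] fi AE_I2) auto
  have "(LINT z|circle. of_real (g z) * f z) = (LINT z|circle. of_real (g z) * f z - of_real (p z) * f z)"
    using gI pI p0 by simp
  also have "cmod \<dots> \<le> (LINT z|circle. e * cmod (f z))"
  proof (rule order_trans[OF integral_norm_bound integral_mono])
    fix z assume "z \<in> space circle"
    then have "\<bar>g z - p z\<bar> \<le> e" using p(2)[of z] by auto
    moreover have "of_real (g z) * f z - of_real (p z) * f z = of_real (g z - p z) * f z"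
      by (simp add: algebra_simps)
    ultimately show "norm (of_real (g z) * f z - of_real (p z) * f z) \<le> e * cmod (f z)"
      by (simp add: norm_mult mult_right_mono del: of_real_diff)
  qed (use gI pI fi in auto)
  also have "\<dots> = e * L" by (simp add: L_def)
  finally have "cmod (LINT z|circle. of_real (g z) * f z) \<le> e * L" .
  moreover have "cmod (LINT z|circle. of_real (g z) * f z) = e * (L + 1)" using L0 by (simp add: e_def)
  ultimately show False using e by (simp add: algebra_simps)
qed

lemma fourier_null_closed:
  assumes f: "fourier_null f" and C: "closed C"
  shows "(LINT z|circle. indicator C z * f z) = 0"
proof (cases "C = {}")
  case False
  define g where "g k z = max 0 (1 - real k * setdist {z} C)" for k z
  have cont: "continuous_on S (g k)" for k S
    unfolding g_def by (intro continuous_intros continuous_on_setdist)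
  have gm [measurable]: "g k \<in> borel_measurable circle" for k
    by (intro borel_measurable_circleI borel_measurable_continuous_onI cont)
  have fi [measurable]: "integrable circle f" using f by (simp add: fourier_null_def)
  have Cm [measurable]: "C \<in> sets borel" using C by simp
  have indm [measurable]: "(indicator C :: complex \<Rightarrow> complex) \<in> borel_measurable circle"
    by (intro borel_measurable_circleI borel_measurable_indicator Cm)
  have lim: "(\<lambda>k. g k z) \<longlonglongrightarrow> indicator C z" for z
  proof (cases "z \<in> C")
    case True
    then show ?thesis by (simp add: g_def setdist_sing_in_set)
  next
    case zC: False
    then have d: "setdist {z} C > 0"
      using False C setdist_gt_0_compact_closed[of "{z}" C] by auto
    obtain N where N: "1 < real N * setdist {z} C" using reals_Archimedean3[OF d] by blast
    have "\<forall>k\<ge>N. g k z = 0"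
    proof (intro allI impI)
      fix k assume "N \<le> k"
      then have "real N * setdist {z} C \<le> real k * setdist {z} C" using d by (intro mult_right_mono) auto
      then show "g k z = 0" using N by (simp add: g_def)
    qed
    then have "\<forall>\<^sub>F k in sequentially. g k z = 0" by (auto simp: eventually_sequentially)
    then show ?thesis using zC by (auto intro: tendsto_eventually)
  qed
  have "(\<lambda>k. LINT z|circle. of_real (g k z) * f z) \<longlonglongrightarrow> (LINT z|circle. indicator C z * f z)"
  proof (rule integral_dominated_convergence[where w="\<lambda>z. cmod (f z)"])
    show "AE z in circle. (\<lambda>k. of_real (g k z) * f z) \<longlonglongrightarrow> indicator C z * f z"
    proof (rule AE_I2)
      fix z
      have "(\<lambda>k. of_real (g k z) * f z) \<longlonglongrightarrow> of_real (indicator C z) * f z"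
        by (intro tendsto_intros lim)
      then show "(\<lambda>k. of_real (g k z) * f z) \<longlonglongrightarrow> indicator C z * f z"
        by (cases "z \<in> C") auto
    qed
    show "\<And>k. AE z in circle. norm (of_real (g k z) * f z) \<le> cmod (f z)"
    proof (rule AE_I2)
      fix k z
      have "\<bar>g k z\<bar> \<le> 1" by (simp add: g_def setdist_pos_le)
      then show "norm (of_real (g k z) * f z) \<le> cmod (f z)"
        by (simp add: norm_mult mult_left_le_one_le)
    qed
  qed (use fi in \<open>auto intro: borel_measurable_integrable\<close>)
  moreover have "(LINT z|circle. of_real (g k z) * f z) = 0" for k
    by (rule fourier_null_continuous[OF f cont gm])
  ultimately show ?thesis by (simp add: LIMSEQ_const_iff)
qed simp

text \<open>
  The sets over which $f$ integrates to zero contain the closed sets, whose indicators are limits of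
  continuous functions, and form a Dynkin system; so they are all Borel sets.
\<close>

lemma fourier_uniqueness:
  assumes f: "integrable circle f" and z: "\<And>k. fourier_coeff f k = 0"
  shows "AE z in circle. f z = 0"
proof -
  have fn: "fourier_null f" using f z by (simp add: fourier_null_def)
  have [measurable]: "f \<in> borel_measurable circle" using f by auto
  have ind: "integrable circle (\<lambda>z. indicator A z * f z)" if "A \<in> sets borel" for A
    using that by (intro integrable_bounded_mult[where C=1] f borel_measurable_circleI borel_measurable_indicator)
      (auto simp: indicator_def)
  have IS: "Int_stable (Collect (closed :: complex set \<Rightarrow> bool))" by (auto simp: Int_stable_def)
  have SP: "Collect (closed :: complex set \<Rightarrow> bool) \<subseteq> Pow UNIV" by auto
  have Z: "(LINT z|circle. indicator A z * f z) = 0" if "A \<in> sigma_sets UNIV (Collect closed)" for A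
    using IS SP that
  proof (induction rule: sigma_sets_induct_disjoint)
    fix A :: "complex set" assume "A \<in> Collect closed"
    then show "(LINT z|circle. indicator A z * f z) = 0" using fourier_null_closed[OF fn] by auto
  next
    fix A :: "complex set" assume A: "A \<in> sigma_sets UNIV (Collect closed)"
      and IH: "(LINT z|circle. indicator A z * f z) = 0"
    have Ab: "A \<in> sets borel" using A by (simp add: borel_eq_closed)
    have "(LINT z|circle. indicator (UNIV - A) z * f z) = (LINT z|circle. indicator UNIV z * f z - indicator A z * f z)"
      by (intro Bochner_Integration.integral_cong) (auto simp: indicator_def)
    also have "\<dots> = (LINT z|circle. indicator UNIV z * f z) - (LINT z|circle. indicator A z * f z)"
      by (intro Bochner_Integration.integral_diff ind Ab) simp
    finally show "(LINT z|circle. indicator (UNIV - A) z * f z) = 0"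
      using IH fourier_null_closed[OF fn closed_UNIV] by simp
  next
    fix A :: "nat \<Rightarrow> complex set" assume dis: "disjoint_family A"
      and A: "range A \<subseteq> sigma_sets UNIV (Collect closed)"
      and IH: "\<And>i. (LINT z|circle. indicator (A i) z * f z) = 0"
    have Ab: "\<And>i. A i \<in> sets borel" using A by (auto simp: borel_eq_closed)
    then have Ub: "(\<Union>i. A i) \<in> sets borel" by auto
    have "(\<lambda>N. LINT z|circle. indicator (\<Union>i<N. A i) z * f z) \<longlonglongrightarrow> (LINT z|circle. indicator (\<Union>i. A i) z * f z)"
    proof (rule integral_dominated_convergence[where w="\<lambda>z. cmod (f z)"])
      show "AE z in circle. (\<lambda>N. indicator (\<Union>i<N. A i) z * f z) \<longlonglongrightarrow> indicator (\<Union>i. A i) z * f z"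
        by (intro AE_I2 tendsto_mult LIMSEQ_indicator_UN tendsto_const)
      show "\<And>N. AE z in circle. norm (indicator (\<Union>i<N. A i) z * f z) \<le> cmod (f z)"
        by (auto simp: indicator_def)
      show "(\<lambda>z. indicator (\<Union>i. A i) z * f z) \<in> borel_measurable circle" using ind[OF Ub] by auto
      show "\<And>N. (\<lambda>z. indicator (\<Union>i<N. A i) z * f z) \<in> borel_measurable circle"
        using ind[of "\<Union>i<N. A i" for N] Ab by auto
    qed (use f in auto)
    moreover have "(LINT z|circle. indicator (\<Union>i<N. A i) z * f z) = 0" for N
    proof -
      have "(LINT z|circle. indicator (\<Union>i<N. A i) z * f z) = (LINT z|circle. (\<Sum>i<N. indicator (A i) z * f z))"
      proof (intro Bochner_Integration.integral_cong refl)
        fix z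
        have "(indicator (\<Union>i<N. A i) z :: complex) = (\<Sum>i<N. indicator (A i) z)"
          using dis by (intro indicator_UN_disjoint) (auto simp: disjoint_family_on_def)
        then show "indicator (\<Union>i<N. A i) z * f z = (\<Sum>i<N. indicator (A i) z * f z)"
          by (simp add: sum_distrib_right)
      qed
      also have "\<dots> = (\<Sum>i<N. LINT z|circle. indicator (A i) z * f z)"
        by (intro Bochner_Integration.integral_sum ind Ab)
      finally show ?thesis by (simp add: IH)
    qed
    ultimately show "(LINT z|circle. indicator (\<Union>i. A i) z * f z) = 0" by (simp add: LIMSEQ_const_iff)
  qed auto
  have Zc: "(LINT z|circle. indicator A z * f z) = 0" if "A \<in> sets circle" for A
  proof -
    have "A \<in> sets borel"
      using that unfolding sets_circle by (auto simp: sets_restrict_space)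
    then show ?thesis using Z[of A] by (simp add: borel_eq_closed)
  qed
  have ZI: "integrable circle (\<lambda>z. indicator A z * f z)" if "A \<in> sets circle" for A
    using that by (intro integrable_bounded_mult[where C=1] f) (auto simp: indicator_def)
  have "AE z in circle. Re (f z) = 0"
  proof (rule density_unique_real)
    fix A assume A: "A \<in> sets circle"
    have "(LINT z|circle. Re (indicator A z * f z)) = 0"
      unfolding integral_Re[OF ZI[OF A]] Zc[OF A] by simp
    then show "set_lebesgue_integral circle A (\<lambda>z. Re (f z)) = set_lebesgue_integral circle A (\<lambda>z. 0)"
      unfolding set_lebesgue_integral_def
      by (subst (asm) Bochner_Integration.integral_cong[where g="\<lambda>z. indicator A z *\<^sub>R Re (f z)"]) (auto simp: indicator_def)
  qed (use f in auto)
  moreover have "AE z in circle. Im (f z) = 0"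
  proof (rule density_unique_real)
    fix A assume A: "A \<in> sets circle"
    have "(LINT z|circle. Im (indicator A z * f z)) = 0"
      unfolding integral_Im[OF ZI[OF A]] Zc[OF A] by simp
    then show "set_lebesgue_integral circle A (\<lambda>z. Im (f z)) = set_lebesgue_integral circle A (\<lambda>z. 0)"
      unfolding set_lebesgue_integral_def
      by (subst (asm) Bochner_Integration.integral_cong[where g="\<lambda>z. indicator A z *\<^sub>R Im (f z)"]) (auto simp: indicator_def)
  qed (use f in auto)
  ultimately show ?thesis by eventually_elim (simp add: complex_eq_iff)
qed

section \<open>Square integrable functions\<close>

definition l2sq :: "(complex \<Rightarrow> complex) \<Rightarrow> real" where
  "l2sq f = (LINT z|circle. (cmod (f z))\<^sup>2)"

lemma L2D [measurable_dest]: "f \<in> L2 \<Longrightarrow> f \<in> borel_measurable circle"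
  by (simp add: L2_def)

lemma L2_integrable_sq: "f \<in> L2 \<Longrightarrow> integrable circle (\<lambda>z. (cmod (f z))\<^sup>2)"
  by (simp add: L2_def)

lemma LinfD [measurable_dest]: "f \<in> Linf \<Longrightarrow> f \<in> borel_measurable circle"
  by (simp add: Linf_def)

lemma LinfE:
  assumes "f \<in> Linf" obtains C where "C > 0" "AE z in circle. cmod (f z) \<le> C"
proof -
  obtain C where C: "AE z in circle. cmod (f z) \<le> C" using assms by (auto simp: Linf_def)
  have "AE z in circle. cmod (f z) \<le> \<bar>C\<bar> + 1" using C by eventually_elim linarith
  then show ?thesis using that[of "\<bar>C\<bar> + 1"] by linarith
qed

lemma l2sq_nonneg: "l2sq f \<ge> 0"
  by (simp add: l2sq_def)

lemma cmod_add_sq_le: "(cmod (a + b))\<^sup>2 \<le> 2 * (cmod a)\<^sup>2 + 2 * (cmod b)\<^sup>2"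
proof -
  have "(cmod (a + b))\<^sup>2 + (cmod (a - b))\<^sup>2 = 2 * (cmod a)\<^sup>2 + 2 * (cmod b)\<^sup>2"
    by (simp only: cmod_power2) (simp add: power2_eq_square algebra_simps)
  then show ?thesis by (smt (verit) zero_le_power2)
qed

lemma cmod_mean_sq_le:
  assumes "n \<ge> 1"
  shows "(cmod ((\<Sum>i<n. x i) / of_nat n))\<^sup>2 \<le> (\<Sum>i<n. (cmod (x i))\<^sup>2) / real n"
proof -
  have "cmod ((\<Sum>i<n. x i) / of_nat n) \<le> (\<Sum>i<n. cmod (x i)) / real n"
    by (simp add: norm_divide divide_right_mono norm_sum)
  then have "(cmod ((\<Sum>i<n. x i) / of_nat n))\<^sup>2 \<le> ((\<Sum>i<n. 1 * cmod (x i)) / real n)\<^sup>2"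
    by (intro power_mono) auto
  also have "\<dots> \<le> ((\<Sum>i<n. 1\<^sup>2) * (\<Sum>i<n. (cmod (x i))\<^sup>2)) / (real n)\<^sup>2"
    unfolding power_divide by (intro divide_right_mono Cauchy_Schwarz_ineq_sum) auto
  also have "\<dots> = (\<Sum>i<n. (cmod (x i))\<^sup>2) / real n"
    using assms by (simp add: power2_eq_square)
  finally show ?thesis .
qed

lemma L2_bound:
  assumes "integrable circle G" "f \<in> borel_measurable circle" "AE z in circle. (cmod (f z))\<^sup>2 \<le> G z"
  shows "f \<in> L2"
  unfolding L2_def using assms
  by (auto intro!: Bochner_Integration.integrable_bound[OF assms(1)] elim!: eventually_mono)

lemma L2_add: assumes "f \<in> L2" "g \<in> L2" shows "(\<lambda>z. f z + g z) \<in> L2"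
  by (rule L2_bound[where G="\<lambda>z. 2 * (cmod (f z))\<^sup>2 + 2 * (cmod (g z))\<^sup>2"])
    (use assms in \<open>auto simp: L2_integrable_sq intro: cmod_add_sq_le dest: L2D\<close>)

lemma L2_bounded_mult:
  assumes "f \<in> L2" "g \<in> Linf" shows "(\<lambda>z. g z * f z) \<in> L2"
proof -
  obtain C where C: "C > 0" "AE z in circle. cmod (g z) \<le> C" using LinfE[OF assms(2)] .
  show ?thesis
  proof (rule L2_bound[where G="\<lambda>z. C\<^sup>2 * (cmod (f z))\<^sup>2"])
    show "AE z in circle. (cmod (g z * f z))\<^sup>2 \<le> C\<^sup>2 * (cmod (f z))\<^sup>2"
      using C(2)
    proof eventually_elim
      case (elim z)
      have "(cmod (g z))\<^sup>2 \<le> C\<^sup>2" by (rule power_mono[OF elim]) simp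
      then show ?case by (simp add: norm_mult power_mult_distrib mult_right_mono)
    qed
  qed (use assms in \<open>auto simp: L2_integrable_sq dest: L2D LinfD\<close>)
qed

lemma const_Linf: "(\<lambda>z. c) \<in> Linf"
  by (auto simp: Linf_def intro!: exI[of _ "cmod c"])

lemma powi_Linf: "(\<lambda>z. z powi k) \<in> Linf"
  by (auto simp: Linf_def norm_powi_circle intro!: exI[of _ 1] AE_circleI)

lemma power_Linf: "(\<lambda>z. z ^ k) \<in> Linf"
  by (auto simp: Linf_def norm_power intro!: exI[of _ 1] AE_circleI)

lemma Linf_mult: assumes "f \<in> Linf" "g \<in> Linf" shows "(\<lambda>z. f z * g z) \<in> Linf"
proof -
  obtain C where C: "C > 0" "AE z in circle. cmod (f z) \<le> C" using LinfE[OF assms(1)] .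
  obtain D where D: "D > 0" "AE z in circle. cmod (g z) \<le> D" using LinfE[OF assms(2)] .
  have "AE z in circle. cmod (f z * g z) \<le> C * D"
    using C(2) D(2) by eventually_elim (use C D in \<open>auto simp: norm_mult intro!: mult_mono\<close>)
  then show ?thesis using assms by (auto simp: Linf_def)
qed

lemma Linf_add: assumes "f \<in> Linf" "g \<in> Linf" shows "(\<lambda>z. f z + g z) \<in> Linf"
proof -
  obtain C where C: "C > 0" "AE z in circle. cmod (f z) \<le> C" using LinfE[OF assms(1)] .
  obtain D where D: "D > 0" "AE z in circle. cmod (g z) \<le> D" using LinfE[OF assms(2)] .
  have "AE z in circle. cmod (f z + g z) \<le> C + D"
    using C(2) D(2) by eventually_elim (meson add_mono norm_triangle_ineq order_trans)
  then show ?thesis using assms by (auto simp: Linf_def)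
qed

lemma Linf_cmult: "f \<in> Linf \<Longrightarrow> (\<lambda>z. c * f z) \<in> Linf"
  using Linf_mult[OF const_Linf] .

lemma Linf_diff: "f \<in> Linf \<Longrightarrow> g \<in> Linf \<Longrightarrow> (\<lambda>z. f z - g z) \<in> Linf"
  using Linf_add[OF _ Linf_cmult[of g "-1"], of f] by simp

lemma Linf_sum: "(\<And>i. i \<in> I \<Longrightarrow> f i \<in> Linf) \<Longrightarrow> (\<lambda>z. \<Sum>i\<in>I. f i z) \<in> Linf"
  by (induction I rule: infinite_finite_induct) (auto simp: const_Linf Linf_add)

lemma Linf_subset_L2: "f \<in> Linf \<Longrightarrow> f \<in> L2"
proof -
  assume f: "f \<in> Linf"
  have "(\<lambda>z. 1) \<in> L2" by (simp add: L2_def)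
  from L2_bounded_mult[OF this f] show ?thesis by simp
qed

lemma L2_cmult: "f \<in> L2 \<Longrightarrow> (\<lambda>z. c * f z) \<in> L2"
  using L2_bounded_mult[OF _ const_Linf] .

lemma L2_diff: "f \<in> L2 \<Longrightarrow> g \<in> L2 \<Longrightarrow> (\<lambda>z. f z - g z) \<in> L2"
  using L2_add[OF _ L2_cmult[of g "-1"], of f] by simp

lemma cnj_measurable [measurable (raw)]:
  "f \<in> borel_measurable M \<Longrightarrow> (\<lambda>x. cnj (f x)) \<in> borel_measurable M"
  by (rule measurable_compose[of f M borel]) (auto intro: borel_measurable_continuous_onI continuous_intros)

lemma L2_cnj: "f \<in> L2 \<Longrightarrow> (\<lambda>z. cnj (f z)) \<in> L2"
  by (auto simp: L2_def)

lemma L2_integrable_mult: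
  assumes "f \<in> L2" "g \<in> L2" shows "integrable circle (\<lambda>z. f z * g z)"
proof (rule Bochner_Integration.integrable_bound)
  show "integrable circle (\<lambda>z. (cmod (f z))\<^sup>2 + (cmod (g z))\<^sup>2)" using assms by (auto simp: L2_def)
  show "AE z in circle. norm (f z * g z) \<le> norm ((cmod (f z))\<^sup>2 + (cmod (g z))\<^sup>2)"
  proof (rule AE_I2)
    fix z
    have "2 * (cmod (f z) * cmod (g z)) \<le> (cmod (f z))\<^sup>2 + (cmod (g z))\<^sup>2"
      using sum_squares_bound[of "cmod (f z)" "cmod (g z)"] by simp
    moreover have "0 \<le> cmod (f z) * cmod (g z)" by simp
    ultimately show "norm (f z * g z) \<le> norm ((cmod (f z))\<^sup>2 + (cmod (g z))\<^sup>2)"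
      unfolding norm_mult real_norm_def by linarith
  qed
qed (use assms in measurable)

lemma L2_integrable: "f \<in> L2 \<Longrightarrow> integrable circle f"
  using L2_integrable_mult[of f "\<lambda>z. 1"] by (simp add: Linf_subset_L2 const_Linf)

text \<open>
  The form of the Cauchy--Schwarz inequality before optimizing the weight $s$. It suffices for limits:
  with $s = 2^k$ it is small as soon as the square norm of the first factor is at most $4^{-k}$.
\<close>

lemma l2_weighted_Cauchy_Schwarz:
  assumes f: "f \<in> L2" and g: "g \<in> L2" and s: "s > 0"
  shows "cmod (LINT z|circle. f z * g z) \<le> s * l2sq f + l2sq g / s"
proof -
  have "cmod (LINT z|circle. f z * g z) \<le> (LINT z|circle. s * (cmod (f z))\<^sup>2 + (cmod (g z))\<^sup>2 / s)"
  proof (rule order_trans[OF integral_norm_bound integral_mono])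
    fix z
    define a b where "a = sqrt s * cmod (f z)" and "b = cmod (g z) / sqrt s"
    have "2 * (a * b) \<le> a\<^sup>2 + b\<^sup>2" using sum_squares_bound[of a b] by simp
    moreover have "a * b = cmod (f z * g z)" using s by (simp add: a_def b_def norm_mult)
    moreover have "a\<^sup>2 = s * (cmod (f z))\<^sup>2" "b\<^sup>2 = (cmod (g z))\<^sup>2 / s"
      using s by (auto simp: a_def b_def power_mult_distrib power_divide)
    ultimately show "norm (f z * g z) \<le> s * (cmod (f z))\<^sup>2 + (cmod (g z))\<^sup>2 / s"
      using norm_ge_zero[of "f z * g z"] by linarith
  qed (use L2_integrable_mult[OF f g] L2_integrable_sq[OF f] L2_integrable_sq[OF g] in auto)
  also have "\<dots> = s * l2sq f + l2sq g / s"
    using L2_integrable_sq[OF f] L2_integrable_sq[OF g] by (simp add: l2sq_def)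
  finally show ?thesis .
qed

text \<open>
  Completeness of $L^2$, together with an integrable function $G$ that dominates the whole sequence.
  By $|d| \le 2^{-k} + 2^k |d|^2$, the series of the increments is dominated by the sum of the
  geometric series and of $\sum_k 2^k |f_{k+1} - f_k|^2$, which is integrable. So $G$ comes without any
  use of the triangle inequality in $L^2$.
\<close>

lemma L2_rapid_Cauchy:
  fixes f :: "nat \<Rightarrow> complex \<Rightarrow> complex"
  assumes f: "\<And>k. f k \<in> L2" and C: "\<And>j k. k \<le> j \<Longrightarrow> l2sq (\<lambda>z. f j z - f k z) \<le> (1/4) ^ k"
  obtains F G where "F \<in> L2" "integrable circle G" "AE z in circle. (\<lambda>k. f k z) \<longlonglongrightarrow> F z"
    "AE z in circle. \<forall>k. cmod (f k z) \<le> G z" "\<And>k. l2sq (\<lambda>z. F z - f k z) \<le> (1/4) ^ k"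
proof -
  have [measurable]: "f k \<in> borel_measurable circle" for k using f by (rule L2D)
  define u where "u k z = 2 ^ k * (cmod (f (Suc k) z - f k z))\<^sup>2" for k z
  have um [measurable]: "u k \<in> borel_measurable circle" for k unfolding u_def by measurable
  have u0: "u k z \<ge> 0" for k z by (simp add: u_def)
  have ui: "integrable circle (u k)" for k
    unfolding u_def using L2_integrable_sq[OF L2_diff[OF f f]] by auto
  have ub: "(LINT z|circle. u k z) \<le> (1/2) ^ k" for k
  proof -
    have "(LINT z|circle. u k z) = 2 ^ k * l2sq (\<lambda>z. f (Suc k) z - f k z)" by (simp add: u_def l2sq_def)
    also have "\<dots> \<le> 2 ^ k * (1/4) ^ k" by (intro mult_left_mono C) auto
    also have "\<dots> = (1/2) ^ k" by (simp add: power_mult_distrib[symmetric])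
    finally show ?thesis .
  qed
  have "(\<integral>\<^sup>+z. (\<Sum>k. ennreal (u k z)) \<partial>circle) = (\<Sum>k. \<integral>\<^sup>+z. ennreal (u k z) \<partial>circle)"
    by (rule nn_integral_suminf) auto
  also have "\<dots> \<le> (\<Sum>k. ennreal ((1/2) ^ k))"
    by (intro suminf_le) (auto simp: nn_integral_eq_integral[OF ui] u0 intro!: ennreal_leI ub)
  also have "\<dots> = ennreal (\<Sum>k. (1/2) ^ k)"
    by (intro suminf_ennreal2) auto
  finally have fin: "(\<integral>\<^sup>+z. (\<Sum>k. ennreal (u k z)) \<partial>circle) \<noteq> \<infinity>"
    by (auto simp: top_unique)
  have "AE z in circle. (\<Sum>k. ennreal (u k z)) \<noteq> \<infinity>"
    by (rule nn_integral_PInf_AE[OF _ fin]) auto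
  then have sumu: "AE z in circle. summable (\<lambda>k. u k z)"
    by eventually_elim (rule summable_suminf_not_top, auto simp: u0)
  define G where "G z = cmod (f 0 z) + 2 + (\<Sum>k. u k z)" for z
  have Gi: "integrable circle G"
  proof -
    have "summable (\<lambda>k. LINT z|circle. norm (u k z))"
      by (rule summable_comparison_test'[of "\<lambda>k. (1/2)^k"]) (auto simp: u0 intro!: ub)
    then have "integrable circle (\<lambda>z. \<Sum>k. u k z)"
      by (intro integrable_suminf ui) (use sumu in \<open>auto simp: u0\<close>)
    then show ?thesis unfolding G_def using L2_integrable[OF f] by auto
  qed
  have step: "cmod (f (Suc k) z - f k z) \<le> (1/2) ^ k + u k z" for k z
  proof -
    define x where "x = cmod (f (Suc k) z - f k z)"
    have "0 \<le> (1 - 2 ^ k * x)\<^sup>2" by simp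
    then have "2 * (2 ^ k * x) \<le> 1 + 2 ^ k * (2 ^ k * x\<^sup>2)"
      by (simp add: power2_eq_square algebra_simps)
    also have "\<dots> = 2 ^ k * ((1/2) ^ k + 2 ^ k * x\<^sup>2)"
      by (simp add: ring_distribs power_mult_distrib[symmetric])
    finally have "2 * x \<le> (1/2) ^ k + 2 ^ k * x\<^sup>2" by simp
    moreover have "0 \<le> x" by (simp add: x_def)
    ultimately have "x \<le> (1/2) ^ k + 2 ^ k * x\<^sup>2" by linarith
    then show ?thesis by (simp add: u_def x_def)
  qed
  define F where "F z = lim (\<lambda>k. f k z)" for z
  have Fm [measurable]: "F \<in> borel_measurable circle" unfolding F_def by measurable
  have both: "AE z in circle. (\<lambda>k. f k z) \<longlonglongrightarrow> F z \<and> (\<forall>k. cmod (f k z) \<le> G z)"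
    using sumu
  proof eventually_elim
    case (elim z)
    have s1: "summable (\<lambda>k. (1/2) ^ k + u k z)" by (intro summable_add elim summable_geometric) simp
    have s2: "summable (\<lambda>k. f (Suc k) z - f k z)"
      by (rule summable_comparison_test'[OF s1, of 0]) (rule step)
    have tel: "(\<Sum>k<N. f (Suc k) z - f k z) = f N z - f 0 z" for N
      by (rule sum_lessThan_telescope)
    have "(\<lambda>N. f N z - f 0 z) \<longlonglongrightarrow> (\<Sum>k. f (Suc k) z - f k z)"
      using summable_LIMSEQ[OF s2] by (simp add: tel)
    then have "(\<lambda>N. f N z - f 0 z + f 0 z) \<longlonglongrightarrow> (\<Sum>k. f (Suc k) z - f k z) + f 0 z"
      by (intro tendsto_add tendsto_const)
    then have "convergent (\<lambda>k. f k z)" by (auto simp: convergent_def)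
    then have 1: "(\<lambda>k. f k z) \<longlonglongrightarrow> F z" by (simp add: F_def convergent_LIMSEQ_iff)
    have "cmod (f N z) \<le> G z" for N
    proof -
      have "cmod (f N z) \<le> cmod (f 0 z) + cmod (\<Sum>k<N. f (Suc k) z - f k z)"
        unfolding tel using norm_triangle_ineq[of "f 0 z" "f N z - f 0 z"] by simp
      also have "cmod (\<Sum>k<N. f (Suc k) z - f k z) \<le> (\<Sum>k<N. (1/2) ^ k + u k z)"
        by (rule sum_norm_le) (rule step)
      also have "\<dots> \<le> (\<Sum>k. (1/2) ^ k + u k z)"
        by (rule sum_le_suminf[OF s1]) (auto simp: u0)
      also have "\<dots> = (\<Sum>k. (1/2) ^ k) + (\<Sum>k. u k z)"
        by (rule suminf_add[symmetric]) (auto intro: elim)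
      also have "(\<Sum>k. (1/2::real) ^ k) = 2" by (simp add: suminf_geometric)
      finally show ?thesis by (simp add: G_def)
    qed
    then show ?case using 1 by auto
  qed
  \<comment> \<open>The rate of convergence passes to the limit by the lemma of Fatou.\<close>
  have fat: "(\<integral>\<^sup>+z. ennreal ((cmod (F z - f k z))\<^sup>2) \<partial>circle) \<le> ennreal ((1/4) ^ k)" for k
  proof -
    have "(\<integral>\<^sup>+z. ennreal ((cmod (F z - f k z))\<^sup>2) \<partial>circle)
        = (\<integral>\<^sup>+z. liminf (\<lambda>j. ennreal ((cmod (f j z - f k z))\<^sup>2)) \<partial>circle)"
    proof (rule nn_integral_cong_AE)
      show "AE z in circle. ennreal ((cmod (F z - f k z))\<^sup>2) = liminf (\<lambda>j. ennreal ((cmod (f j z - f k z))\<^sup>2))"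
        using both
      proof eventually_elim
        case (elim z)
        have "(\<lambda>j. ennreal ((cmod (f j z - f k z))\<^sup>2)) \<longlonglongrightarrow> ennreal ((cmod (F z - f k z))\<^sup>2)"
          using elim by (intro tendsto_ennrealI tendsto_intros) auto
        then show ?case by (metis lim_imp_Liminf trivial_limit_sequentially)
      qed
    qed
    also have "\<dots> \<le> liminf (\<lambda>j. \<integral>\<^sup>+z. ennreal ((cmod (f j z - f k z))\<^sup>2) \<partial>circle)"
      by (rule nn_integral_liminf) measurable
    also have "\<dots> \<le> liminf (\<lambda>j::nat. ennreal ((1/4) ^ k))"
    proof (rule Liminf_mono, rule eventually_sequentiallyI)
      fix j assume "k \<le> j"
      then show "(\<integral>\<^sup>+z. ennreal ((cmod (f j z - f k z))\<^sup>2) \<partial>circle) \<le> ennreal ((1/4) ^ k)"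
        using C[of k j] L2_integrable_sq[OF L2_diff[OF f f], of j k]
        by (subst nn_integral_eq_integral) (auto simp: l2sq_def intro!: ennreal_leI)
    qed
    also have "\<dots> = ennreal ((1/4) ^ k)" by (simp add: Liminf_const)
    finally show ?thesis .
  qed
  have Fk: "(\<lambda>z. F z - f k z) \<in> L2" for k
    unfolding L2_def
    using order_le_less_trans[OF fat[of k] ennreal_less_top] by (auto intro!: integrableI_bounded)
  have "F \<in> L2" using L2_add[OF Fk[of 0] f[of 0]] by simp
  moreover have "l2sq (\<lambda>z. F z - f k z) \<le> (1/4) ^ k" for k
    using fat[of k] L2_integrable_sq[OF Fk[of k]] unfolding l2sq_def
    by (subst (asm) nn_integral_eq_integral) auto
  ultimately show ?thesis using that[of F G] Gi both by (auto elim: eventually_mono)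
qed

lemma l2_inner_tendsto:
  assumes F: "F \<in> L2" and f: "\<And>k. f k \<in> L2" and C: "\<And>k. l2sq (\<lambda>z. F z - f k z) \<le> (1/4) ^ k" and g: "g \<in> L2"
  shows "(\<lambda>k. LINT z|circle. f k z * g z) \<longlonglongrightarrow> (LINT z|circle. F z * g z)"
proof -
  have "(\<lambda>k. (LINT z|circle. F z * g z) - (LINT z|circle. f k z * g z)) \<longlonglongrightarrow> 0"
  proof (rule Lim_null_comparison)
    have "norm ((LINT z|circle. F z * g z) - (LINT z|circle. f k z * g z)) \<le> (1 + l2sq g) * (1/2) ^ k" for k
    proof -
      have "(LINT z|circle. F z * g z) - (LINT z|circle. f k z * g z) = (LINT z|circle. (F z - f k z) * g z)"
        by (simp add: left_diff_distrib L2_integrable_mult F f g)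
      also have "norm \<dots> \<le> 2 ^ k * l2sq (\<lambda>z. F z - f k z) + l2sq g / 2 ^ k"
        by (rule l2_weighted_Cauchy_Schwarz[OF L2_diff[OF F f] g]) simp
      also have "\<dots> \<le> 2 ^ k * (1/4) ^ k + l2sq g / 2 ^ k" by (intro add_right_mono mult_left_mono C) simp
      also have "2 ^ k * (1/4) ^ k = (1/2::real) ^ k" by (simp add: power_mult_distrib[symmetric])
      also have "(1/2) ^ k + l2sq g / 2 ^ k = (1 + l2sq g) * (1/2) ^ k" by (simp add: power_one_over field_simps)
      finally show ?thesis .
    qed
    then show "\<forall>\<^sub>F k in sequentially. norm ((LINT z|circle. F z * g z) - (LINT z|circle. f k z * g z)) \<le> (1 + l2sq g) * (1/2) ^ k"
      by simp
    show "(\<lambda>k. (1 + l2sq g) * (1/2) ^ k :: real) \<longlonglongrightarrow> 0"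
      by (rule tendsto_mult_right_zero) (rule LIMSEQ_power_zero, simp)
  qed
  then have "(\<lambda>k. (LINT z|circle. F z * g z) - ((LINT z|circle. F z * g z) - (LINT z|circle. f k z * g z)))
      \<longlonglongrightarrow> (LINT z|circle. F z * g z) - 0"
    by (intro tendsto_diff tendsto_const)
  then show ?thesis by simp
qed

section \<open>Fourier series in $L^2$\<close>

definition trig_poly :: "(int \<Rightarrow> complex) \<Rightarrow> int set \<Rightarrow> complex \<Rightarrow> complex" where
  "trig_poly a K z = (\<Sum>k\<in>K. a k * z powi k)"

lemma trig_poly_Linf: "trig_poly a K \<in> Linf"
  unfolding trig_poly_def by (intro Linf_sum Linf_cmult powi_Linf)

lemma trig_poly_L2: "trig_poly a K \<in> L2"
  by (intro Linf_subset_L2 trig_poly_Linf)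

lemma cnj_powi_circle: "cmod z = 1 \<Longrightarrow> cnj (z powi k) = z powi (- k)"
proof -
  assume z: "cmod z = 1"
  have "cnj (z powi k) = inverse (z powi k)" using z by (intro cnj_circle norm_powi_circle)
  then show ?thesis by (simp add: power_int_minus)
qed

lemma fourier_coeff_powi: "fourier_coeff (\<lambda>z. z powi k) j = (if j = k then 1 else 0)"
proof -
  have "fourier_coeff (\<lambda>z. z powi k) j = fourier_coeff (\<lambda>z. z powi k * 1) j" by simp
  also have "\<dots> = fourier_coeff (\<lambda>z. 1) (j - k)" by (rule fourier_coeff_powi_mult)
  also have "\<dots> = (LINT z|circle. z powi (k - j))" by (simp add: fourier_coeff_def)
  finally show ?thesis by (simp add: integral_powi)
qed

lemma fourier_coeff_trig_poly:
  "finite K \<Longrightarrow> fourier_coeff (trig_poly a K) j = (if j \<in> K then a j else 0)"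
proof (induction K rule: finite_induct)
  case empty
  then show ?case by (simp add: trig_poly_def fourier_coeff_def)
next
  case (insert k K)
  have "trig_poly a (insert k K) = (\<lambda>z. a k * z powi k + trig_poly a K z)"
    using insert by (auto simp: trig_poly_def)
  moreover have "integrable circle (\<lambda>z. a k * z powi k)" 
    by (intro L2_integrable Linf_subset_L2 Linf_cmult powi_Linf)
  moreover have "integrable circle (trig_poly a K)" by (intro L2_integrable trig_poly_L2)
  ultimately have "fourier_coeff (trig_poly a (insert k K)) j
      = fourier_coeff (\<lambda>z. a k * z powi k) j + fourier_coeff (trig_poly a K) j"
    by (simp add: fourier_coeff_add)
  then show ?case using insert by (auto simp: fourier_coeff_cmult fourier_coeff_powi)
qed

lemma integral_mult_cnj_trig_poly:
  assumes "integrable circle f"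
  shows "(LINT z|circle. f z * cnj (trig_poly a K z)) = (\<Sum>k\<in>K. cnj (a k) * fourier_coeff f k)"
proof -
  have "(LINT z|circle. f z * cnj (trig_poly a K z)) = (LINT z|circle. (\<Sum>k\<in>K. cnj (a k) * (f z * z powi (- k))))"
    by (intro Bochner_Integration.integral_cong refl)
       (simp add: trig_poly_def sum_distrib_left cnj_powi_circle mult_ac del: complex_cnj_power_int)
  also have "\<dots> = (\<Sum>k\<in>K. cnj (a k) * (LINT z|circle. f z * z powi (- k)))"
    using integrable_powi_mult[OF assms] by simp
  finally show ?thesis by (simp add: fourier_coeff_def)
qed

lemma cmod_diff_sq: "(cmod (a - b))\<^sup>2 = (cmod a)\<^sup>2 - 2 * Re (a * cnj b) + (cmod b)\<^sup>2"
  by (simp only: cmod_power2) (simp add: power2_eq_square algebra_simps)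

lemma l2sq_diff:
  assumes "f \<in> L2" "g \<in> L2"
  shows "l2sq (\<lambda>z. f z - g z) = l2sq f - 2 * Re (LINT z|circle. f z * cnj (g z)) + l2sq g"
proof -
  have "integrable circle (\<lambda>z. f z * cnj (g z))" by (intro L2_integrable_mult assms L2_cnj)
  then have "Re (LINT z|circle. f z * cnj (g z)) = (LINT z|circle. Re (f z * cnj (g z)))"
    and "integrable circle (\<lambda>z. Re (f z * cnj (g z)))" by (auto simp del: times_complex.sel)
  then show ?thesis
    using L2_integrable_sq[OF assms(1)] L2_integrable_sq[OF assms(2)]
    by (simp add: l2sq_def cmod_diff_sq del: times_complex.sel)
qed

lemma l2sq_trig_poly:
  assumes "finite K" shows "l2sq (trig_poly a K) = (\<Sum>k\<in>K. (cmod (a k))\<^sup>2)"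
proof -
  have "complex_of_real (l2sq (trig_poly a K)) = (LINT z|circle. complex_of_real ((cmod (trig_poly a K z))\<^sup>2))"
    unfolding l2sq_def by (rule integral_complex_of_real[symmetric])
  also have "\<dots> = (LINT z|circle. trig_poly a K z * cnj (trig_poly a K z))"
    by (simp only: complex_norm_square)
  also have "\<dots> = (\<Sum>k\<in>K. cnj (a k) * a k)"
    using assms by (simp add: integral_mult_cnj_trig_poly L2_integrable trig_poly_L2 fourier_coeff_trig_poly)
  also have "\<dots> = complex_of_real (\<Sum>k\<in>K. (cmod (a k))\<^sup>2)"
    by (simp only: of_real_sum complex_norm_square mult.commute)
  finally show ?thesis using of_real_eq_iff by blast
qed

lemma l2sq_diff_fourier_sum:
  assumes "f \<in> L2" "finite K"
  shows "l2sq (\<lambda>z. f z - trig_poly (fourier_coeff f) K z) = l2sq f - (\<Sum>k\<in>K. (cmod (fourier_coeff f k))\<^sup>2)"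
proof -
  have "(LINT z|circle. f z * cnj (trig_poly (fourier_coeff f) K z))
      = complex_of_real (\<Sum>k\<in>K. (cmod (fourier_coeff f k))\<^sup>2)"
    unfolding integral_mult_cnj_trig_poly[OF L2_integrable[OF assms(1)]]
    by (simp only: of_real_sum complex_norm_square mult.commute)
  then show ?thesis
    using assms by (simp add: l2sq_diff trig_poly_L2 l2sq_trig_poly)
qed

abbreviation sym_range :: "nat \<Rightarrow> int set" where
  "sym_range N \<equiv> {- int N..int N}"

abbreviation fourier_sum :: "(complex \<Rightarrow> complex) \<Rightarrow> nat \<Rightarrow> complex \<Rightarrow> complex" where
  "fourier_sum f N \<equiv> trig_poly (fourier_coeff f) (sym_range N)"

lemma Bessel:
  assumes "f \<in> L2" "finite K" shows "(\<Sum>k\<in>K. (cmod (fourier_coeff f k))\<^sup>2) \<le> l2sq f"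
  using l2sq_diff_fourier_sum[OF assms] l2sq_nonneg[of "\<lambda>z. f z - trig_poly (fourier_coeff f) K z"] by simp

lemma fourier_coeff_limit:
  assumes "F \<in> L2" "\<And>k. f k \<in> L2" "\<And>k. l2sq (\<lambda>z. F z - f k z) \<le> (1/4) ^ k"
  shows "(\<lambda>k. fourier_coeff (f k) j) \<longlonglongrightarrow> fourier_coeff F j"
  unfolding fourier_coeff_def by (rule l2_inner_tendsto[OF assms Linf_subset_L2[OF powi_Linf]])

text \<open>
  Partial sums along indices that grow quickly enough converge at the rate $4^{-k}$, hence also
  almost everywhere and under an integrable bound.
\<close>

lemma Riesz_Fischer:
  assumes B: "\<And>N. (\<Sum>k\<in>sym_range N. (cmod (a k))\<^sup>2) \<le> B"
  obtains F r G where "F \<in> L2" "\<And>k. fourier_coeff F k = a k" "integrable circle G"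
    "AE z in circle. (\<lambda>k. trig_poly a (sym_range (r k)) z) \<longlonglongrightarrow> F z"
    "AE z in circle. \<forall>k. cmod (trig_poly a (sym_range (r k)) z) \<le> G z"
    "\<And>k. l2sq (\<lambda>z. F z - trig_poly a (sym_range (r k)) z) \<le> (1/4) ^ k"
proof -
  define b where "b N = (\<Sum>k\<in>sym_range N. (cmod (a k))\<^sup>2)" for N
  have inc: "incseq b" unfolding b_def by (intro incseq_SucI sum_mono2) auto
  obtain L where L: "b \<longlonglongrightarrow> L" "\<And>N. b N \<le> L"
    using incseq_convergent[OF inc, of B] B unfolding b_def by auto
  have "\<exists>N0. \<forall>N\<ge>N0. L - b N \<le> (1/4) ^ k" for k
  proof -
    have "\<forall>\<^sub>F N in sequentially. L - (1/4) ^ k < b N" by (rule order_tendstoD(1)[OF L(1)]) simp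
    then show ?thesis unfolding eventually_sequentially by force
  qed
  then obtain N0 where N0: "\<And>k N. N \<ge> N0 k \<Longrightarrow> L - b N \<le> (1/4) ^ k" by metis
  \<comment> \<open>The partial sums of \<open>N0\<close> are monotone and still exceed \<open>N0 k\<close>; adding \<open>k\<close> makes
    every frequency occur eventually.\<close>
  define r where "r k = (\<Sum>i\<le>k. N0 i) + k" for k
  have r_mono: "r k \<le> r j" if "k \<le> j" for k j
    unfolding r_def using that by (intro add_mono sum_mono2) auto
  have rN0: "N0 k \<le> r k" for k
    using member_le_sum[of k "{..k}" N0] by (simp add: r_def)
  define S where "S k = trig_poly a (sym_range (r k))" for k
  have SL: "S k \<in> L2" for k unfolding S_def by (rule trig_poly_L2)
  have C: "l2sq (\<lambda>z. S j z - S k z) \<le> (1/4) ^ k" if "k \<le> j" for j k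
  proof -
    have sub: "sym_range (r k) \<subseteq> sym_range (r j)" using r_mono[OF that] by auto
    have "(\<lambda>z. S j z - S k z) = trig_poly a (sym_range (r j) - sym_range (r k))"
      using sub by (auto simp: S_def trig_poly_def sum_diff)
    then have "l2sq (\<lambda>z. S j z - S k z) = (\<Sum>k\<in>sym_range (r j) - sym_range (r k). (cmod (a k))\<^sup>2)"
      by (simp add: l2sq_trig_poly)
    also have "\<dots> = b (r j) - b (r k)" unfolding b_def using sub by (simp add: sum_diff)
    also have "\<dots> \<le> (1/4) ^ k" using N0[OF rN0[of k]] L(2)[of "r j"] by linarith
    finally show ?thesis .
  qed
  obtain F G where FG: "F \<in> L2" "integrable circle G" "AE z in circle. (\<lambda>k. S k z) \<longlonglongrightarrow> F z"
    "AE z in circle. \<forall>k. cmod (S k z) \<le> G z" "\<And>k. l2sq (\<lambda>z. F z - S k z) \<le> (1/4) ^ k"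
    by (rule L2_rapid_Cauchy[OF SL C]) (assumption, rule that)
  have "fourier_coeff F j = a j" for j
  proof -
    have lim: "(\<lambda>k. fourier_coeff (S k) j) \<longlonglongrightarrow> fourier_coeff F j"
      by (rule fourier_coeff_limit[OF FG(1) SL FG(5)])
    have "\<forall>k\<ge>nat \<bar>j\<bar>. fourier_coeff (S k) j = a j"
    proof (intro allI impI)
      fix k assume "nat \<bar>j\<bar> \<le> k"
      then have "nat \<bar>j\<bar> \<le> r k" by (simp add: r_def)
      then have "j \<in> sym_range (r k)" by auto
      then show "fourier_coeff (S k) j = a j" by (simp add: S_def fourier_coeff_trig_poly)
    qed
    then have "(\<lambda>k. fourier_coeff (S k) j) \<longlonglongrightarrow> a j"
      by (intro tendsto_eventually) (auto simp: eventually_sequentially)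
    with lim show ?thesis by (rule LIMSEQ_unique)
  qed
  then show ?thesis using that[of F G r] FG by (simp add: S_def)
qed

lemma fourier_coeff_eq_imp_AE_eq:
  assumes "integrable circle f" "integrable circle g" "\<And>k. fourier_coeff f k = fourier_coeff g k"
  shows "AE z in circle. f z = g z"
  using fourier_uniqueness[of "\<lambda>z. f z - g z"] assms by (simp add: fourier_coeff_diff)

lemma l2sq_cong:
  assumes "f \<in> borel_measurable circle" "g \<in> borel_measurable circle" "AE z in circle. f z = g z"
  shows "l2sq f = l2sq g"
  unfolding l2sq_def using assms by (intro integral_cong_AE) (auto elim!: eventually_mono)

lemma L2_fourier_series_subsequence:
  assumes f: "f \<in> L2"
  obtains r G where "integrable circle G"
    "AE z in circle. (\<lambda>k. fourier_sum f (r k) z) \<longlonglongrightarrow> f z"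
    "AE z in circle. \<forall>k. cmod (fourier_sum f (r k) z) \<le> G z"
    "\<And>k. l2sq (\<lambda>z. f z - fourier_sum f (r k) z) \<le> (1/4) ^ k"
proof -
  obtain F r G where F: "F \<in> L2" "\<And>k. fourier_coeff F k = fourier_coeff f k" "integrable circle G"
    "AE z in circle. (\<lambda>k. fourier_sum f (r k) z) \<longlonglongrightarrow> F z"
    "AE z in circle. \<forall>k. cmod (fourier_sum f (r k) z) \<le> G z"
    "\<And>k. l2sq (\<lambda>z. F z - fourier_sum f (r k) z) \<le> (1/4) ^ k"
    by (rule Riesz_Fischer[OF Bessel[OF f finite_atLeastAtMost_int]]) (rule that)
  have eq: "AE z in circle. F z = f z"
    using F f by (intro fourier_coeff_eq_imp_AE_eq L2_integrable) auto
  have "l2sq (\<lambda>z. f z - fourier_sum f (r k) z) = l2sq (\<lambda>z. F z - fourier_sum f (r k) z)" for k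
    using eq F(1) f trig_poly_L2 by (intro l2sq_cong) (auto elim: eventually_mono intro!: borel_measurable_diff L2D)
  moreover have "AE z in circle. (\<lambda>k. fourier_sum f (r k) z) \<longlonglongrightarrow> f z"
    using F(4) eq by eventually_elim simp
  ultimately show ?thesis using that[OF F(3) _ F(5)] F(6) by simp
qed

lemma L2_fourier_series_tendsto:
  assumes f: "f \<in> L2"
  shows "(\<lambda>N. l2sq (\<lambda>z. f z - fourier_sum f N z)) \<longlonglongrightarrow> 0"
proof (rule LIMSEQ_I)
  fix e :: real assume e: "0 < e"
  obtain r G where "integrable circle G"
    "AE z in circle. (\<lambda>k. fourier_sum f (r k) z) \<longlonglongrightarrow> f z"
    "AE z in circle. \<forall>k. cmod (fourier_sum f (r k) z) \<le> G z"
    and r: "\<And>k. l2sq (\<lambda>z. f z - fourier_sum f (r k) z) \<le> (1/4) ^ k"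
    by (rule L2_fourier_series_subsequence[OF f]) (rule that)
  obtain k where k: "(1/4::real) ^ k < e" using real_arch_pow_inv[OF e, of "1/4"] by auto
  have "l2sq (\<lambda>z. f z - fourier_sum f N z) < e" if "N \<ge> r k" for N
  proof -
    have "(\<Sum>i\<in>sym_range (r k). (cmod (fourier_coeff f i))\<^sup>2) \<le> (\<Sum>i\<in>sym_range N. (cmod (fourier_coeff f i))\<^sup>2)"
      by (rule sum_mono2) (use that in auto)
    then show ?thesis using r[of k] k by (simp add: l2sq_diff_fourier_sum[OF f])
  qed
  then show "\<exists>no. \<forall>N\<ge>no. norm (l2sq (\<lambda>z. f z - fourier_sum f N z) - 0) < e"
    using l2sq_nonneg by (auto intro!: exI[of _ "r k"])
qed

section \<open>Fejer means and analytic completion\<close>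

lemma Cesaro_null:
  fixes x :: "nat \<Rightarrow> real"
  assumes x: "x \<longlonglongrightarrow> 0"
  shows "(\<lambda>N. (\<Sum>k\<le>N. x k) / real (Suc N)) \<longlonglongrightarrow> 0"
proof (rule LIMSEQ_I)
  fix e :: real assume e: "0 < e"
  obtain K where K: "\<And>k. k \<ge> K \<Longrightarrow> \<bar>x k\<bar> < e / 2"
    using LIMSEQ_D[OF x, of "e/2"] e by auto
  define B where "B = (\<Sum>k<K. \<bar>x k\<bar>)"
  have B0: "B \<ge> 0" by (simp add: B_def)
  obtain M where M: "2 * B / e < real M" using reals_Archimedean2 by blast
  have "\<bar>(\<Sum>k\<le>N. x k) / real (Suc N)\<bar> < e" if "N \<ge> M" for N
  proof -
    have "\<bar>\<Sum>k\<le>N. x k\<bar> \<le> (\<Sum>k\<le>N. \<bar>x k\<bar>)" by (rule sum_abs)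
    also have "\<dots> \<le> (\<Sum>k\<le>N. (if k < K then \<bar>x k\<bar> else 0) + e / 2)"
      using K e by (intro sum_mono) (auto simp: less_imp_le)
    also have "\<dots> = (\<Sum>k\<le>N. if k < K then \<bar>x k\<bar> else 0) + real (Suc N) * (e / 2)"
      by (simp add: sum.distrib)
    also have "(\<Sum>k\<le>N. if k < K then \<bar>x k\<bar> else 0) \<le> B"
    proof -
      have "(\<Sum>k\<le>N. if k < K then \<bar>x k\<bar> else 0) = (\<Sum>k\<in>{..N} \<inter> {..<K}. \<bar>x k\<bar>)"
        by (simp add: sum.inter_restrict)
      also have "\<dots> \<le> B" unfolding B_def by (rule sum_mono2) auto
      finally show ?thesis .
    qed
    finally have 1: "\<bar>\<Sum>k\<le>N. x k\<bar> \<le> B + real (Suc N) * (e / 2)" by simp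
    have "2 * B < e * real (Suc N)"
    proof -
      have "2 * B < e * real M" using M e by (simp add: field_simps)
      also have "\<dots> \<le> e * real (Suc N)" using that e by (intro mult_left_mono) auto
      finally show ?thesis .
    qed
    moreover have "real (Suc N) * (e / 2) = e * real (Suc N) / 2" by simp
    ultimately have "\<bar>\<Sum>k\<le>N. x k\<bar> < e * real (Suc N)" using 1 by linarith
    then show ?thesis by (simp add: abs_divide pos_divide_less_eq)
  qed
  then show "\<exists>no. \<forall>N\<ge>no. norm ((\<Sum>k\<le>N. x k) / real (Suc N) - 0) < e"
    by (auto intro!: exI[of _ M])
qed

text \<open>
  The coefficients of the power series whose partial sums have the Dirichlet kernels as real parts.
\<close>

definition dirichlet_weight :: "nat \<Rightarrow> complex" where
  "dirichlet_weight j = (if j = 0 then 1 else 2)"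

text \<open>
  The sum of the first Dirichlet kernels is a square, so Fejer means of nonnegative functions are
  nonnegative.
\<close>

lemma fejer_kernel:
  assumes x: "cmod x = 1"
  shows "(\<Sum>k\<le>N. Re (\<Sum>j\<le>k. dirichlet_weight j * x ^ j)) = (cmod (\<Sum>k\<le>N. x ^ k))\<^sup>2"
proof (induction N)
  case 0
  then show ?case by (simp add: dirichlet_weight_def)
next
  case (Suc N)
  define P where "P = (\<Sum>k\<le>N. x ^ k)"
  have D: "(\<Sum>j\<le>k. dirichlet_weight j * x ^ j) = 1 + 2 * (\<Sum>j<k. x ^ Suc j)" for k
    unfolding sum.atMost_shift by (simp add: dirichlet_weight_def sum_distrib_left)
  have 1: "x ^ Suc N * cnj P = (\<Sum>j\<le>N. x ^ Suc j)"
  proof -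
    have "x ^ Suc N * cnj P = (\<Sum>k\<le>N. x ^ Suc N * cnj x ^ k)"
      by (simp add: P_def sum_distrib_left)
    also have "\<dots> = (\<Sum>k\<le>N. x ^ Suc (N - k))"
    proof (rule sum.cong)
      fix k assume "k \<in> {..N}"
      then have "x ^ Suc N = x ^ Suc (N - k) * x ^ k" unfolding power_add[symmetric] by simp
      moreover have "x ^ k * cnj x ^ k = 1"
        using x complex_norm_square[of x] by (simp flip: power_mult_distrib)
      ultimately show "x ^ Suc N * cnj x ^ k = x ^ Suc (N - k)" by (simp only: mult.assoc mult_1_right)
    qed simp
    also have "\<dots> = (\<Sum>j\<le>N. x ^ Suc j)"
      using sum.nat_diff_reindex[of "\<lambda>j. x ^ Suc j" "Suc N"] by (simp only: lessThan_Suc_atMost diff_Suc_Suc)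
    finally show ?thesis .
  qed
  have "(cmod (P + x ^ Suc N))\<^sup>2 = (cmod P)\<^sup>2 + 2 * Re (x ^ Suc N * cnj P) + 1"
    using cmod_diff_sq[of "x ^ Suc N" "- P"] x by (simp add: norm_power norm_mult add.commute)
  also have "\<dots> = (cmod P)\<^sup>2 + Re (\<Sum>j\<le>Suc N. dirichlet_weight j * x ^ j)"
    unfolding D 1 by (simp add: lessThan_Suc_atMost)
  finally show ?case using Suc.IH by (simp add: P_def)
qed

lemma sum_sum_le_swap:
  fixes x :: "nat \<Rightarrow> complex"
  shows "(\<Sum>k\<le>N. \<Sum>j\<le>k. x j) = (\<Sum>j\<le>N. of_nat (Suc N - j) * x j)"
proof (induction N)
  case (Suc N)
  have "(\<Sum>j\<le>N. of_nat (Suc (Suc N) - j) * x j) = (\<Sum>j\<le>N. of_nat (Suc N - j) * x j + x j)"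
    by (intro sum.cong) (auto simp: Suc_diff_le algebra_simps)
  then show ?case by (simp only: sum.atMost_Suc Suc.IH sum.distrib) simp
qed simp

lemma trig_poly_nonneg_freq:
  assumes "\<And>k. k < 0 \<Longrightarrow> a k = 0"
  shows "trig_poly a (sym_range N) z = (\<Sum>j\<le>N. a (int j) * z ^ j)"
proof -
  have "trig_poly a (sym_range N) z = (\<Sum>k\<in>int ` {..N}. a k * z powi k)"
    unfolding trig_poly_def
  proof (rule sum.mono_neutral_right)
    show "\<forall>i\<in>sym_range N - int ` {..N}. a i * z powi i = 0"
    proof
      fix i assume i: "i \<in> sym_range N - int ` {..N}"
      have "i < 0"
      proof (rule ccontr)
        assume "\<not> i < 0"
        then have "i = int (nat i)" "nat i \<le> N" using i by auto
        then show False using i by (metis DiffD2 atMost_iff imageI)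
      qed
      then show "a i * z powi i = 0" using assms by simp
    qed
  qed auto
  also have "\<dots> = (\<Sum>j\<le>N. a (int j) * z ^ j)"
    by (subst sum.reindex) (auto simp: inj_on_def)
  finally show ?thesis .
qed

lemma fourier_coeff_cnj: "fourier_coeff (\<lambda>z. cnj (f z)) k = cnj (fourier_coeff f (- k))"
proof -
  have "cnj (fourier_coeff f (- k)) = (LINT z|circle. cnj (f z * z powi k))"
    by (simp add: fourier_coeff_def del: complex_cnj_mult)
  also have "\<dots> = fourier_coeff (\<lambda>z. cnj (f z)) k"
    unfolding fourier_coeff_def
    by (intro Bochner_Integration.integral_cong refl) (simp add: cnj_powi_circle del: complex_cnj_power_int)
  finally show ?thesis by simp
qed

text \<open>
  The function $F \in H^2$ with real part $v$: its coefficients are $c_0$ and $2c_j$ for $j > 0$, where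
  $c_j$ are those of $v$. The partial sums converge to $F$ in $L^2$, but their real parts have no sign.
  Their Cesaro means still converge in $L^2$, and their real parts are the Fejer means of $v$, hence
  nonnegative. This sign is what makes the exponentials of $-P_k$ bounded by 1. Only frequencies of
  $v$ occur in the $P_k$.
\<close>

lemma analytic_completion:
  fixes v :: "complex \<Rightarrow> real"
  assumes vm [measurable]: "v \<in> borel_measurable circle" and v0: "\<And>z. v z \<ge> 0"
    and v2: "integrable circle (\<lambda>z. (v z)\<^sup>2)"
  obtains F P d b where "F \<in> borel_measurable circle" "AE z in circle. Re (F z) = v z"
    "AE z in circle. (\<lambda>k. P k z) \<longlonglongrightarrow> F z" "\<And>k z. cmod z = 1 \<Longrightarrow> Re (P k z) \<ge> 0"
    "\<And>k::nat. P k = (\<lambda>z. \<Sum>j\<le>d k. b k j * z ^ j)"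
    "\<And>k j. fourier_coeff (\<lambda>z. of_real (v z)) (int j) = 0 \<Longrightarrow> b k j = 0"
proof -
  define w where "w z = complex_of_real (v z)" for z
  have w: "w \<in> L2" using v2 unfolding L2_def w_def by auto
  define c where "c = fourier_coeff w"
  have c_cnj: "cnj (c (- k)) = c k" for k
  proof -
    have "(\<lambda>z. cnj (w z)) = w" by (simp add: w_def fun_eq_iff)
    then show ?thesis using fourier_coeff_cnj[of w k] by (simp add: c_def)
  qed
  define a where "a k = (if k < 0 then 0 else if k = 0 then c 0 else 2 * c k)" for k
  have aB: "(\<Sum>k\<in>sym_range N. (cmod (a k))\<^sup>2) \<le> 4 * l2sq w" for N
  proof -
    have "(\<Sum>k\<in>sym_range N. (cmod (a k))\<^sup>2) \<le> (\<Sum>k\<in>sym_range N. 4 * (cmod (c k))\<^sup>2)"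
      by (intro sum_mono) (auto simp: a_def norm_mult power_mult_distrib)
    also have "\<dots> \<le> 4 * l2sq w"
      using Bessel[OF w, of "sym_range N"] by (simp add: c_def flip: sum_distrib_left)
    finally show ?thesis .
  qed
  obtain F r G where FF: "F \<in> L2" "\<And>k. fourier_coeff F k = a k" "integrable circle G"
    "AE z in circle. (\<lambda>k. trig_poly a (sym_range (r k)) z) \<longlonglongrightarrow> F z"
    "AE z in circle. \<forall>k. cmod (trig_poly a (sym_range (r k)) z) \<le> G z"
    "\<And>k. l2sq (\<lambda>z. F z - trig_poly a (sym_range (r k)) z) \<le> (1/4) ^ k"
    by (rule Riesz_Fischer[OF aB]) (rule that)
  have aF: "fourier_coeff F = a" using FF(2) by auto
  have Fm [measurable]: "F \<in> borel_measurable circle" using FF(1) by (rule L2D)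
  have "AE z in circle. F z + cnj (F z) = 2 * w z"
  proof (rule fourier_coeff_eq_imp_AE_eq)
    show "integrable circle (\<lambda>z. F z + cnj (F z))" "integrable circle (\<lambda>z. 2 * w z)"
      by (intro L2_integrable L2_add L2_cnj L2_cmult FF(1) w)+
    fix k
    have "fourier_coeff (\<lambda>z. F z + cnj (F z)) k = a k + cnj (a (- k))"
      by (subst fourier_coeff_add) (auto intro: L2_integrable L2_cnj FF simp: fourier_coeff_cnj FF(2) simp del: integrable_cnj)
    also have "\<dots> = 2 * c k" using c_cnj[of k] by (auto simp: a_def)
    finally show "fourier_coeff (\<lambda>z. F z + cnj (F z)) k = fourier_coeff (\<lambda>z. 2 * w z) k"
      by (simp add: fourier_coeff_cmult c_def)
  qed
  then have ReF: "AE z in circle. Re (F z) = v z"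
    by eventually_elim (simp add: w_def complex_eq_iff)
  define A where "A N z = (\<Sum>j\<le>N. a (int j) * z ^ j)" for N z
  have A_trig: "A N z = trig_poly a (sym_range N) z" for N z
    unfolding A_def by (rule trig_poly_nonneg_freq[symmetric]) (simp add: a_def)
  have "A N = trig_poly a (sym_range N)" for N by (rule ext) (rule A_trig)
  then have AL: "A N \<in> L2" for N by (simp add: trig_poly_L2)
  define V where "V N z = (\<Sum>k\<le>N. A k z) / of_nat (Suc N)" for N z
  have V_eq: "V N z = (\<Sum>j\<le>N. (of_nat (Suc N - j) / of_nat (Suc N) * a (int j)) * z ^ j)" for N z
    unfolding V_def A_def sum_sum_le_swap by (simp add: sum_divide_distrib mult_ac)
  have Vm [measurable]: "V N \<in> borel_measurable circle" for N unfolding V_eq by measurable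
  have err: "(LINT z|circle. (cmod (F z - V N z))\<^sup>2) \<le> (\<Sum>k\<le>N. l2sq (\<lambda>z. F z - A k z)) / real (Suc N)"
    and erri: "integrable circle (\<lambda>z. (cmod (F z - V N z))\<^sup>2)" for N
  proof -
    have "F z - V N z = (\<Sum>k<Suc N. F z - A k z) / of_nat (Suc N)" for z
      by (simp add: V_def lessThan_Suc_atMost sum_subtractf diff_divide_distrib del: of_nat_Suc)
    then have pt: "(cmod (F z - V N z))\<^sup>2 \<le> (\<Sum>k\<le>N. (cmod (F z - A k z))\<^sup>2) / real (Suc N)" for z
      using cmod_mean_sq_le[of "Suc N" "\<lambda>k. F z - A k z"]
      by (simp add: lessThan_Suc_atMost del: of_nat_Suc)
    have i: "integrable circle (\<lambda>z. (cmod (F z - A k z))\<^sup>2)" for k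
      by (rule L2_integrable_sq) (intro L2_diff FF AL)
    have i2: "integrable circle (\<lambda>z. (\<Sum>k\<le>N. (cmod (F z - A k z))\<^sup>2) / real (Suc N))" using i by auto
    show e: "integrable circle (\<lambda>z. (cmod (F z - V N z))\<^sup>2)"
      by (rule Bochner_Integration.integrable_bound[OF i2]) (use pt in \<open>auto simp: abs_of_nonneg sum_nonneg simp del: of_nat_Suc\<close>)
    have "(LINT z|circle. (cmod (F z - V N z))\<^sup>2) \<le> (LINT z|circle. (\<Sum>k\<le>N. (cmod (F z - A k z))\<^sup>2) / real (Suc N))"
      by (rule integral_mono[OF e i2]) (rule pt)
    also have "\<dots> = (\<Sum>k\<le>N. l2sq (\<lambda>z. F z - A k z)) / real (Suc N)"
      using i by (simp add: l2sq_def del: of_nat_Suc)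
    finally show "(LINT z|circle. (cmod (F z - V N z))\<^sup>2) \<le> (\<Sum>k\<le>N. l2sq (\<lambda>z. F z - A k z)) / real (Suc N)" .
  qed
  have "(\<lambda>k. l2sq (\<lambda>z. F z - A k z)) \<longlonglongrightarrow> 0"
    using L2_fourier_series_tendsto[OF FF(1)] by (simp add: A_trig aF)
  from Cesaro_null[OF this] have lim0: "(\<lambda>N. LINT z|circle. norm ((cmod (F z - V N z))\<^sup>2)) \<longlonglongrightarrow> 0"
    by (rule tendsto_sandwich[rotated 2, OF tendsto_const]) (use err in \<open>auto simp del: of_nat_Suc\<close>)
  obtain s where s: "strict_mono s" "AE z in circle. (\<lambda>n. (cmod (F z - V (s n) z))\<^sup>2) \<longlonglongrightarrow> 0"
    using tendsto_L1_AE_subseq[OF erri lim0] by auto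
  have VF: "AE z in circle. (\<lambda>n. V (s n) z) \<longlonglongrightarrow> F z"
    using s(2)
  proof eventually_elim
    case (elim z)
    have "(\<lambda>n. sqrt ((cmod (F z - V (s n) z))\<^sup>2)) \<longlonglongrightarrow> sqrt 0" by (intro tendsto_intros elim)
    then have "(\<lambda>n. norm (F z - V (s n) z)) \<longlonglongrightarrow> 0" by simp
    then have "(\<lambda>n. F z - V (s n) z) \<longlonglongrightarrow> 0" by (rule tendsto_norm_zero_cancel)
    then have "(\<lambda>n. F z - (F z - V (s n) z)) \<longlonglongrightarrow> F z - 0" by (intro tendsto_diff tendsto_const)
    then show ?case by simp
  qed
  have pos: "Re (V N z) \<ge> 0" if z: "cmod z = 1" for N z
  proof -
    have A_int: "Re (A k z) = (LINT y|circle. v y * Re (\<Sum>j\<le>k. dirichlet_weight j * (z * inverse y) ^ j))"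
      and i_int: "integrable circle (\<lambda>y. v y * Re (\<Sum>j\<le>k. dirichlet_weight j * (z * inverse y) ^ j))" for k
    proof -
      have i: "integrable circle (\<lambda>y. w y * y powi (- int j))" for j
        by (intro integrable_powi_mult L2_integrable w)
      have "A k z = (\<Sum>j\<le>k. (dirichlet_weight j * z ^ j) * (LINT y|circle. w y * y powi (- int j)))"
        unfolding A_def by (intro sum.cong) (auto simp: a_def c_def dirichlet_weight_def fourier_coeff_def)
      also have "\<dots> = (LINT y|circle. (\<Sum>j\<le>k. (dirichlet_weight j * z ^ j) * (w y * y powi (- int j))))"
        using i by simp
      also have "(\<lambda>y. \<Sum>j\<le>k. (dirichlet_weight j * z ^ j) * (w y * y powi (- int j)))
          = (\<lambda>y. w y * (\<Sum>j\<le>k. dirichlet_weight j * (z * inverse y) ^ j))"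
        by (simp add: sum_distrib_left power_mult_distrib power_int_minus power_inverse mult_ac)
      finally have 1: "A k z = (LINT y|circle. w y * (\<Sum>j\<le>k. dirichlet_weight j * (z * inverse y) ^ j))" .
      have "integrable circle (\<lambda>y. (\<Sum>j\<le>k. (dirichlet_weight j * z ^ j) * (w y * y powi (- int j))))"
        using i by auto
      also have "(\<lambda>y. \<Sum>j\<le>k. (dirichlet_weight j * z ^ j) * (w y * y powi (- int j)))
          = (\<lambda>y. w y * (\<Sum>j\<le>k. dirichlet_weight j * (z * inverse y) ^ j))"
        by (simp add: sum_distrib_left power_mult_distrib power_int_minus power_inverse mult_ac)
      finally have 2: "integrable circle (\<lambda>y. w y * (\<Sum>j\<le>k. dirichlet_weight j * (z * inverse y) ^ j))" .
      have 3: "Re (w y * (\<Sum>j\<le>k. dirichlet_weight j * (z * inverse y) ^ j)) = v y * Re (\<Sum>j\<le>k. dirichlet_weight j * (z * inverse y) ^ j)" for y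
        by (simp add: w_def del: Re_sum)
      show "Re (A k z) = (LINT y|circle. v y * Re (\<Sum>j\<le>k. dirichlet_weight j * (z * inverse y) ^ j))"
        unfolding 1 integral_Re[OF 2, symmetric] 3 ..
      show "integrable circle (\<lambda>y. v y * Re (\<Sum>j\<le>k. dirichlet_weight j * (z * inverse y) ^ j))"
        using integrable_Re[OF 2] unfolding 3 .
    qed
    have "Re (\<Sum>k\<le>N. A k z) = (LINT y|circle. (\<Sum>k\<le>N. v y * Re (\<Sum>j\<le>k. dirichlet_weight j * (z * inverse y) ^ j)))"
      unfolding Re_sum[of "\<lambda>k. A k z"] A_int
      by (rule Bochner_Integration.integral_sum[symmetric]) (rule i_int)
    also have "\<dots> \<ge> 0"
    proof (rule integral_nonneg_AE, rule AE_circleI)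
      fix y :: complex assume "cmod y = 1"
      then have "cmod (z * inverse y) = 1" using z by (simp add: norm_mult norm_inverse)
      from fejer_kernel[OF this, of N]
      show "0 \<le> (\<Sum>k\<le>N. v y * Re (\<Sum>j\<le>k. dirichlet_weight j * (z * inverse y) ^ j))"
        unfolding sum_distrib_left[symmetric] using v0[of y] by simp
    qed
    finally have "0 \<le> Re (\<Sum>k\<le>N. A k z)" .
    then show ?thesis by (simp add: V_def Re_divide_of_nat del: of_nat_Suc Re_sum)
  qed
  show ?thesis
  proof (rule that[of F "\<lambda>n. V (s n)" "\<lambda>n j. of_nat (Suc (s n) - j) / of_nat (Suc (s n)) * a (int j)" s])
    show "V (s k) = (\<lambda>z. \<Sum>j\<le>s k. (of_nat (Suc (s k) - j) / of_nat (Suc (s k)) * a (int j)) * z ^ j)" for k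
      by (rule ext) (rule V_eq)
    show "of_nat (Suc (s k) - j) / of_nat (Suc (s k)) * a (int j) = 0"
      if "fourier_coeff (\<lambda>z. of_real (v z)) (int j) = 0" for k j
    proof -
      have "fourier_coeff w (int j) = 0" using that by (simp add: w_def[abs_def])
      then show ?thesis by (auto simp: a_def c_def)
    qed
  qed (use Fm ReF VF pos in auto)
qed

section \<open>Averaging over the rotations by roots of unity\<close>

definition unit_root :: "nat \<Rightarrow> complex" where
  "unit_root n = cis (2 * pi / real n)"

lemma norm_unit_root [simp]: "cmod (unit_root n) = 1"
  by (simp add: unit_root_def)

lemma norm_unit_root_power [simp]: "cmod (unit_root n ^ i) = 1"
  by (simp add: norm_power)

lemma unit_root_power_self: "n \<ge> 1 \<Longrightarrow> unit_root n ^ n = 1"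
  unfolding unit_root_def Complex.DeMoivre by simp

lemma unit_root_powi_eq_1_iff:
  assumes "n \<ge> 1" shows "unit_root n powi j = 1 \<longleftrightarrow> int n dvd j"
proof -
  have "unit_root n powi j = cis (2 * pi * (of_int j / real n))"
    by (simp add: unit_root_def cis_power_int field_simps)
  also have "\<dots> = 1 \<longleftrightarrow> (\<exists>k::int. of_int j / real n = of_int k)"
  proof -
    have "cis (2 * pi * x) = 1 \<longleftrightarrow> (\<exists>k::int. x = of_int k)" for x :: real
    proof -
      have "cis (2 * pi * x) = 1 \<longleftrightarrow> cos (2 * pi * x) = 1"
        by (auto simp: complex_eq_iff cos_one_sin_zero)
      also have "\<dots> \<longleftrightarrow> (\<exists>k::int. 2 * pi * x = of_int k * 2 * pi)" by (simp add: cos_one_2pi_int)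
      finally show ?thesis by simp
    qed
    then show ?thesis .
  qed
  also have "\<dots> \<longleftrightarrow> int n dvd j"
  proof -
    have "of_int j / real n = of_int k \<longleftrightarrow> j = int n * k" for k
    proof -
      have "of_int j / real n = of_int k \<longleftrightarrow> (of_int j :: real) = of_int (int n * k)"
        using assms by (simp add: field_simps)
      then show ?thesis by (simp only: of_int_eq_iff)
    qed
    then show ?thesis by (auto simp: dvd_def)
  qed
  finally show ?thesis .
qed

lemma sum_unit_root_powi:
  assumes n: "n \<ge> 1"
  shows "(\<Sum>i<n. (unit_root n ^ i) powi j) = (if int n dvd j then of_nat n else 0)"
proof -
  define x where "x = unit_root n powi j"
  have eq: "(unit_root n ^ i) powi j = x ^ i" for i
    by (simp add: x_def power_int_def power_mult[symmetric] mult.commute power_inverse)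
  have xn: "x ^ n = 1"
    using eq[of n] unit_root_power_self[OF n] by simp
  show ?thesis
  proof (cases "int n dvd j")
    case True
    then have "x = 1" using unit_root_powi_eq_1_iff[OF n] by (simp add: x_def)
    then show ?thesis using True by (simp add: eq)
  next
    case False
    then have "x \<noteq> 1" using unit_root_powi_eq_1_iff[OF n] by (simp add: x_def)
    then show ?thesis using False xn by (simp add: eq sum_gp_strict)
  qed
qed

definition rot_avg :: "nat \<Rightarrow> (complex \<Rightarrow> complex) \<Rightarrow> complex \<Rightarrow> complex" where
  "rot_avg n f z = (\<Sum>i<n. f (unit_root n ^ i * z)) / of_nat n"

lemma rot_avg_measurable [measurable]:
  assumes f: "f \<in> borel_measurable circle" shows "rot_avg n f \<in> borel_measurable circle"
proof -
  have "(\<lambda>z. f (unit_root n ^ i * z)) \<in> borel_measurable circle" for i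
    by (rule rotate_measurable[OF norm_unit_root_power f])
  then show ?thesis unfolding rot_avg_def[abs_def] by simp
qed

lemma Linf_rotate: "f \<in> Linf \<Longrightarrow> cmod w = 1 \<Longrightarrow> (\<lambda>z. f (w * z)) \<in> Linf"
  unfolding Linf_def using AE_rotate by (fastforce intro: rotate_measurable)

lemma rot_avg_Linf: "f \<in> Linf \<Longrightarrow> rot_avg n f \<in> Linf"
proof -
  assume f: "f \<in> Linf"
  have "(\<lambda>z. (1 / of_nat n) * (\<Sum>i<n. f (unit_root n ^ i * z))) \<in> Linf"
    by (intro Linf_cmult Linf_sum Linf_rotate f norm_unit_root_power)
  then show ?thesis by (simp add: rot_avg_def[abs_def])
qed

lemma rot_avg_integrable:
  assumes f: "integrable circle f" shows "integrable circle (rot_avg n f)"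
proof -
  have "integrable circle (\<lambda>z. f (unit_root n ^ i * z))" for i
    by (rule integrable_rotate[OF norm_unit_root_power f])
  then show ?thesis unfolding rot_avg_def[abs_def] by simp
qed

lemma rot_avg_cong_AE:
  assumes "AE z in circle. f z = g z" shows "AE z in circle. rot_avg n f z = rot_avg n g z"
proof -
  have "AE z in circle. \<forall>i. f (unit_root n ^ i * z) = g (unit_root n ^ i * z)"
    unfolding AE_all_countable by (auto intro: AE_rotate assms)
  then show ?thesis by eventually_elim (simp add: rot_avg_def)
qed

lemma rot_avg_sq_le:
  "n \<ge> 1 \<Longrightarrow> (cmod (rot_avg n f z))\<^sup>2 \<le> (\<Sum>i<n. (cmod (f (unit_root n ^ i * z)))\<^sup>2) / real n"
  unfolding rot_avg_def by (rule cmod_mean_sq_le)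

lemma rot_avg_L2:
  assumes f: "f \<in> L2" and n: "n \<ge> 1"
  shows "rot_avg n f \<in> L2" "l2sq (rot_avg n f) \<le> l2sq f"
proof -
  have i: "integrable circle (\<lambda>z. (cmod (f (unit_root n ^ i * z)))\<^sup>2)" for i
    by (rule integrable_rotate[OF norm_unit_root_power L2_integrable_sq[OF f]])
  have i2: "integrable circle (\<lambda>z. (\<Sum>i<n. (cmod (f (unit_root n ^ i * z)))\<^sup>2) / real n)"
    using i by auto
  show L: "rot_avg n f \<in> L2"
    by (rule L2_bound[OF i2]) (use f rot_avg_sq_le[OF n] in \<open>auto dest: L2D\<close>)
  have "l2sq (rot_avg n f) \<le> (LINT z|circle. (\<Sum>i<n. (cmod (f (unit_root n ^ i * z)))\<^sup>2) / real n)"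
    unfolding l2sq_def by (rule integral_mono[OF L2_integrable_sq[OF L] i2]) (rule rot_avg_sq_le[OF n])
  also have "\<dots> = (\<Sum>i<n. LINT z|circle. (cmod (f (unit_root n ^ i * z)))\<^sup>2) / real n"
    using i by simp
  also have "\<dots> = (\<Sum>i<n. l2sq f) / real n"
  proof -
    have "(\<lambda>z. (cmod (f z))\<^sup>2) \<in> borel_measurable circle" using L2D[OF f] by simp
    from integral_rotate[OF norm_unit_root_power this] show ?thesis by (simp add: l2sq_def)
  qed
  finally show "l2sq (rot_avg n f) \<le> l2sq f" using n by simp
qed

lemma rot_avg_trig_poly:
  assumes n: "n \<ge> 1" and fin: "finite K"
  shows "rot_avg n (trig_poly a K) z = trig_poly a {k \<in> K. int n dvd k} z"
proof -
  have "rot_avg n (trig_poly a K) z = (\<Sum>i<n. \<Sum>k\<in>K. a k * z powi k * (unit_root n ^ i) powi k) / of_nat n"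
    by (simp only: rot_avg_def trig_poly_def power_int_mult_distrib mult_ac)
  also have "(\<Sum>i<n. \<Sum>k\<in>K. a k * z powi k * (unit_root n ^ i) powi k) = (\<Sum>k\<in>K. a k * z powi k * (\<Sum>i<n. (unit_root n ^ i) powi k))"
    by (subst sum.swap) (simp only: sum_distrib_left)
  also have "\<dots> / of_nat n = (\<Sum>k\<in>K. if int n dvd k then a k * z powi k else 0)"
    unfolding sum_unit_root_powi[OF n] sum_divide_distrib using n by (intro sum.cong) auto
  also have "\<dots> = trig_poly a {k \<in> K. int n dvd k} z"
    unfolding trig_poly_def using fin by (rule sum.inter_filter[symmetric])
  finally show ?thesis .
qed

section \<open>Rotationally symmetric norms on bounded functions\<close>

locale continuous_rot_sym_norm =
  fixes \<alpha> :: "(complex \<Rightarrow> complex) \<Rightarrow> real"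
  assumes rsn: "rot_sym_norm \<alpha>" and cnorm: "continuous_norm \<alpha>"
begin

lemma alpha_nonneg: "f \<in> Linf \<Longrightarrow> 0 \<le> \<alpha> f"
  and alpha_eq_0_iff: "f \<in> Linf \<Longrightarrow> \<alpha> f = 0 \<longleftrightarrow> (AE z in circle. f z = 0)"
  and alpha_cmult: "f \<in> Linf \<Longrightarrow> \<alpha> (\<lambda>z. c * f z) = cmod c * \<alpha> f"
  and alpha_triangle: "f \<in> Linf \<Longrightarrow> g \<in> Linf \<Longrightarrow> \<alpha> (\<lambda>z. f z + g z) \<le> \<alpha> f + \<alpha> g"
  and alpha_one: "\<alpha> (\<lambda>z. 1) = 1"
  and alpha_abs: "f \<in> Linf \<Longrightarrow> \<alpha> (\<lambda>z. complex_of_real (cmod (f z))) = \<alpha> f"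
  and alpha_rotate_cnj: "f \<in> Linf \<Longrightarrow> cmod w = 1 \<Longrightarrow> \<alpha> (\<lambda>z. f (cnj w * z)) = \<alpha> f"
  using rsn unfolding rot_sym_norm_def by auto

lemma alpha_AE_cong:
  assumes f: "f \<in> Linf" and g: "g \<in> Linf" and eq: "AE z in circle. f z = g z"
  shows "\<alpha> f = \<alpha> g"
proof -
  have le: "\<alpha> f \<le> \<alpha> g" if "f \<in> Linf" "g \<in> Linf" "AE z in circle. f z = g z" for f g
  proof -
    have d: "(\<lambda>z. f z - g z) \<in> Linf" using that Linf_diff by blast
    have "\<alpha> (\<lambda>z. f z - g z) = 0" using that(3) by (subst alpha_eq_0_iff[OF d]) auto
    then show ?thesis using alpha_triangle[OF that(2) d] by simp
  qed
  have "AE z in circle. g z = f z" using eq by eventually_elim simp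
  then show ?thesis using le[OF f g eq] le[OF g f] by simp
qed

lemma alpha_unimodular_mult:
  assumes f: "f \<in> Linf" and u: "u \<in> borel_measurable circle" "\<And>z. cmod (u z) = 1"
  shows "\<alpha> (\<lambda>z. u z * f z) = \<alpha> f"
proof -
  have "u \<in> Linf" using u by (auto simp: Linf_def intro!: exI[of _ 1])
  then have "(\<lambda>z. u z * f z) \<in> Linf" using f by (rule Linf_mult)
  from alpha_abs[OF this] show ?thesis using alpha_abs[OF f] u(2) by (simp add: norm_mult)
qed

text \<open>
  A complex number of modulus at most 1 is the mean of two unimodular numbers, $\rho \pm i
  \sqrt{1-\rho^2}$ for real $\rho$. So $|f| = \rho |g|$ is the mean of two functions of the same norm as $g$.
\<close>

lemma alpha_mono:
  assumes f: "f \<in> Linf" and g: "g \<in> Linf" and le: "AE z in circle. cmod (f z) \<le> cmod (g z)"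
  shows "\<alpha> f \<le> \<alpha> g"
proof -
  have [measurable]: "f \<in> borel_measurable circle" "g \<in> borel_measurable circle" using f g by (auto dest: LinfD)
  define \<rho> where "\<rho> z = min 1 (cmod (f z) / cmod (g z))" for z
  have r: "0 \<le> \<rho> z" "\<rho> z \<le> 1" for z by (auto simp: \<rho>_def)
  define u where "u z = complex_of_real (\<rho> z) + \<i> * complex_of_real (sqrt (1 - (\<rho> z)\<^sup>2))" for z
  have [measurable]: "\<rho> \<in> borel_measurable circle" unfolding \<rho>_def by measurable
  have um [measurable]: "u \<in> borel_measurable circle" unfolding u_def by measurable
  have u1: "cmod (u z) = 1" for z
  proof -
    have "(\<rho> z)\<^sup>2 \<le> 1" using r[of z] by (simp add: power_le_one)
    then show ?thesis by (simp add: u_def cmod_def)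
  qed
  have cu: "u z + cnj (u z) = 2 * complex_of_real (\<rho> z)" for z by (simp add: u_def complex_eq_iff)
  define g' where "g' z = complex_of_real (cmod (g z))" for z
  have [measurable]: "g' \<in> borel_measurable circle" unfolding g'_def[abs_def] by measurable
  have g': "g' \<in> Linf" using g by (auto simp: Linf_def g'_def)
  have f': "(\<lambda>z. complex_of_real (cmod (f z))) \<in> Linf" using f by (auto simp: Linf_def)
  have uL: "u \<in> Linf" "(\<lambda>z. cnj (u z)) \<in> Linf" using um u1 by (auto simp: Linf_def intro!: exI[of _ 1])
  have h: "(\<lambda>z. u z * ((1/2) * g' z)) \<in> Linf" "(\<lambda>z. cnj (u z) * ((1/2) * g' z)) \<in> Linf"
    by (intro Linf_mult uL Linf_cmult g')+
  have "\<alpha> f = \<alpha> (\<lambda>z. complex_of_real (cmod (f z)))" by (rule alpha_abs[OF f, symmetric])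
  also have "\<dots> = \<alpha> (\<lambda>z. u z * ((1/2) * g' z) + cnj (u z) * ((1/2) * g' z))"
  proof (rule alpha_AE_cong[OF f' Linf_add[OF h]])
    show "AE z in circle. complex_of_real (cmod (f z)) = u z * ((1/2) * g' z) + cnj (u z) * ((1/2) * g' z)"
      using le
    proof eventually_elim
      case (elim z)
      have "cmod (f z) = \<rho> z * cmod (g z)"
        using elim by (cases "g z = 0") (auto simp: \<rho>_def min_def divide_le_eq)
      moreover have "u z * ((1/2) * g' z) + cnj (u z) * ((1/2) * g' z) = (u z + cnj (u z)) * ((1/2) * g' z)"
        by (simp only: ring_distribs)
      ultimately show ?case unfolding cu by (simp add: g'_def)
    qed
  qed
  also have "\<dots> \<le> \<alpha> (\<lambda>z. u z * ((1/2) * g' z)) + \<alpha> (\<lambda>z. cnj (u z) * ((1/2) * g' z))"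
    by (rule alpha_triangle[OF h])
  also have "\<dots> = \<alpha> (\<lambda>z. (1/2) * g' z) + \<alpha> (\<lambda>z. (1/2) * g' z)"
    by (intro arg_cong2[where f="(+)"] alpha_unimodular_mult Linf_cmult g') (auto simp: u1)
  also have "\<dots> = \<alpha> g'" by (simp only: alpha_cmult[OF g']) simp
  also have "\<dots> = \<alpha> g" unfolding g'_def by (rule alpha_abs[OF g])
  finally show ?thesis .
qed

lemma alpha_const: "\<alpha> (\<lambda>z. c) = cmod c"
  using alpha_cmult[OF const_Linf[of 1], of c] alpha_one by simp

lemma alpha_le_bound:
  assumes "f \<in> Linf" "AE z in circle. cmod (f z) \<le> C" "C \<ge> 0" shows "\<alpha> f \<le> C"
proof -
  have "\<alpha> f \<le> \<alpha> (\<lambda>z. of_real C)" using assms by (intro alpha_mono const_Linf) auto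
  then show ?thesis using assms by (simp add: alpha_const)
qed

lemma indicator_Linf: "E \<in> sets circle \<Longrightarrow> indicator E \<in> Linf"
  by (auto simp: Linf_def indicator_def intro!: exI[of _ 1])

text \<open>
  Split at the set where $|f_k| > e/2$: its measure tends to 0, so $\alpha$ of its indicator does, and
  elsewhere $f_k$ is uniformly small.
\<close>

lemma alpha_bounded_convergence:
  fixes f :: "nat \<Rightarrow> complex \<Rightarrow> complex"
  assumes fm [measurable]: "\<And>k. f k \<in> borel_measurable circle"
    and C: "\<And>k. AE z in circle. cmod (f k z) \<le> C"
    and lim: "AE z in circle. (\<lambda>k. f k z) \<longlonglongrightarrow> 0"
  shows "(\<lambda>k. \<alpha> (f k)) \<longlonglongrightarrow> 0"
proof (rule LIMSEQ_I)
  fix e :: real assume e: "0 < e"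
  define D where "D = \<bar>C\<bar> + 1"
  have D: "D > 0" "\<And>k. AE z in circle. cmod (f k z) \<le> D"
  proof -
    show "AE z in circle. cmod (f k z) \<le> D" for k
      using C[of k] by eventually_elim (simp add: D_def)
  qed (simp add: D_def)
  have fL: "f k \<in> Linf" for k using fm C by (auto simp: Linf_def)
  define E where "E k = {z \<in> space circle. e / 2 < cmod (f k z)}" for k
  have Em [measurable]: "E k \<in> sets circle" for k unfolding E_def by measurable
  have "(\<lambda>k. LINT z|circle. indicator (E k) z :: real) \<longlonglongrightarrow> (LINT z|circle. 0)"
  proof (rule integral_dominated_convergence[where w="\<lambda>z. 1"])
    show "AE z in circle. (\<lambda>k. indicator (E k) z :: real) \<longlonglongrightarrow> 0"
      using lim
    proof eventually_elim
      case (elim z)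
      have "\<forall>\<^sub>F k in sequentially. cmod (f k z) < e / 2"
        using order_tendstoD(2)[OF tendsto_norm_zero[OF elim], of "e/2"] e by simp
      then have "\<forall>\<^sub>F k in sequentially. indicator (E k) z = (0::real)"
        by eventually_elim (auto simp: E_def)
      then show ?case by (rule tendsto_eventually)
    qed
  qed (auto simp: indicator_def)
  moreover have "E k \<inter> sphere 0 1 = E k" for k by (auto simp: E_def)
  ultimately have "(\<lambda>k. measure circle (E k)) \<longlonglongrightarrow> 0" by simp
  then have "(\<lambda>k. \<alpha> (indicator (E k))) \<longlonglongrightarrow> 0"
    using cnorm Em unfolding continuous_norm_def by blast
  then have "\<forall>\<^sub>F k in sequentially. \<alpha> (indicator (E k)) < e / (2 * D)"
    using e D by (intro order_tendstoD(2)) auto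
  then obtain K where K: "\<And>k. k \<ge> K \<Longrightarrow> \<alpha> (indicator (E k)) < e / (2 * D)"
    by (auto simp: eventually_sequentially)
  have "\<alpha> (f k) < e" if "k \<ge> K" for k
  proof -
    have h: "(\<lambda>z. complex_of_real (e/2)) \<in> Linf" "(\<lambda>z. complex_of_real D * indicator (E k) z) \<in> Linf"
      by (intro const_Linf Linf_cmult indicator_Linf Em)+
    have "\<alpha> (f k) \<le> \<alpha> (\<lambda>z. complex_of_real (e/2) + complex_of_real D * indicator (E k) z)"
    proof (rule alpha_mono[OF fL Linf_add[OF h]])
      show "AE z in circle. cmod (f k z) \<le> cmod (complex_of_real (e/2) + complex_of_real D * indicator (E k) z)"
        using D(2)[of k] AE_space
      proof eventually_elim
        case (elim z)
        show ?case
        proof (cases "z \<in> E k")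
          case True
          then have "complex_of_real (e/2) + complex_of_real D * indicator (E k) z = complex_of_real (e/2 + D)" by simp
          then show ?thesis using elim e D(1) by (simp only: norm_of_real)
        next
          case False
          then show ?thesis using elim e by (auto simp: E_def)
        qed
      qed
    qed
    also have "\<dots> \<le> e / 2 + D * \<alpha> (indicator (E k))"
      using alpha_triangle[OF h] alpha_const[of "complex_of_real (e/2)"] alpha_cmult[OF indicator_Linf[OF Em[of k]], of "complex_of_real D"] e D
      by simp
    also have "\<dots> < e / 2 + D * (e / (2 * D))" using K[OF that] D by (intro add_strict_left_mono mult_strict_left_mono) auto
    also have "\<dots> = e" using D by simp
    finally show ?thesis .
  qed
  then show "\<exists>no. \<forall>k\<ge>no. norm (\<alpha> (f k) - 0) < e" using alpha_nonneg[OF fL] by (auto intro!: exI[of _ K])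
qed

lemma alpha_sum_le:
  assumes "\<And>i. i \<in> I \<Longrightarrow> f i \<in> Linf" shows "\<alpha> (\<lambda>z. \<Sum>i\<in>I. f i z) \<le> (\<Sum>i\<in>I. \<alpha> (f i))"
  using assms
proof (induction I rule: infinite_finite_induct)
  case (insert x I)
  have "\<alpha> (\<lambda>z. f x z + (\<Sum>i\<in>I. f i z)) \<le> \<alpha> (f x) + \<alpha> (\<lambda>z. \<Sum>i\<in>I. f i z)"
    using insert by (intro alpha_triangle Linf_sum) auto
  then show ?case using insert by simp
qed (use alpha_const[of 0] in auto)

lemma alpha_rotate: "f \<in> Linf \<Longrightarrow> cmod w = 1 \<Longrightarrow> \<alpha> (\<lambda>z. f (w * z)) = \<alpha> f"
  using alpha_rotate_cnj[of f "cnj w"] by simp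

lemma alpha_rot_avg_le:
  assumes f: "f \<in> Linf" and n: "n \<ge> 1" shows "\<alpha> (rot_avg n f) \<le> \<alpha> f"
proof -
  have L: "(\<lambda>z. f (unit_root n ^ i * z)) \<in> Linf" for i by (intro Linf_rotate f norm_unit_root_power)
  have "\<alpha> (rot_avg n f) = \<alpha> (\<lambda>z. (1 / of_nat n) * (\<Sum>i<n. f (unit_root n ^ i * z)))"
    by (simp add: rot_avg_def[abs_def])
  also have "\<dots> = (1 / real n) * \<alpha> (\<lambda>z. \<Sum>i<n. f (unit_root n ^ i * z))"
    by (subst alpha_cmult) (auto intro!: Linf_sum L simp: norm_divide)
  also have "\<dots> \<le> (1 / real n) * (\<Sum>i<n. \<alpha> (\<lambda>z. f (unit_root n ^ i * z)))"
    by (intro mult_left_mono alpha_sum_le L) auto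
  also have "\<dots> = \<alpha> f" using n by (simp add: alpha_rotate[OF f])
  finally show ?thesis .
qed

text \<open>
  Averaging $g = |h|$ over the rotations by $N$-th roots of unity does not increase $\alpha$ and removes
  all frequencies that are not divisible by $N$. As $N$ grows quickly, the averages converge boundedly
  to the constant $\int |h|$, whose norm is this constant.
\<close>

lemma L1_le_alpha:
  assumes h: "h \<in> Linf" shows "(LINT z|circle. cmod (h z)) \<le> \<alpha> h"
proof -
  define g where "g z = complex_of_real (cmod (h z))" for z
  have [measurable]: "h \<in> borel_measurable circle" by (rule LinfD[OF h])
  have [measurable]: "g \<in> borel_measurable circle" unfolding g_def[abs_def] by measurable
  have g: "g \<in> Linf" using h by (auto simp: Linf_def g_def)
  obtain C where C: "C > 0" "AE z in circle. cmod (g z) \<le> C" using LinfE[OF g] .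
  define c where "c = (LINT z|circle. cmod (h z))"
  have c0: "c \<ge> 0" by (simp add: c_def)
  have g0: "fourier_coeff g 0 = of_real c" by (simp add: fourier_coeff_def g_def c_def)
  have gL2: "g \<in> L2" by (rule Linf_subset_L2[OF g])
  obtain r G where "integrable circle G"
    "AE z in circle. (\<lambda>k. fourier_sum g (r k) z) \<longlonglongrightarrow> g z"
    "AE z in circle. \<forall>k. cmod (fourier_sum g (r k) z) \<le> G z"
    and r: "\<And>k. l2sq (\<lambda>z. g z - fourier_sum g (r k) z) \<le> (1/4) ^ k"
    by (rule L2_fourier_series_subsequence[OF gL2]) (rule that)
  \<comment> \<open>No nonzero frequency in \<open>sym_range (r k)\<close> is divisible by \<open>N k\<close>, so averaging turns the
    partial sum of $g$ into the constant $c$.\<close>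
  define N where "N k = Suc (r k)" for k
  have N: "N k \<ge> 1" for k by (simp add: N_def)
  define A where "A k z = rot_avg (N k) g z - of_real c" for k z
  have Am [measurable]: "A k \<in> borel_measurable circle" for k unfolding A_def by measurable
  have A_eq: "A k z = rot_avg (N k) (\<lambda>z. g z - fourier_sum g (r k) z) z" for k z
  proof -
    have "{j \<in> sym_range (r k). int (N k) dvd j} = {0}"
    proof -
      have "j = 0" if "- int (r k) \<le> j" "j \<le> int (r k)" "int (Suc (r k)) dvd j" for j
        using that dvd_imp_le_int[of j "int (Suc (r k))"] by (cases "j = 0") auto
      then show ?thesis by (auto simp: N_def simp del: of_nat_Suc)
    qed
    then have "rot_avg (N k) (fourier_sum g (r k)) z = of_real c"
      by (simp add: rot_avg_trig_poly[OF N] trig_poly_def g0)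
    then show ?thesis by (simp add: A_def rot_avg_def sum_subtractf diff_divide_distrib)
  qed
  have dL: "(\<lambda>z. g z - fourier_sum g (r k) z) \<in> L2" for k
    by (intro L2_diff gL2 trig_poly_L2)
  have AL: "A k \<in> L2" "l2sq (A k) \<le> (1/4) ^ k" for k
    using rot_avg_L2[OF dL[of k] N[of k]] r[of k] unfolding A_eq[abs_def] by auto
  have "(\<lambda>k. l2sq (A k)) \<longlonglongrightarrow> 0"
    by (rule tendsto_sandwich[OF _ _ tendsto_const LIMSEQ_power_zero[of "1/4::real"]])
      (use AL l2sq_nonneg in auto)
  then have "(\<lambda>k. LINT z|circle. norm ((cmod (A k z))\<^sup>2)) \<longlonglongrightarrow> 0" by (simp add: l2sq_def)
  then obtain s where s: "strict_mono s" "AE z in circle. (\<lambda>k. (cmod (A (s k) z))\<^sup>2) \<longlonglongrightarrow> 0"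
    using tendsto_L1_AE_subseq[of circle "\<lambda>k z. (cmod (A k z))\<^sup>2"] L2_integrable_sq[OF AL(1)] by blast
  have lim: "AE z in circle. (\<lambda>k. A (s k) z) \<longlonglongrightarrow> 0"
    using s(2)
  proof eventually_elim
    case (elim z)
    have "(\<lambda>k. sqrt ((cmod (A (s k) z))\<^sup>2)) \<longlonglongrightarrow> sqrt 0" by (intro tendsto_intros elim)
    then show ?case by (simp add: tendsto_norm_zero_iff)
  qed
  have bd: "AE z in circle. cmod (A (s k) z) \<le> C + c" for k
  proof -
    have "AE z in circle. \<forall>i. cmod (g (unit_root (N (s k)) ^ i * z)) \<le> C"
      unfolding AE_all_countable by (auto intro: AE_rotate C)
    then show ?thesis
    proof eventually_elim
      case (elim z)
      have "cmod (\<Sum>i<N (s k). g (unit_root (N (s k)) ^ i * z)) \<le> (\<Sum>i<N (s k). C)"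
        using elim by (intro sum_norm_le) auto
      then have "cmod (rot_avg (N (s k)) g z) \<le> (\<Sum>i<N (s k). C) / real (N (s k))"
        unfolding rot_avg_def norm_divide norm_of_nat by (rule divide_right_mono) simp
      also have "\<dots> = C" using N[of "s k"] by simp
      finally have "cmod (rot_avg (N (s k)) g z) \<le> C" .
      then show ?case using c0 norm_triangle_ineq4[of "rot_avg (N (s k)) g z" "of_real c"]
        by (simp add: A_def)
    qed
  qed
  have "(\<lambda>k. \<alpha> (A (s k))) \<longlonglongrightarrow> 0" by (rule alpha_bounded_convergence[OF Am bd lim])
  then have "(\<lambda>k. \<alpha> g + \<alpha> (A (s k))) \<longlonglongrightarrow> \<alpha> g + 0" by (intro tendsto_intros)
  moreover have "c \<le> \<alpha> g + \<alpha> (A (s k))" for k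
  proof -
    have L: "rot_avg (N (s k)) g \<in> Linf" "(\<lambda>z. (-1) * A (s k) z) \<in> Linf"
      unfolding A_def by (intro rot_avg_Linf g Linf_cmult Linf_diff const_Linf)+
    have "c = \<alpha> (\<lambda>z. rot_avg (N (s k)) g z + (-1) * A (s k) z)"
      using c0 by (simp add: A_def alpha_const)
    also have "\<dots> \<le> \<alpha> (rot_avg (N (s k)) g) + \<alpha> (\<lambda>z. (-1) * A (s k) z)" by (rule alpha_triangle[OF L])
    also have "\<alpha> (\<lambda>z. (-1) * A (s k) z) = \<alpha> (A (s k))"
      using alpha_cmult[of "A (s k)" "-1"] Linf_cmult[OF L(2), of "-1"] by simp
    also have "\<alpha> (rot_avg (N (s k)) g) \<le> \<alpha> g" by (rule alpha_rot_avg_le[OF g N])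
    finally show ?thesis by simp
  qed
  ultimately have "c \<le> \<alpha> g" by (intro LIMSEQ_le_const[of "\<lambda>k. \<alpha> g + \<alpha> (A (s k))"]) auto
  also have "\<dots> = \<alpha> h" unfolding g_def by (rule alpha_abs[OF h])
  finally show ?thesis by (simp add: c_def)
qed

end

section \<open>The extended norm\<close>

context continuous_rot_sym_norm
begin

lemma norm_ext_mono_AE:
  "AE z in circle. cmod (f z) \<le> cmod (g z) \<Longrightarrow> norm_ext \<alpha> f \<le> norm_ext \<alpha> g"
  unfolding norm_ext_def by (rule SUP_subset_mono) (auto elim: eventually_elim2)

lemma norm_ext_AE_cong:
  "AE z in circle. cmod (f z) = cmod (g z) \<Longrightarrow> norm_ext \<alpha> f = norm_ext \<alpha> g"
  by (intro antisym norm_ext_mono_AE) (auto elim: eventually_mono)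

lemma simple_function_Linf: "simple_function circle s \<Longrightarrow> s \<in> Linf"
proof -
  assume s: "simple_function circle s"
  have "bounded (s ` space circle)" using s by (intro finite_imp_bounded) (simp add: simple_function_def)
  then obtain C where "\<And>z. z \<in> space circle \<Longrightarrow> cmod (s z) \<le> C"
    by (auto simp: bounded_iff simp del: space_circle)
  then show ?thesis using s by (auto simp: Linf_def intro: borel_measurable_simple_function intro!: exI[of _ C] AE_I2
        simp del: space_circle)
qed

lemma norm_ext_ge_simple:
  "simple_function circle s \<Longrightarrow> AE z in circle. cmod (s z) \<le> cmod (f z) \<Longrightarrow> ennreal (\<alpha> s) \<le> norm_ext \<alpha> f"
  unfolding norm_ext_def by (rule SUP_upper) auto

lemma norm_ext_least:
  "(\<And>s. s \<in> Linf \<Longrightarrow> AE z in circle. cmod (s z) \<le> cmod (f z) \<Longrightarrow> ennreal (\<alpha> s) \<le> x) \<Longrightarrow> norm_ext \<alpha> f \<le> x"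
  unfolding norm_ext_def by (rule SUP_least) (auto intro: simple_function_Linf)

text \<open>
  The supremum over simple functions is the supremum over all bounded functions, because $|h|$ is a
  uniform limit of simple functions from below. The proofs below can therefore use truncations and
  products, which are not simple.
\<close>

lemma norm_ext_ge_Linf:
  assumes h: "h \<in> Linf" and le: "AE z in circle. cmod (h z) \<le> cmod (f z)"
  shows "ennreal (\<alpha> h) \<le> norm_ext \<alpha> f"
proof -
  have [measurable]: "h \<in> borel_measurable circle" using h by (rule LinfD)
  obtain C where C: "C > 0" "AE z in circle. cmod (h z) \<le> C" using LinfE[OF h] .
  define g where "g z = min C (cmod (h z))" for z
  have [measurable]: "g \<in> borel_measurable circle" unfolding g_def[abs_def] by measurable
  have g: "0 \<le> g z" "g z \<le> C" for z using C by (auto simp: g_def)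
  define s where "s k z = real_of_int \<lfloor>g z * 2 ^ k\<rfloor> / 2 ^ k" for k :: nat and z
  have s: "0 \<le> s k z" "s k z \<le> g z" "g z - s k z \<le> (1/2) ^ k" for k z
  proof -
    have p: "(2::real) ^ k > 0" by simp
    show "0 \<le> s k z" using g[of z] by (simp add: s_def)
    show "s k z \<le> g z" using of_int_floor_le[of "g z * 2 ^ k"] by (simp add: s_def divide_le_eq)
    have "g z * 2 ^ k \<le> real_of_int \<lfloor>g z * 2 ^ k\<rfloor> + 1" by linarith
    then have "g z \<le> (real_of_int \<lfloor>g z * 2 ^ k\<rfloor> + 1) / 2 ^ k" by (simp add: pos_le_divide_eq)
    then show "g z - s k z \<le> (1/2) ^ k" by (simp add: s_def add_divide_distrib power_one_over)
  qed
  have sm [measurable]: "s k \<in> borel_measurable circle" for k unfolding s_def[abs_def] by measurable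
  have simple: "simple_function circle (\<lambda>z. complex_of_real (s k z))" for k
  proof (rule simple_function_borel_measurable)
    show "(\<lambda>z. complex_of_real (s k z)) \<in> borel_measurable circle" by measurable
    have "(\<lambda>z. complex_of_real (s k z)) ` space circle \<subseteq> (\<lambda>i. complex_of_real (real_of_int i / 2 ^ k)) ` {0..\<lceil>C * 2 ^ k\<rceil>}"
    proof
      fix y assume "y \<in> (\<lambda>z. complex_of_real (s k z)) ` space circle"
      then obtain z where z: "y = complex_of_real (s k z)" by auto
      have "g z * 2 ^ k \<le> C * 2 ^ k" using g[of z] by simp
      then have "g z * 2 ^ k \<le> real_of_int \<lceil>C * 2 ^ k\<rceil>" using le_of_int_ceiling[of "C * 2 ^ k"] by linarith
      then have "\<lfloor>g z * 2 ^ k\<rfloor> \<le> \<lceil>C * 2 ^ k\<rceil>" unfolding floor_le_iff by linarith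
      moreover have "0 \<le> \<lfloor>g z * 2 ^ k\<rfloor>" using g[of z] by simp
      ultimately have "\<lfloor>g z * 2 ^ k\<rfloor> \<in> {0..\<lceil>C * 2 ^ k\<rceil>}" by simp
      then show "y \<in> (\<lambda>i. complex_of_real (real_of_int i / 2 ^ k)) ` {0..\<lceil>C * 2 ^ k\<rceil>}"
        unfolding z s_def by auto
    qed
    then show "finite ((\<lambda>z. complex_of_real (s k z)) ` space circle)"
      by (rule finite_subset) simp
  qed
  have gh: "AE z in circle. cmod (complex_of_real (g z)) = cmod (h z)"
    using C(2) by eventually_elim (use g C in \<open>auto simp: g_def\<close>)
  have gL: "(\<lambda>z. complex_of_real (g z)) \<in> Linf"
    using g C by (auto simp: Linf_def intro!: exI[of _ C] AE_I2)
  have bd: "\<alpha> h \<le> \<alpha> (\<lambda>z. complex_of_real (s k z)) + (1/2) ^ k" for k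
  proof -
    have sL: "(\<lambda>z. complex_of_real (s k z)) \<in> Linf" by (rule simple_function_Linf[OF simple])
    have dL: "(\<lambda>z. complex_of_real (g z) - complex_of_real (s k z)) \<in> Linf" by (rule Linf_diff[OF gL sL])
    have "\<alpha> h \<le> \<alpha> (\<lambda>z. complex_of_real (g z))"
      by (rule alpha_mono[OF h gL]) (use gh in \<open>auto elim: eventually_mono\<close>)
    also have "\<dots> = \<alpha> (\<lambda>z. complex_of_real (s k z) + (complex_of_real (g z) - complex_of_real (s k z)))" by simp
    also have "\<dots> \<le> \<alpha> (\<lambda>z. complex_of_real (s k z)) + \<alpha> (\<lambda>z. complex_of_real (g z) - complex_of_real (s k z))"
      by (rule alpha_triangle[OF sL dL])
    also have "\<alpha> (\<lambda>z. complex_of_real (g z) - complex_of_real (s k z)) \<le> (1/2) ^ k"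
    proof (rule alpha_le_bound[OF dL])
      show "AE z in circle. cmod (complex_of_real (g z) - complex_of_real (s k z)) \<le> (1/2) ^ k"
      proof (rule AE_I2)
        fix z
        have "cmod (complex_of_real (g z - s k z)) \<le> (1/2) ^ k"
          using s(1,2)[of k z] s(3)[of z k] by (simp only: norm_of_real abs_of_nonneg)
        then show "cmod (complex_of_real (g z) - complex_of_real (s k z)) \<le> (1/2) ^ k" by simp
      qed
    qed simp
    finally show ?thesis by simp
  qed
  have "ennreal (\<alpha> h) \<le> norm_ext \<alpha> f + ennreal ((1/2) ^ k)" for k
  proof -
    have "AE z in circle. cmod (complex_of_real (s k z)) \<le> cmod (f z)"
      using gh le
    proof eventually_elim
      case (elim z)
      then show ?case using s(1,2)[of k z] g[of z] by simp
    qed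
    then have "ennreal (\<alpha> (\<lambda>z. complex_of_real (s k z))) \<le> norm_ext \<alpha> f"
      by (rule norm_ext_ge_simple[OF simple])
    moreover have "ennreal (\<alpha> h) \<le> ennreal (\<alpha> (\<lambda>z. complex_of_real (s k z))) + ennreal ((1/2) ^ k)"
    proof -
      have "(0::real) \<le> (1/2) ^ k" by simp
      from ennreal_plus[OF alpha_nonneg[OF simple_function_Linf[OF simple[of k]]] this]
      show ?thesis using ennreal_leI[OF bd[of k]] by simp
    qed
    ultimately show ?thesis by (meson add_right_mono order_trans)
  qed
  moreover have "(\<lambda>k. norm_ext \<alpha> f + ennreal ((1/2) ^ k)) \<longlonglongrightarrow> norm_ext \<alpha> f + ennreal 0"
    by (intro tendsto_add tendsto_const tendsto_ennrealI LIMSEQ_power_zero) simp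
  ultimately have "ennreal (\<alpha> h) \<le> norm_ext \<alpha> f + ennreal 0"
    by (intro LIMSEQ_le_const[of "\<lambda>k. norm_ext \<alpha> f + ennreal ((1/2) ^ k)"]) auto
  then show ?thesis by simp
qed

lemma norm_ext_Linf: "f \<in> Linf \<Longrightarrow> norm_ext \<alpha> f = ennreal (\<alpha> f)"
  by (intro antisym norm_ext_least norm_ext_ge_Linf) (auto intro!: ennreal_leI alpha_mono)

lemma norm_ext_bounded_mult_le:
  assumes u: "AE z in circle. cmod (u z) \<le> C" and C: "C > 0"
  shows "norm_ext \<alpha> (\<lambda>z. u z * f z) \<le> ennreal C * norm_ext \<alpha> f"
proof (rule norm_ext_least)
  fix s assume s: "s \<in> Linf" and le: "AE z in circle. cmod (s z) \<le> cmod (u z * f z)"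
  have "AE z in circle. cmod (of_real (1 / C) * s z) \<le> cmod (f z)"
    using u le
  proof eventually_elim
    case (elim z)
    have "cmod (u z * f z) \<le> C * cmod (f z)" using elim by (simp add: norm_mult mult_right_mono)
    then show ?case using elim C by (simp add: norm_mult norm_divide divide_le_eq mult.commute)
  qed
  from norm_ext_ge_Linf[OF Linf_cmult[OF s] this]
  have "ennreal (1 / C * \<alpha> s) \<le> norm_ext \<alpha> f"
    unfolding alpha_cmult[OF s] norm_of_real using C by simp
  then have "ennreal C * ennreal (1 / C * \<alpha> s) \<le> ennreal C * norm_ext \<alpha> f" by (rule mult_left_mono) simp
  also have "ennreal C * ennreal (1 / C * \<alpha> s) = ennreal (\<alpha> s)"
    using C alpha_nonneg[OF s] by (subst ennreal_mult[symmetric]) auto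
  finally show "ennreal (\<alpha> s) \<le> ennreal C * norm_ext \<alpha> f" .
qed

text \<open>
  A function $s$ with $|s| \le |f+g|$ is split in the proportion $|f| : |g|$. The quotient takes the value
  0 where both functions vanish, and there $s$ vanishes as well.
\<close>

lemma norm_ext_triangle:
  assumes [measurable]: "f \<in> borel_measurable circle" "g \<in> borel_measurable circle"
  shows "norm_ext \<alpha> (\<lambda>z. f z + g z) \<le> norm_ext \<alpha> f + norm_ext \<alpha> g"
proof (rule norm_ext_least)
  fix s assume s: "s \<in> Linf" and le: "AE z in circle. cmod (s z) \<le> cmod (f z + g z)"
  have [measurable]: "s \<in> borel_measurable circle" using s by (rule LinfD)
  define \<theta> where "\<theta> z = cmod (f z) / (cmod (f z) + cmod (g z))" for z
  have [measurable]: "\<theta> \<in> borel_measurable circle" unfolding \<theta>_def[abs_def] by measurable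
  have th: "0 \<le> \<theta> z" "\<theta> z \<le> 1" for z
  proof -
    show "\<theta> z \<le> 1"
    proof (cases "cmod (f z) + cmod (g z) = 0")
      case False
      then have "cmod (f z) + cmod (g z) > 0" using norm_ge_zero[of "f z"] norm_ge_zero[of "g z"] by linarith
      then show ?thesis by (simp add: \<theta>_def)
    qed (simp add: \<theta>_def)
  qed (simp add: \<theta>_def)
  have tL: "(\<lambda>z. complex_of_real (\<theta> z)) \<in> Linf" "(\<lambda>z. complex_of_real (1 - \<theta> z)) \<in> Linf"
    unfolding Linf_def using th by (auto intro!: exI[of _ 1] AE_I2 simp del: of_real_diff simp: abs_le_iff)
  have L: "(\<lambda>z. complex_of_real (\<theta> z) * s z) \<in> Linf" "(\<lambda>z. complex_of_real (1 - \<theta> z) * s z) \<in> Linf"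
    by (rule Linf_mult[OF tL(1) s], rule Linf_mult[OF tL(2) s])
  have f: "AE z in circle. cmod (complex_of_real (\<theta> z) * s z) \<le> cmod (f z)"
    using le
  proof eventually_elim
    case (elim z)
    have "cmod (s z) \<le> cmod (f z) + cmod (g z)" using elim norm_triangle_ineq[of "f z" "g z"] by linarith
    then have "\<theta> z * cmod (s z) \<le> \<theta> z * (cmod (f z) + cmod (g z))" by (rule mult_left_mono) (rule th)
    also have "\<dots> = cmod (f z)" by (cases "cmod (f z) + cmod (g z) = 0") (auto simp: \<theta>_def add_nonneg_eq_0_iff)
    finally show ?case using th[of z] by (simp add: norm_mult)
  qed
  have g: "AE z in circle. cmod (complex_of_real (1 - \<theta> z) * s z) \<le> cmod (g z)"
    using le
  proof eventually_elim
    case (elim z)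
    have sz: "cmod (s z) \<le> cmod (f z) + cmod (g z)" using elim norm_triangle_ineq[of "f z" "g z"] by linarith
    then have "(1 - \<theta> z) * cmod (s z) \<le> (1 - \<theta> z) * (cmod (f z) + cmod (g z))"
      by (rule mult_left_mono) (use th[of z] in simp)
    also have "\<dots> = cmod (g z)"
      by (cases "cmod (f z) + cmod (g z) = 0") (auto simp: \<theta>_def add_nonneg_eq_0_iff field_simps)
    finally have "(1 - \<theta> z) * cmod (s z) \<le> cmod (g z)" .
    moreover have "cmod (complex_of_real (1 - \<theta> z)) = 1 - \<theta> z"
      using th[of z] by (simp only: norm_of_real abs_of_nonneg diff_ge_0_iff_ge)
    ultimately show ?case by (simp only: norm_mult)
  qed
  have "\<alpha> s = \<alpha> (\<lambda>z. complex_of_real (\<theta> z) * s z + complex_of_real (1 - \<theta> z) * s z)"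
    by (simp add: algebra_simps)
  also have "\<dots> \<le> \<alpha> (\<lambda>z. complex_of_real (\<theta> z) * s z) + \<alpha> (\<lambda>z. complex_of_real (1 - \<theta> z) * s z)"
    by (rule alpha_triangle[OF L])
  finally have "ennreal (\<alpha> s) \<le> ennreal (\<alpha> (\<lambda>z. complex_of_real (\<theta> z) * s z) + \<alpha> (\<lambda>z. complex_of_real (1 - \<theta> z) * s z))"
    by (rule ennreal_leI)
  also have "\<dots> = ennreal (\<alpha> (\<lambda>z. complex_of_real (\<theta> z) * s z)) + ennreal (\<alpha> (\<lambda>z. complex_of_real (1 - \<theta> z) * s z))"
    by (rule ennreal_plus) (intro alpha_nonneg L)+
  also have "\<dots> \<le> norm_ext \<alpha> f + norm_ext \<alpha> g"
    by (intro add_mono norm_ext_ge_Linf L f g)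
  finally show "ennreal (\<alpha> s) \<le> norm_ext \<alpha> f + norm_ext \<alpha> g" .
qed

lemma norm_ext_rotate_le:
  assumes w: "cmod w = 1"
  shows "norm_ext \<alpha> (\<lambda>z. f (w * z)) \<le> norm_ext \<alpha> f"
proof (rule norm_ext_least)
  fix s assume s: "s \<in> Linf" and le: "AE z in circle. cmod (s z) \<le> cmod (f (w * z))"
  have w': "cmod (cnj w) = 1" using w by simp
  have ww: "w * (cnj w * z) = z" for z
    using complex_norm_square[of w] w by (simp flip: mult.assoc)
  have "AE z in circle. cmod (s (cnj w * z)) \<le> cmod (f z)"
    using AE_rotate[OF w' le] by (simp only: ww)
  from norm_ext_ge_Linf[OF Linf_rotate[OF s w'] this]
  show "ennreal (\<alpha> s) \<le> norm_ext \<alpha> f" by (simp add: alpha_rotate_cnj[OF s w])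
qed

lemma norm_ext_zero: "norm_ext \<alpha> (\<lambda>z. 0) = 0"
  using norm_ext_Linf[OF const_Linf[of 0]] alpha_const[of 0] by simp

lemma norm_ext_sum_le:
  assumes "\<And>i. i \<in> I \<Longrightarrow> f i \<in> borel_measurable circle"
  shows "norm_ext \<alpha> (\<lambda>z. \<Sum>i\<in>I. f i z) \<le> (\<Sum>i\<in>I. norm_ext \<alpha> (f i))"
  using assms
proof (induction I rule: infinite_finite_induct)
  case (insert x I)
  have "norm_ext \<alpha> (\<lambda>z. f x z + (\<Sum>i\<in>I. f i z)) \<le> norm_ext \<alpha> (f x) + norm_ext \<alpha> (\<lambda>z. \<Sum>i\<in>I. f i z)"
    using insert by (intro norm_ext_triangle borel_measurable_sum) auto
  also have "\<dots> \<le> norm_ext \<alpha> (f x) + (\<Sum>i\<in>I. norm_ext \<alpha> (f i))"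
    using insert by (intro add_left_mono) auto
  finally show ?case using insert by simp
qed (auto simp: norm_ext_zero)

lemma norm_ext_rot_avg_le:
  assumes f: "f \<in> borel_measurable circle" and n: "n \<ge> 1"
  shows "norm_ext \<alpha> (rot_avg n f) \<le> norm_ext \<alpha> f"
proof -
  have "norm_ext \<alpha> (rot_avg n f) = norm_ext \<alpha> (\<lambda>z. of_real (1 / real n) * (\<Sum>i<n. f (unit_root n ^ i * z)))"
    by (simp add: rot_avg_def[abs_def])
  also have "\<dots> \<le> ennreal (1 / real n) * norm_ext \<alpha> (\<lambda>z. \<Sum>i<n. f (unit_root n ^ i * z))"
    by (rule norm_ext_bounded_mult_le) (use n in \<open>auto simp: norm_divide\<close>)
  also have "\<dots> \<le> ennreal (1 / real n) * (\<Sum>i<n. norm_ext \<alpha> (\<lambda>z. f (unit_root n ^ i * z)))"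
    by (intro mult_left_mono norm_ext_sum_le rotate_measurable[OF norm_unit_root_power f]) auto
  also have "\<dots> \<le> ennreal (1 / real n) * (\<Sum>i<n. norm_ext \<alpha> f)"
    by (intro mult_left_mono sum_mono norm_ext_rotate_le) auto
  also have "\<dots> = (ennreal (1 / real n) * ennreal (real n)) * norm_ext \<alpha> f"
    by (simp add: mult.assoc ennreal_of_nat_eq_real_of_nat)
  also have "ennreal (1 / real n) * ennreal (real n) = 1"
    using n by (subst ennreal_mult[symmetric]) auto
  finally show ?thesis by simp
qed

lemma L1_le_norm_ext:
  assumes f [measurable]: "f \<in> borel_measurable circle"
  shows "(\<integral>\<^sup>+z. ennreal (cmod (f z)) \<partial>circle) \<le> norm_ext \<alpha> f"
proof -
  define h where "h k z = min (real k) (cmod (f z))" for k z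
  have [measurable]: "h k \<in> borel_measurable circle" for k unfolding h_def[abs_def] by measurable
  have h0: "0 \<le> h k z" for k z by (simp add: h_def)
  have "(\<integral>\<^sup>+z. ennreal (h k z) \<partial>circle) \<le> norm_ext \<alpha> f" for k
  proof -
    have L: "(\<lambda>z. complex_of_real (h k z)) \<in> Linf"
      using h0 by (auto simp: Linf_def h_def intro!: exI[of _ "real k"])
    have i: "integrable circle (\<lambda>z. h k z)"
      using L2_integrable[OF Linf_subset_L2[OF L]] by (simp only: complex_of_real_integrable_eq)
    have "(\<integral>\<^sup>+z. ennreal (h k z) \<partial>circle) = ennreal (LINT z|circle. h k z)"
      by (rule nn_integral_eq_integral[OF i]) (simp add: h0)
    also have "\<dots> \<le> ennreal (\<alpha> (\<lambda>z. complex_of_real (h k z)))"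
      using L1_le_alpha[OF L] h0 by (intro ennreal_leI) simp
    also have "\<dots> \<le> norm_ext \<alpha> f"
      by (rule norm_ext_ge_Linf[OF L]) (auto simp: h_def)
    finally show ?thesis .
  qed
  moreover have "(\<integral>\<^sup>+z. ennreal (cmod (f z)) \<partial>circle) \<le> liminf (\<lambda>k. \<integral>\<^sup>+z. ennreal (h k z) \<partial>circle)"
  proof -
    have "(\<lambda>k. ennreal (h k z)) \<longlonglongrightarrow> ennreal (cmod (f z))" for z
    proof (rule tendsto_eventually)
      obtain K where "cmod (f z) \<le> real K" using real_arch_simple by blast
      then have "\<forall>k\<ge>K. ennreal (h k z) = ennreal (cmod (f z))" by (auto simp: h_def min_def)
      then show "\<forall>\<^sub>F k in sequentially. ennreal (h k z) = ennreal (cmod (f z))"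
        by (auto simp: eventually_sequentially)
    qed
    then have "liminf (\<lambda>k. ennreal (h k z)) = ennreal (cmod (f z))" for z
      by (intro lim_imp_Liminf) auto
    then have "(\<integral>\<^sup>+z. ennreal (cmod (f z)) \<partial>circle) = (\<integral>\<^sup>+z. liminf (\<lambda>k. ennreal (h k z)) \<partial>circle)"
      by simp
    also have "\<dots> \<le> liminf (\<lambda>k. \<integral>\<^sup>+z. ennreal (h k z) \<partial>circle)"
      by (rule nn_integral_liminf) measurable
    finally show ?thesis .
  qed
  moreover have "liminf (\<lambda>k. \<integral>\<^sup>+z. ennreal (h k z) \<partial>circle) \<le> liminf (\<lambda>k::nat. norm_ext \<alpha> f)"
    using calculation(1) by (intro Liminf_mono) auto
  ultimately show ?thesis by (simp add: Liminf_const)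
qed

lemma calL_measurable: "f \<in> calL \<alpha> \<Longrightarrow> f \<in> borel_measurable circle"
  by (simp add: calL_def)

lemma calL_integrable:
  assumes "f \<in> calL \<alpha>" shows "integrable circle f"
  using L1_le_norm_ext[of f] assms unfolding calL_def
  by (intro integrableI_bounded) (auto intro: order_le_less_trans)

lemma norm_ext_eq_0:
  assumes f: "f \<in> borel_measurable circle" and z: "norm_ext \<alpha> f = 0"
  shows "AE z in circle. f z = 0"
  using L1_le_norm_ext[OF f] z f by (auto simp: nn_integral_0_iff_AE)

lemma norm_ext_diff_commute: "norm_ext \<alpha> (\<lambda>z. f z - g z) = norm_ext \<alpha> (\<lambda>z. g z - f z)"
  by (rule norm_ext_AE_cong) (simp add: norm_minus_commute)

lemma calL_bounded_mult:
  assumes f: "f \<in> calL \<alpha>" and u: "u \<in> Linf"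
  shows "(\<lambda>z. u z * f z) \<in> calL \<alpha>"
proof -
  obtain C where C: "C > 0" "AE z in circle. cmod (u z) \<le> C" using LinfE[OF u] .
  have "norm_ext \<alpha> (\<lambda>z. u z * f z) \<le> ennreal C * norm_ext \<alpha> f" by (rule norm_ext_bounded_mult_le[OF C(2,1)])
  also have "\<dots> < \<infinity>" using f by (simp add: calL_def ennreal_mult_less_top)
  finally show ?thesis using f LinfD[OF u] by (simp add: calL_def borel_measurable_times)
qed

lemma calL_AE_cong:
  assumes "f \<in> calL \<alpha>" "g \<in> borel_measurable circle" "AE z in circle. f z = g z" shows "g \<in> calL \<alpha>"
proof -
  have "norm_ext \<alpha> f = norm_ext \<alpha> g" by (rule norm_ext_AE_cong) (use assms(3) in \<open>auto elim: eventually_mono\<close>)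
  then show ?thesis using assms by (simp add: calL_def)
qed

lemma Linf_calL: "f \<in> Linf \<Longrightarrow> f \<in> calL \<alpha>"
  by (simp add: calL_def norm_ext_Linf LinfD)

lemma alpha_closure_superset: "X \<subseteq> calL \<alpha> \<Longrightarrow> X \<subseteq> alpha_closure \<alpha> X"
proof
  fix f assume "X \<subseteq> calL \<alpha>" "f \<in> X"
  moreover have "norm_ext \<alpha> (\<lambda>z. f z - f z) < e" if "e > 0" for e using that norm_ext_zero by simp
  ultimately show "f \<in> alpha_closure \<alpha> X" unfolding alpha_closure_def by blast
qed

lemma alpha_closure_calL: "alpha_closure \<alpha> X \<subseteq> calL \<alpha>"
  by (auto simp: alpha_closure_def)

lemma alpha_closureI_tendsto:
  assumes f: "f \<in> calL \<alpha>" and g: "\<And>k. g k \<in> X" and lim: "(\<lambda>k. norm_ext \<alpha> (\<lambda>z. g k z - f z)) \<longlonglongrightarrow> 0"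
  shows "f \<in> alpha_closure \<alpha> X"
proof -
  have "\<exists>g\<in>X. norm_ext \<alpha> (\<lambda>z. f z - g z) < e" if "e > 0" for e
  proof -
    have "\<forall>\<^sub>F k in sequentially. norm_ext \<alpha> (\<lambda>z. g k z - f z) < e"
      by (rule order_tendstoD(2)[OF lim that])
    then obtain k where "norm_ext \<alpha> (\<lambda>z. g k z - f z) < e" by (auto simp: eventually_sequentially)
    then show ?thesis using g[of k] norm_ext_diff_commute[of f "g k"] by (intro bexI[of _ "g k"]) simp_all
  qed
  then show ?thesis using f by (simp add: alpha_closure_def)
qed

lemma Lalpha_calL: "f \<in> Lalpha \<alpha> \<Longrightarrow> f \<in> calL \<alpha>"
  unfolding Lalpha_def using alpha_closure_calL by blast

lemma Linf_Lalpha: "f \<in> Linf \<Longrightarrow> f \<in> Lalpha \<alpha>"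
  unfolding Lalpha_def using alpha_closure_superset[of Linf] Linf_calL by blast

text \<open>
  Approximate $g$ by a bounded $b$. The part of $f_k$ below a multiple of $|b|$ tends to 0 by bounded
  convergence, and the rest is at most a multiple of $|g-b|$. This is where it matters that $g$ is in
  the closure of the bounded functions and not only of finite norm.
\<close>

lemma norm_ext_dominated_convergence:
  assumes g: "g \<in> Lalpha \<alpha>" and fm [measurable]: "\<And>k::nat. f k \<in> borel_measurable circle"
    and dom: "\<And>k. AE z in circle. cmod (f k z) \<le> C * cmod (g z)" and lim: "AE z in circle. (\<lambda>k. f k z) \<longlonglongrightarrow> 0"
  shows "(\<lambda>k. norm_ext \<alpha> (f k)) \<longlonglongrightarrow> 0"
proof -
  define D where "D = \<bar>C\<bar> + 1"
  have D: "D > 0" by (simp add: D_def)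
  have domD: "AE z in circle. cmod (f k z) \<le> D * cmod (g z)" for k
    using dom[of k]
  proof eventually_elim
    case (elim z)
    have "C * cmod (g z) \<le> D * cmod (g z)" by (rule mult_right_mono) (auto simp: D_def)
    then show ?case using elim by linarith
  qed
  have [measurable]: "g \<in> borel_measurable circle" using Lalpha_calL[OF g] by (rule calL_measurable)
  show ?thesis
  proof (rule order_tendstoI)
    fix e :: ennreal assume e: "0 < e"
    show "\<forall>\<^sub>F k in sequentially. norm_ext \<alpha> (f k) < e"
    proof -
      obtain d where d: "d > 0" "ennreal d < e"
      proof (cases e)
        case (real r)
        then have "r > 0" using e by simp
        then show ?thesis using real that[of "r/2"] by (simp add: ennreal_less_iff)
      next
        case top
        then show ?thesis using that[of 1] by simp
      qed
      have "ennreal (d / (2 * D)) > 0" using d D by simp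
      then obtain b where b: "b \<in> Linf" "norm_ext \<alpha> (\<lambda>z. g z - b z) < ennreal (d / (2 * D))"
        using g unfolding Lalpha_def alpha_closure_def by blast
      have [measurable]: "b \<in> borel_measurable circle" using b(1) by (rule LinfD)
      obtain B where B: "B > 0" "AE z in circle. cmod (b z) \<le> B" using LinfE[OF b(1)] .
      define h where "h k z = complex_of_real (min (cmod (f k z)) (D * cmod (b z)))" for k z
      have hm [measurable]: "h k \<in> borel_measurable circle" for k unfolding h_def[abs_def] by measurable
      have hB: "AE z in circle. cmod (h k z) \<le> D * B" for k
        using B(2)
      proof eventually_elim
        case (elim z)
        have "D * cmod (b z) \<le> D * B" using elim D by simp
        moreover have "0 \<le> min (cmod (f k z)) (D * cmod (b z))" using D by simp
        ultimately show ?case by (simp add: h_def)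
      qed
      have hlim: "AE z in circle. (\<lambda>k. h k z) \<longlonglongrightarrow> 0"
        using lim
      proof eventually_elim
        case (elim z)
        have "(\<lambda>k. complex_of_real (min (cmod (f k z)) (D * cmod (b z)))) \<longlonglongrightarrow> complex_of_real (min (cmod 0) (D * cmod (b z)))"
          by (intro tendsto_intros elim)
        then show ?case using D by (simp add: h_def)
      qed
      have hL: "h k \<in> Linf" for k using hB[of k] hm[of k] by (auto simp: Linf_def)
      have "(\<lambda>k. \<alpha> (h k)) \<longlonglongrightarrow> 0" by (rule alpha_bounded_convergence[OF hm hB hlim])
      then have "\<forall>\<^sub>F k in sequentially. \<alpha> (h k) < d / 2" by (rule order_tendstoD(2)) (use d in simp)
      then show ?thesis
      proof eventually_elim
        case (elim k)
        define q where "q z = of_real D * (g z - b z)" for z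
        have [measurable]: "q \<in> borel_measurable circle" unfolding q_def[abs_def] by measurable
        have "norm_ext \<alpha> (f k) \<le> norm_ext \<alpha> (\<lambda>z. h k z + complex_of_real (cmod (q z)))"
        proof (rule norm_ext_mono_AE)
          show "AE z in circle. cmod (f k z) \<le> cmod (h k z + complex_of_real (cmod (q z)))"
            using domD[of k]
          proof eventually_elim
            case (elim z)
            have "cmod (g z) \<le> cmod (b z) + cmod (g z - b z)" using norm_triangle_ineq[of "b z" "g z - b z"] by simp
            then have "D * cmod (g z) \<le> D * (cmod (b z) + cmod (g z - b z))" using D by (intro mult_left_mono) auto
            also have "\<dots> = D * cmod (b z) + cmod (q z)"
            proof -
              have "cmod (q z) = D * cmod (g z - b z)" unfolding q_def norm_mult using D by simp
              then show ?thesis by (simp only: ring_distribs)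
            qed
            finally have "cmod (f k z) \<le> min (cmod (f k z)) (D * cmod (b z)) + cmod (q z)" using elim
              by (auto simp: min_def)
            also have "\<dots> = cmod (h k z + complex_of_real (cmod (q z)))"
            proof -
              have "0 \<le> min (cmod (f k z)) (D * cmod (b z)) + cmod (q z)" using D by simp
              then show ?thesis unfolding h_def of_real_add[symmetric] norm_of_real by (rule abs_of_nonneg[symmetric])
            qed
            finally show ?case .
          qed
        qed
        also have "\<dots> \<le> norm_ext \<alpha> (h k) + norm_ext \<alpha> (\<lambda>z. complex_of_real (cmod (q z)))"
          by (rule norm_ext_triangle) measurable
        also have "norm_ext \<alpha> (\<lambda>z. complex_of_real (cmod (q z))) = norm_ext \<alpha> q"
          by (rule norm_ext_AE_cong) simp
        also have "norm_ext \<alpha> q \<le> ennreal D * norm_ext \<alpha> (\<lambda>z. g z - b z)"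
          unfolding q_def by (rule norm_ext_bounded_mult_le) (use D in auto)
        also have "\<dots> \<le> ennreal D * ennreal (d / (2 * D))" by (rule mult_left_mono) (use b in auto)
        also have "\<dots> = ennreal (d / 2)" using D d by (subst ennreal_mult[symmetric]) auto
        also have "norm_ext \<alpha> (h k) = ennreal (\<alpha> (h k))" by (rule norm_ext_Linf[OF hL])
        also have "\<dots> \<le> ennreal (d / 2)" using elim by (intro ennreal_leI) simp
        finally have "norm_ext \<alpha> (f k) \<le> ennreal (d / 2) + ennreal (d / 2)" by (simp add: add_right_mono)
        also have "\<dots> = ennreal d" using d by (subst ennreal_plus[symmetric]) auto
        finally show ?case using d(2) by (rule order_le_less_trans)
      qed
    qed
  qed simp
qed

end

section \<open>Multipliers of an invariant subspace\<close>

lemma fourier_coeff_rotate: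
  assumes f: "f \<in> borel_measurable circle" and w: "cmod w = 1"
  shows "fourier_coeff (\<lambda>z. f (w * z)) k = w powi k * fourier_coeff f k"
proof -
  have w0: "w \<noteq> 0" using w by auto
  have "fourier_coeff (\<lambda>z. f (w * z)) k = (LINT z|circle. w powi k * (f (w * z) * (w * z) powi (- k)))"
    unfolding fourier_coeff_def
    by (intro Bochner_Integration.integral_cong refl)
       (use w0 in \<open>simp add: power_int_mult_distrib power_int_minus\<close>)
  also have "\<dots> = w powi k * (LINT z|circle. f (w * z) * (w * z) powi (- k))" by simp
  also have "(LINT z|circle. f (w * z) * (w * z) powi (- k)) = (LINT z|circle. f z * z powi (- k))"
    using f by (intro integral_rotate[OF w, of "\<lambda>z. f z * z powi (- k)"] borel_measurable_times powi_measurable_circle)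
  finally show ?thesis by (simp add: fourier_coeff_def)
qed

lemma fourier_coeff_sum:
  assumes "\<And>i. i \<in> I \<Longrightarrow> integrable circle (f i)"
  shows "fourier_coeff (\<lambda>z. \<Sum>i\<in>I. f i z) k = (\<Sum>i\<in>I. fourier_coeff (f i) k)"
  unfolding fourier_coeff_def sum_distrib_right
  by (rule Bochner_Integration.integral_sum) (rule integrable_powi_mult[OF assms])

lemma fourier_coeff_rot_avg:
  assumes f: "integrable circle f" and n: "n \<ge> 1"
  shows "fourier_coeff (rot_avg n f) k = (if int n dvd k then fourier_coeff f k else 0)"
proof -
  have fm: "f \<in> borel_measurable circle" using f by simp
  have "fourier_coeff (rot_avg n f) k = fourier_coeff (\<lambda>z. (1 / of_nat n) * (\<Sum>i<n. f (unit_root n ^ i * z))) k"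
    by (simp add: rot_avg_def[abs_def])
  also have "\<dots> = (1 / of_nat n) * (\<Sum>i<n. fourier_coeff (\<lambda>z. f (unit_root n ^ i * z)) k)"
    unfolding fourier_coeff_cmult
    by (subst fourier_coeff_sum) (rule integrable_rotate[OF norm_unit_root_power f], simp)
  also have "\<dots> = (1 / of_nat n) * ((\<Sum>i<n. (unit_root n ^ i) powi k) * fourier_coeff f k)"
    by (simp only: fourier_coeff_rotate[OF fm norm_unit_root_power] sum_distrib_right)
  also have "\<dots> = (if int n dvd k then fourier_coeff f k else 0)"
    unfolding sum_unit_root_powi[OF n] using n by simp
  finally show ?thesis .
qed

lemma pow_part_rotate:
  assumes f: "f \<in> pow_part n X" and n: "n \<ge> 1"
  shows "AE z in circle. \<forall>i. f (unit_root n ^ i * z) = f z"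
proof -
  obtain g where g: "AE z in circle. f z = g (z ^ n)" using f by (auto simp: pow_part_def)
  have "AE z in circle. \<forall>i. f (unit_root n ^ i * z) = g ((unit_root n ^ i * z) ^ n)"
    unfolding AE_all_countable by (intro allI AE_rotate[OF norm_unit_root_power g])
  moreover have "(unit_root n ^ i * z) ^ n = z ^ n" for i z
    using unit_root_power_self[OF n] by (simp add: power_mult_distrib flip: power_mult) (metis mult.commute power_mult power_one)
  ultimately show ?thesis using g by (auto elim: eventually_elim2)
qed

lemma pow_part_fourier_coeff:
  assumes f: "f \<in> pow_part n X" and fm: "f \<in> borel_measurable circle" and n: "n \<ge> 1" and k: "\<not> int n dvd k"
  shows "fourier_coeff f k = 0"
proof -
  have "AE z in circle. f (unit_root n * z) = f z"
    using pow_part_rotate[OF f n] by eventually_elim (metis power_one_right)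
  then have "fourier_coeff f k = fourier_coeff (\<lambda>z. f (unit_root n * z)) k"
    by (intro fourier_coeff_cong fm rotate_measurable[OF norm_unit_root]) (auto elim: eventually_mono)
  also have "\<dots> = unit_root n powi k * fourier_coeff f k" by (rule fourier_coeff_rotate[OF fm norm_unit_root])
  finally show ?thesis using k unit_root_powi_eq_1_iff[OF n, of k] by simp
qed

locale invariant_subspace = continuous_rot_sym_norm +
  fixes n :: nat and M :: "(complex \<Rightarrow> complex) set"
  assumes n: "n \<ge> 1" and cs: "closed_subspace \<alpha> M" and inv: "mult_set (\<lambda>z. z ^ n) M \<subseteq> M"
begin

lemma M_Lalpha: "f \<in> M \<Longrightarrow> f \<in> Lalpha \<alpha>"
  and M_zero: "(\<lambda>z. 0) \<in> M"
  and M_add: "f \<in> M \<Longrightarrow> g \<in> M \<Longrightarrow> (\<lambda>z. f z + g z) \<in> M"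
  and M_cmult: "f \<in> M \<Longrightarrow> (\<lambda>z. c * f z) \<in> M"
  and M_closure: "alpha_closure \<alpha> M = M"
  using cs unfolding closed_subspace_def by auto

lemma M_calL: "f \<in> M \<Longrightarrow> f \<in> calL \<alpha>"
  by (intro Lalpha_calL M_Lalpha)

lemma M_measurable: "f \<in> M \<Longrightarrow> f \<in> borel_measurable circle"
  by (intro calL_measurable M_calL)

lemma M_diff: "f \<in> M \<Longrightarrow> g \<in> M \<Longrightarrow> (\<lambda>z. f z - g z) \<in> M"
  using M_add[OF _ M_cmult[of g "-1"], of f] by simp

lemma M_sum: "(\<And>i. i \<in> I \<Longrightarrow> f i \<in> M) \<Longrightarrow> (\<lambda>z. \<Sum>i\<in>I. f i z) \<in> M"
  by (induction I rule: infinite_finite_induct) (auto intro: M_zero M_add)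

lemma M_limit:
  assumes "f \<in> calL \<alpha>" "\<And>k. g k \<in> M" "(\<lambda>k. norm_ext \<alpha> (\<lambda>z. g k z - f z)) \<longlonglongrightarrow> 0"
  shows "f \<in> M"
  using alpha_closureI_tendsto[OF assms] M_closure by simp

lemma M_AE_cong:
  assumes "f \<in> M" "g \<in> borel_measurable circle" "AE z in circle. f z = g z" shows "g \<in> M"
proof (rule M_limit[of g "\<lambda>_. f"])
  show "g \<in> calL \<alpha>" by (rule calL_AE_cong[OF M_calL[OF assms(1)] assms(2,3)])
  have "norm_ext \<alpha> (\<lambda>z. f z - g z) = norm_ext \<alpha> (\<lambda>z. 0)"
    by (rule norm_ext_AE_cong) (use assms(3) in \<open>auto elim: eventually_mono\<close>)
  then show "(\<lambda>k. norm_ext \<alpha> (\<lambda>z. f z - g z)) \<longlonglongrightarrow> 0" by (simp add: norm_ext_zero)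
qed (use assms in simp)

lemma M_mult_power: "f \<in> M \<Longrightarrow> (\<lambda>z. z ^ n * f z) \<in> M"
proof (rule subsetD[OF inv])
  assume f: "f \<in> M"
  have [measurable]: "f \<in> borel_measurable circle" by (rule M_measurable[OF f])
  have "(\<lambda>z. z ^ n * f z) \<in> borel_measurable circle" by measurable
  then show "(\<lambda>z. z ^ n * f z) \<in> mult_set (\<lambda>z. z ^ n) M"
    unfolding mult_set_def using f by (intro CollectI conjI bexI[of _ f]) auto
qed

lemma M_dominated_limit:
  assumes g: "g \<in> Lalpha \<alpha>" and fM: "\<And>k. f k \<in> M" and Fm [measurable]: "F \<in> borel_measurable circle"
    and dom: "\<And>k. AE z in circle. cmod (f k z) \<le> C * cmod (g z)" and lim: "AE z in circle. (\<lambda>k. f k z) \<longlonglongrightarrow> F z"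
  shows "F \<in> M"
proof (rule M_limit)
  have [measurable]: "f k \<in> borel_measurable circle" for k using fM by (rule M_measurable)
  have dom': "AE z in circle. \<forall>k. cmod (f k z) \<le> C * cmod (g z)"
    unfolding AE_all_countable using dom by auto
  have F: "AE z in circle. cmod (F z) \<le> C * cmod (g z)"
    using dom' lim
  proof eventually_elim
    case (elim z)
    have "(\<lambda>k. cmod (f k z)) \<longlonglongrightarrow> cmod (F z)" by (intro tendsto_norm elim)
    then show ?case by (rule LIMSEQ_le_const2) (use elim in auto)
  qed
  show "F \<in> calL \<alpha>"
  proof -
    have "norm_ext \<alpha> F \<le> norm_ext \<alpha> (\<lambda>z. of_real C * g z)"
    proof (rule norm_ext_mono_AE)
      show "AE z in circle. cmod (F z) \<le> cmod (of_real C * g z)"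
        using F
      proof eventually_elim
        case (elim z)
        have "C * cmod (g z) \<le> \<bar>C\<bar> * cmod (g z)" by (rule mult_right_mono) auto
        then show ?case using elim by (simp add: norm_mult)
      qed
    qed
    also have "\<dots> < \<infinity>" using calL_bounded_mult[OF Lalpha_calL[OF g] const_Linf[of "of_real C"]] by (simp add: calL_def)
    finally show ?thesis by (simp add: calL_def)
  qed
  show "(\<lambda>k. norm_ext \<alpha> (\<lambda>z. f k z - F z)) \<longlonglongrightarrow> 0"
  proof (rule norm_ext_dominated_convergence[OF g])
    show "AE z in circle. cmod (f k z - F z) \<le> (2 * C) * cmod (g z)" for k
      using dom[of k] F by eventually_elim (use norm_triangle_ineq4 in \<open>smt (verit) ring_distribs(2) mult_2\<close>)
    show "AE z in circle. (\<lambda>k. f k z - F z) \<longlonglongrightarrow> 0"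
      using lim by eventually_elim (rule LIM_zero)
  qed measurable
qed (rule fM)

text \<open>
  This algebra is closed under bounded a.e. limits, so it contains exponentials of polynomials in
  $z^n$ and bounded limits of those.
\<close>

definition multipliers :: "(complex \<Rightarrow> complex) set" where
  "multipliers = {h \<in> borel_measurable circle. \<forall>f\<in>M. (\<lambda>z. h z * f z) \<in> M}"

lemma multiplier_mult: "h \<in> multipliers \<Longrightarrow> f \<in> M \<Longrightarrow> (\<lambda>z. h z * f z) \<in> M"
  by (simp add: multipliers_def)

lemma multiplier_times: "g \<in> multipliers \<Longrightarrow> h \<in> multipliers \<Longrightarrow> (\<lambda>z. g z * h z) \<in> multipliers"
  by (auto simp: multipliers_def mult.assoc)

lemma multiplier_cmult: "h \<in> multipliers \<Longrightarrow> (\<lambda>z. c * h z) \<in> multipliers"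
  by (auto simp: multipliers_def mult.assoc M_cmult)

lemma multiplier_one: "(\<lambda>z. 1) \<in> multipliers"
  by (simp add: multipliers_def)

lemma multiplier_power: "h \<in> multipliers \<Longrightarrow> (\<lambda>z. h z ^ k) \<in> multipliers"
  by (induction k) (auto intro: multiplier_one multiplier_times)

lemma multiplier_sum: "(\<And>i. i \<in> I \<Longrightarrow> h i \<in> multipliers) \<Longrightarrow> (\<lambda>z. \<Sum>i\<in>I. h i z) \<in> multipliers"
  by (auto simp: multipliers_def sum_distrib_right intro!: M_sum borel_measurable_sum)

lemma multiplier_power_n: "int n dvd int j \<Longrightarrow> (\<lambda>z. z ^ j) \<in> multipliers"
proof -
  assume "int n dvd int j"
  then obtain q where q: "j = n * q" by (auto simp: int_dvd_int_iff)
  have "(\<lambda>z. z ^ n) \<in> multipliers" by (simp add: multipliers_def M_mult_power)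
  from multiplier_power[OF this, of q] show ?thesis by (simp add: q power_mult)
qed

lemma multiplier_polynomial:
  assumes "\<And>j. \<not> int n dvd int j \<Longrightarrow> b j = 0"
  shows "(\<lambda>z. \<Sum>j\<le>d. b j * z ^ j) \<in> multipliers"
proof (rule multiplier_sum)
  fix j
  show "(\<lambda>z. b j * z ^ j) \<in> multipliers"
  proof (cases "int n dvd int j")
    case True
    then show ?thesis by (intro multiplier_cmult multiplier_power_n)
  next
    case False
    then show ?thesis using multiplier_cmult[OF multiplier_one, of 0] assms by simp
  qed
qed

lemma multiplier_limit:
  assumes h: "\<And>k. h k \<in> multipliers" and Hm: "H \<in> borel_measurable circle"
    and bd: "\<And>k. AE z in circle. cmod (h k z) \<le> C" and lim: "AE z in circle. (\<lambda>k. h k z) \<longlonglongrightarrow> H z"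
  shows "H \<in> multipliers"
  unfolding multipliers_def
proof (safe intro!: Hm)
  fix f assume f: "f \<in> M"
  show "(\<lambda>z. H z * f z) \<in> M"
  proof (rule M_dominated_limit[OF M_Lalpha[OF f], of "\<lambda>k z. h k z * f z"])
    show "AE z in circle. cmod (h k z * f z) \<le> C * cmod (f z)" for k
      using bd[of k] by eventually_elim (simp add: norm_mult mult_right_mono)
    show "AE z in circle. (\<lambda>k. h k z * f z) \<longlonglongrightarrow> H z * f z"
      using lim by eventually_elim (intro tendsto_intros)
    show "(\<lambda>z. H z * f z) \<in> borel_measurable circle"
      using Hm M_measurable[OF f] by (rule borel_measurable_times)
  qed (rule multiplier_mult[OF h f])
qed

lemma multiplier_exp:
  assumes P: "P \<in> multipliers" and bd: "\<And>z. cmod z = 1 \<Longrightarrow> cmod (P z) \<le> B"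
  shows "(\<lambda>z. exp (P z)) \<in> multipliers"
proof (rule multiplier_limit[where C="exp B"])
  have Pm: "P \<in> borel_measurable circle" using P by (simp add: multipliers_def)
  then show "(\<lambda>z. exp (P z)) \<in> borel_measurable circle" by measurable
  show "(\<lambda>z. \<Sum>i<k. (1 / fact i) * P z ^ i) \<in> multipliers" for k
    by (intro multiplier_sum multiplier_cmult multiplier_power P)
  show "AE z in circle. cmod (\<Sum>i<k. (1 / fact i) * P z ^ i) \<le> exp B" for k
  proof (rule AE_circleI)
    fix z :: complex assume z: "cmod z = 1"
    have B0: "B \<ge> 0" using bd[OF z] norm_ge_zero order_trans by blast
    have "cmod (\<Sum>i<k. (1 / fact i) * P z ^ i) \<le> (\<Sum>i<k. B ^ i /\<^sub>R fact i)"
    proof (rule sum_norm_le)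
      fix i
      have "cmod (P z) ^ i \<le> B ^ i" by (rule power_mono[OF bd[OF z]]) simp
      then show "cmod ((1 / fact i) * P z ^ i) \<le> B ^ i /\<^sub>R fact i"
        by (simp add: norm_mult norm_divide norm_power divide_right_mono field_simps)
    qed
    also have "\<dots> \<le> (\<Sum>i. B ^ i /\<^sub>R fact i)"
      by (rule sum_le_suminf[OF summable_exp_generic]) (use B0 in auto)
    finally show "cmod (\<Sum>i<k. (1 / fact i) * P z ^ i) \<le> exp B" by (simp add: exp_def)
  qed
  show "AE z in circle. (\<lambda>k. \<Sum>i<k. (1 / fact i) * P z ^ i) \<longlonglongrightarrow> exp (P z)"
  proof (rule AE_I2)
    fix z
    have "(\<lambda>i. P z ^ i /\<^sub>R fact i) sums exp (P z)" by (rule exp_converges)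
    moreover have "P z ^ i /\<^sub>R fact i = (1 / fact i) * P z ^ i" for i
      by (simp add: scaleR_conv_of_real divide_inverse)
    ultimately show "(\<lambda>k. \<Sum>i<k. (1 / fact i) * P z ^ i) \<longlonglongrightarrow> exp (P z)" by (simp add: sums_def)
  qed
qed

text \<open>
  These are the outer functions $\exp(-cF)$ with small $c > 0$, where $F$ is the analytic completion of
  $v = \sum_{w^n=1} \sqrt{|G|}(w\,\cdot)$. Summing over the rotations makes the frequencies of $v$
  multiples of $n$, as needed for the approximating polynomials to be multipliers. The square root is
  there because $F$ exists in $L^2$ only for $v \in L^2$, whereas $G$ is merely integrable; the factor
  $e^{-cv}$ still beats $v^2 \ge G$.
\<close>

lemma exists_dampening_multipliers:
  assumes G: "integrable circle G"
  obtains h where "\<And>m::nat. h m \<in> multipliers" "\<And>m. AE z in circle. cmod (h m z) \<le> 1"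
    "\<And>m. \<exists>C. AE z in circle. cmod (h m z) * G z \<le> C" "AE z in circle. (\<lambda>m. h m z) \<longlonglongrightarrow> 1"
proof -
  define u where "u z = sqrt \<bar>G z\<bar>" for z
  have Gm [measurable]: "G \<in> borel_measurable circle" using G by simp
  have um [measurable]: "u \<in> borel_measurable circle" unfolding u_def[abs_def] by measurable
  define v where "v z = (\<Sum>i<n. u (unit_root n ^ i * z))" for z
  have vm: "v \<in> borel_measurable circle"
    unfolding v_def[abs_def] by (intro borel_measurable_sum rotate_measurable[OF norm_unit_root_power um])
  have v0: "v z \<ge> 0" for z unfolding v_def u_def by (intro sum_nonneg) auto
  have cu: "(\<lambda>z. complex_of_real (u z)) \<in> L2"
    using G unfolding L2_def u_def by simp
  have cv: "(\<lambda>z. complex_of_real (v z)) = (\<lambda>z. of_nat n * rot_avg n (\<lambda>z. complex_of_real (u z)) z)"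
    using n by (simp add: rot_avg_def v_def fun_eq_iff)
  have "(\<lambda>z. complex_of_real (v z)) \<in> L2"
    unfolding cv by (intro L2_cmult rot_avg_L2 cu n)
  then have v2: "integrable circle (\<lambda>z. (v z)\<^sup>2)" using v0 by (simp add: L2_def)
  have vcoeff: "fourier_coeff (\<lambda>z. of_real (v z)) k = 0" if "\<not> int n dvd k" for k
    unfolding cv fourier_coeff_cmult using that fourier_coeff_rot_avg[OF L2_integrable[OF cu] n] by simp
  obtain F P b d where FP: "F \<in> borel_measurable circle" "AE z in circle. Re (F z) = v z"
    "AE z in circle. (\<lambda>k. P k z) \<longlonglongrightarrow> F z" "\<And>k z. cmod z = 1 \<Longrightarrow> Re (P k z) \<ge> 0"
    "\<And>k::nat. P k = (\<lambda>z. \<Sum>j\<le>d k. b k j * z ^ j)"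
    "\<And>k j. fourier_coeff (\<lambda>z. of_real (v z)) (int j) = 0 \<Longrightarrow> b k j = 0"
    by (rule analytic_completion[OF vm v0 v2]) (rule that)
  have PM: "P k \<in> multipliers" for k
    unfolding FP(5) by (rule multiplier_polynomial) (use FP(6) vcoeff in blast)
  have Pb: "\<exists>B. \<forall>z. cmod z = 1 \<longrightarrow> cmod (P k z) \<le> B" for k
  proof (intro exI allI impI)
    fix z :: complex assume "cmod z = 1"
    then show "cmod (P k z) \<le> (\<Sum>j\<le>d k. cmod (b k j))"
      unfolding FP(5) by (intro sum_norm_le) (simp add: norm_mult norm_power)
  qed
  define c where "c m = 1 / real (Suc m)" for m
  have c: "c m > 0" for m by (simp add: c_def)
  define h where "h m z = exp (- of_real (c m) * F z)" for m z
  have norm_h: "AE z in circle. cmod (h m z) = exp (- c m * v z)" for m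
    using FP(2) by eventually_elim (simp add: h_def)
  have hM: "h m \<in> multipliers" for m
  proof (rule multiplier_limit[where C=1 and h="\<lambda>k z. exp (- of_real (c m) * P k z)"])
    show "(\<lambda>z. exp (- of_real (c m) * P k z)) \<in> multipliers" for k
    proof -
      obtain B where B: "\<And>z. cmod z = 1 \<Longrightarrow> cmod (P k z) \<le> B" using Pb by blast
      show ?thesis
      proof (rule multiplier_exp[where B="c m * B"])
        show "(\<lambda>z. - of_real (c m) * P k z) \<in> multipliers" by (rule multiplier_cmult[OF PM])
        show "cmod (- of_real (c m) * P k z) \<le> c m * B" if "cmod z = 1" for z
          unfolding norm_mult norm_minus_cancel norm_of_real using c[of m] B[OF that] by simp
      qed
    qed
    show "AE z in circle. cmod (exp (- of_real (c m) * P k z)) \<le> 1" for k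
      by (rule AE_circleI) (use FP(4) c[of m] in simp)
    show "AE z in circle. (\<lambda>k. exp (- of_real (c m) * P k z)) \<longlonglongrightarrow> h m z"
      using FP(3) by eventually_elim (auto simp: h_def intro!: tendsto_intros)
    show "h m \<in> borel_measurable circle" unfolding h_def[abs_def] using FP(1) by measurable
  qed
  show ?thesis
  proof (rule that[of h])
    show "h m \<in> multipliers" for m by (rule hM)
    show "AE z in circle. cmod (h m z) \<le> 1" for m
      using norm_h[of m] by eventually_elim (use c[of m] v0 in simp)
    show "\<exists>C. AE z in circle. cmod (h m z) * G z \<le> C" for m
    proof (intro exI)
      show "AE z in circle. cmod (h m z) * G z \<le> 2 / (c m)\<^sup>2"
        using norm_h[of m]
      proof eventually_elim
        case (elim z)
        have "u z \<le> v z"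
          unfolding v_def using member_le_sum[of 0 "{..<n}" "\<lambda>i. u (unit_root n ^ i * z)"] n
          by (simp add: u_def)
        then have "(u z)\<^sup>2 \<le> (v z)\<^sup>2" by (rule power_mono) (simp add: u_def)
        then have Gv: "G z \<le> (v z)\<^sup>2" by (simp add: u_def)
        define y where "y = c m * v z"
        have y0: "y \<ge> 0" using c[of m] v0[of z] by (simp add: y_def)
        have "y\<^sup>2 / 2 \<le> exp y" using exp_lower_Taylor_quadratic[OF y0] y0 by linarith
        then have "exp (- y) * y\<^sup>2 \<le> 2" by (simp add: exp_minus field_simps)
        then have "exp (- y) * (v z)\<^sup>2 \<le> 2 / (c m)\<^sup>2"
          using c[of m] by (simp add: y_def power_mult_distrib pos_le_divide_eq mult_ac)
        moreover have "exp (- y) * G z \<le> exp (- y) * (v z)\<^sup>2" by (rule mult_left_mono[OF Gv]) simp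
        ultimately have "exp (- y) * G z \<le> 2 / (c m)\<^sup>2" by linarith
        then show ?case using elim by (simp add: y_def)
      qed
    qed
    show "AE z in circle. (\<lambda>m. h m z) \<longlonglongrightarrow> 1"
    proof (rule AE_I2)
      fix z
      have "c \<longlonglongrightarrow> 0" unfolding c_def[abs_def] by (rule LIMSEQ_Suc[OF lim_1_over_n])
      then have "(\<lambda>m. exp (- of_real (c m) * F z)) \<longlonglongrightarrow> exp (- of_real 0 * F z)"
        by (intro tendsto_intros)
      then show "(\<lambda>m. h m z) \<longlonglongrightarrow> 1" by (simp add: h_def)
    qed
  qed
qed

text \<open>
  Two limits are taken, and both are legitimate in $\alpha$: for fixed $m$, the products $h_m f_k$ tend to
  $h_m F$ boundedly; then $h_m F$ tends to $F$, dominated by $F \in L^\alpha$.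
\<close>

lemma M_L1_dominated_limit:
  assumes fM: "\<And>k. f k \<in> M" and G: "integrable circle G" and dom: "AE z in circle. \<forall>k. cmod (f k z) \<le> G z"
    and lim: "AE z in circle. (\<lambda>k. f k z) \<longlonglongrightarrow> F z" and F: "F \<in> Lalpha \<alpha>"
  shows "F \<in> M"
proof -
  obtain h where h: "\<And>m::nat. h m \<in> multipliers" "\<And>m. AE z in circle. cmod (h m z) \<le> 1"
    "\<And>m. \<exists>C. AE z in circle. cmod (h m z) * G z \<le> C" "AE z in circle. (\<lambda>m. h m z) \<longlonglongrightarrow> 1"
    by (rule exists_dampening_multipliers[OF G]) (rule that)
  have Fm: "F \<in> borel_measurable circle" using Lalpha_calL[OF F] by (rule calL_measurable)
  have hm: "h m \<in> borel_measurable circle" for m using h(1) by (simp add: multipliers_def)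
  have hF: "(\<lambda>z. h m z * F z) \<in> M" for m
  proof -
    obtain C where C: "AE z in circle. cmod (h m z) * G z \<le> C" using h(3) by blast
    show ?thesis
    proof (rule M_dominated_limit[OF Linf_Lalpha[OF const_Linf[of 1]], of "\<lambda>k z. h m z * f k z"])
      show "AE z in circle. cmod (h m z * f k z) \<le> C * cmod 1" for k
        using C dom
      proof eventually_elim
        case (elim z)
        have "cmod (h m z) * cmod (f k z) \<le> cmod (h m z) * G z" using elim by (intro mult_left_mono) auto
        then show ?case using elim by (simp add: norm_mult)
      qed
      show "AE z in circle. (\<lambda>k. h m z * f k z) \<longlonglongrightarrow> h m z * F z"
        using lim by eventually_elim (intro tendsto_intros)
    qed (use hm Fm multiplier_mult[OF h(1) fM] in auto)
  qed
  show ?thesis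
  proof (rule M_dominated_limit[OF F, of "\<lambda>m z. h m z * F z"])
    show "AE z in circle. cmod (h m z * F z) \<le> 1 * cmod (F z)" for m
      using h(2)[of m] by eventually_elim (simp only: norm_mult mult_right_mono norm_ge_zero)
    show "AE z in circle. (\<lambda>m. h m z * F z) \<longlonglongrightarrow> F z"
      using h(4) by eventually_elim (auto intro!: tendsto_eq_intros)
  qed (use hF Fm in auto)
qed

lemma M_bounded_approximation:
  assumes f: "f \<in> M"
  obtains h where "\<And>m::nat. h m \<in> multipliers" "\<And>m. AE z in circle. cmod (h m z) \<le> 1"
    "\<And>m. (\<lambda>z. h m z * f z) \<in> M \<inter> Linf" "AE z in circle. (\<lambda>m. h m z) \<longlonglongrightarrow> 1"
proof -
  have "integrable circle (\<lambda>z. cmod (f z))" using calL_integrable[OF M_calL[OF f]] by simp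
  then obtain h where h: "\<And>m::nat. h m \<in> multipliers" "\<And>m. AE z in circle. cmod (h m z) \<le> 1"
    "\<And>m. \<exists>C. AE z in circle. cmod (h m z) * cmod (f z) \<le> C" "AE z in circle. (\<lambda>m. h m z) \<longlonglongrightarrow> 1"
    by (rule exists_dampening_multipliers) (rule that)
  have "(\<lambda>z. h m z * f z) \<in> M \<inter> Linf" for m
    using multiplier_mult[OF h(1) f] h(3)[of m] M_measurable
    by (auto simp: Linf_def norm_mult)
  then show ?thesis using that[of h] h by blast
qed

text \<open>
  The partial Fourier sums of $b$ are polynomials in $z^n$. They need not converge boundedly, but a
  subsequence converges under an integrable bound.
\<close>

lemma M_mult_Hinf:
  assumes \<phi>: "\<phi> \<in> M" "\<phi> \<in> Linf" and b: "b \<in> pow_part n Hinf"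
  shows "(\<lambda>z. \<phi> z * b z) \<in> M"
proof -
  have bL: "b \<in> Linf" and bneg: "\<And>k. k < 0 \<Longrightarrow> fourier_coeff b k = 0"
    using b by (auto simp: pow_part_def Hinf_def)
  obtain r G where r: "integrable circle G"
    "AE z in circle. (\<lambda>k. fourier_sum b (r k) z) \<longlonglongrightarrow> b z"
    "AE z in circle. \<forall>k. cmod (fourier_sum b (r k) z) \<le> G z"
    "\<And>k. l2sq (\<lambda>z. b z - fourier_sum b (r k) z) \<le> (1/4) ^ k"
    by (rule L2_fourier_series_subsequence[OF Linf_subset_L2[OF bL]]) (rule that)
  obtain C where C: "C > 0" "AE z in circle. cmod (\<phi> z) \<le> C" using LinfE[OF \<phi>(2)] .
  define S where "S k = fourier_sum b (r k)" for k
  have "S k = (\<lambda>z. \<Sum>j\<le>r k. fourier_coeff b (int j) * z ^ j)" for k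
    unfolding S_def by (rule ext) (rule trig_poly_nonneg_freq[OF bneg])
  moreover have "(\<lambda>z. \<Sum>j\<le>r k. fourier_coeff b (int j) * z ^ j) \<in> multipliers" for k
    by (rule multiplier_polynomial) (rule pow_part_fourier_coeff[OF b LinfD[OF bL] n])
  ultimately have SM: "S k \<in> multipliers" for k by simp
  show ?thesis
  proof (rule M_L1_dominated_limit[of "\<lambda>k z. \<phi> z * S k z" "\<lambda>z. C * G z"])
    show "(\<lambda>z. \<phi> z * S k z) \<in> M" for k
      using multiplier_mult[OF SM \<phi>(1)] by (simp add: mult.commute)
    show "AE z in circle. \<forall>k. cmod (\<phi> z * S k z) \<le> C * G z"
      using C(2) r(3)
    proof eventually_elim
      case (elim z)
      then show ?case using C(1) by (auto simp: norm_mult S_def intro!: mult_mono)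
    qed
    show "AE z in circle. (\<lambda>k. \<phi> z * S k z) \<longlonglongrightarrow> \<phi> z * b z"
      using r(2) unfolding S_def by eventually_elim (intro tendsto_intros)
  qed (use r(1) \<phi> bL in \<open>auto intro: Linf_Lalpha Linf_mult\<close>)
qed

end

section \<open>Functions of $z^n$ and the components of a function\<close>

lemma rot_avg_rotate:
  assumes n: "n \<ge> 1" shows "rot_avg n f (unit_root n ^ i * z) = rot_avg n f z"
proof (induction i)
  case (Suc i)
  have step: "rot_avg n f (unit_root n * y) = rot_avg n f y" for y
  proof -
    have "(\<Sum>i<n. f (unit_root n ^ i * (unit_root n * y))) + f y = (\<Sum>i<Suc n. f (unit_root n ^ i * y))"
      unfolding sum.lessThan_Suc_shift by (simp add: mult_ac)
    also have "\<dots> = (\<Sum>i<n. f (unit_root n ^ i * y)) + f y"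
      using unit_root_power_self[OF n] by simp
    finally show ?thesis by (simp add: rot_avg_def)
  qed
  have "rot_avg n f (unit_root n ^ Suc i * z) = rot_avg n f (unit_root n * (unit_root n ^ i * z))"
    by (simp add: mult_ac)
  then show ?case using step Suc.IH by simp
qed simp

lemma Ex_unit_root_power:
  assumes n: "n \<ge> 1" and w: "w ^ n = 1" shows "\<exists>i. w = unit_root n ^ i"
proof -
  have "w \<in> (\<lambda>k. cis (2 * pi * real k / real n)) ` {..<n}"
    using bij_betw_imp_surj_on[OF Complex.bij_betw_roots_unity[of n]] w n by auto
  then obtain k where "w = cis (2 * pi * real k / real n)" by auto
  then have "w = unit_root n ^ k" unfolding unit_root_def Complex.DeMoivre by (simp add: mult_ac)
  then show ?thesis by blast
qed

lemma Ex_measurable_nth_root: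
  assumes n: "n \<ge> 1"
  obtains \<rho> where "\<rho> \<in> circle \<rightarrow>\<^sub>M circle" "\<And>z. cmod z = 1 \<Longrightarrow> \<rho> z ^ n = z"
proof -
  define \<rho> where "\<rho> z = (if z \<in> \<real>\<^sub>\<le>\<^sub>0 then cis (pi / real n) else indicator (- \<real>\<^sub>\<le>\<^sub>0) z *\<^sub>R exp (Ln z / of_nat n))" for z
  have c: "closed (\<real>\<^sub>\<le>\<^sub>0 :: complex set)" by (rule closed_nonpos_Reals_complex)
  have "(\<lambda>z. indicator (- \<real>\<^sub>\<le>\<^sub>0) z *\<^sub>R exp (Ln z / of_nat n)) \<in> borel_measurable borel"
    using n c by (intro borel_measurable_continuous_on_indicator continuous_intros) auto
  then have "\<rho> \<in> borel_measurable borel"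
    unfolding \<rho>_def[abs_def] using c by (intro measurable_If) auto
  then have m: "\<rho> \<in> borel_measurable circle" by (rule borel_measurable_circleI)
  have pw: "\<rho> z ^ n = z" if "cmod z = 1" for z
  proof (cases "z \<in> \<real>\<^sub>\<le>\<^sub>0")
    case True
    then obtain x where "z = of_real x" "x \<le> 0" by (auto elim: nonpos_Reals_cases)
    then have "z = -1" using that by simp
    then show ?thesis using True n by (simp add: \<rho>_def Complex.DeMoivre)
  next
    case False
    have "exp (Ln z / of_nat n) ^ n = exp (of_nat n * (Ln z / of_nat n))"
      by (rule exp_of_nat_mult[symmetric])
    also have "\<dots> = z"
    proof -
      have "z \<noteq> 0" using that by auto
      then show ?thesis using n by (simp add: exp_Ln)
    qed
    finally show ?thesis using False by (simp add: \<rho>_def)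
  qed
  have "\<rho> z \<in> sphere 0 1" if "z \<in> space circle" for z
  proof -
    have "cmod (\<rho> z) ^ n = 1" using pw[of z] that by (simp flip: norm_power)
    then have "cmod (\<rho> z) = 1" using n power_eq_1_iff[of "cmod (\<rho> z)" n] by simp
    then show ?thesis by simp
  qed
  then have "\<rho> \<in> circle \<rightarrow>\<^sub>M circle"
    unfolding measurable_cong_sets[OF refl sets_circle]
    using m by (intro measurable_restrict_space2) auto
  then show ?thesis using that pw by blast
qed

text \<open>
  A rotation invariant function takes the same value at all $n$-th roots of $z^n$, so it is the
  composition of $z^n$ with its restriction to a measurable branch of the root.
\<close>

lemma rot_avg_pow_part:
  assumes X: "rot_avg n f \<in> X" and f: "f \<in> borel_measurable circle" and n: "n \<ge> 1"
  shows "rot_avg n f \<in> pow_part n X"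
proof -
  obtain \<rho> where r: "\<rho> \<in> circle \<rightarrow>\<^sub>M circle" "\<And>z. cmod z = 1 \<Longrightarrow> \<rho> z ^ n = z"
    by (rule Ex_measurable_nth_root[OF n]) (rule that)
  have "rot_avg n f z = rot_avg n f (\<rho> (z ^ n))" if z: "cmod z = 1" for z
  proof -
    have z0: "z \<noteq> 0" using z by auto
    have "(\<rho> (z ^ n) / z) ^ n = 1" using r(2)[of "z ^ n"] z z0 by (simp add: norm_power power_divide)
    then obtain i where "\<rho> (z ^ n) / z = unit_root n ^ i" using Ex_unit_root_power[OF n] by blast
    then have "\<rho> (z ^ n) = unit_root n ^ i * z" using z0 by (simp add: field_simps)
    then show ?thesis using rot_avg_rotate[OF n] by simp
  qed
  moreover have "(\<lambda>z. rot_avg n f (\<rho> z)) \<in> borel_measurable circle"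
    by (rule measurable_compose[OF r(1) rot_avg_measurable[OF f]])
  ultimately show ?thesis
    unfolding pow_part_def using X by (auto intro!: bexI[of _ "\<lambda>z. rot_avg n f (\<rho> z)"] AE_circleI)
qed

definition rot_invariant :: "nat \<Rightarrow> (complex \<Rightarrow> complex) \<Rightarrow> bool" where
  "rot_invariant n h \<longleftrightarrow> (AE z in circle. \<forall>i. h (unit_root n ^ i * z) = h z)"

lemma rot_avg_mult_invariant:
  assumes "rot_invariant n h"
  shows "AE z in circle. rot_avg n (\<lambda>z. h z * f z) z = h z * rot_avg n f z"
  using assms unfolding rot_invariant_def
  by eventually_elim (simp add: rot_avg_def sum_distrib_left)

definition component :: "nat \<Rightarrow> (complex \<Rightarrow> complex) \<Rightarrow> nat \<Rightarrow> complex \<Rightarrow> complex" where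
  "component n f i = rot_avg n (\<lambda>z. z powi (1 - int i) * f z)"

text \<open>
  Inversion of the finite Fourier transform on the orbit of $z$ under the $n$-th roots of unity.
\<close>

lemma component_decomposition:
  assumes n: "n \<ge> 1" and z: "cmod z = 1"
  shows "f z = (\<Sum>i=1..n. z ^ (i - 1) * component n f i z)"
proof -
  have z0: "z \<noteq> 0" using z by auto
  let ?w = "unit_root n"
  have sw: "(?w ^ k) powi (- int j) = (?w ^ j) powi (- int k)" for j k
    by (simp add: power_int_minus power_mult[symmetric] mult.commute)
  have "(\<Sum>i=1..n. z ^ (i - 1) * component n f i z) = (\<Sum>j<n. z ^ j * component n f (Suc j) z)"
    by (rule sum.reindex_bij_witness[of _ Suc "\<lambda>i. i - 1"]) auto
  also have "\<dots> = (\<Sum>j<n. \<Sum>k<n. (f (?w ^ k * z) / of_nat n) * (?w ^ j) powi (- int k))"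
  proof (rule sum.cong)
    fix j
    have t: "z ^ j * ((?w ^ k * z) powi (1 - int (Suc j)) * f (?w ^ k * z)) = f (?w ^ k * z) * (?w ^ j) powi (- int k)" for k
    proof -
      have eq: "z ^ j * (?w ^ k * z) powi (1 - int (Suc j)) = (?w ^ k) powi (- int j)"
        using z0 by (simp add: power_int_mult_distrib power_int_minus power_mult_distrib)
      show ?thesis unfolding mult.assoc[symmetric] eq sw by (rule mult.commute)
    qed
    then show "z ^ j * component n f (Suc j) z = (\<Sum>k<n. (f (?w ^ k * z) / of_nat n) * (?w ^ j) powi (- int k))"
      unfolding component_def rot_avg_def times_divide_eq_right sum_distrib_left t
      by (simp add: sum_divide_distrib)
  qed simp
  also have "\<dots> = (\<Sum>k<n. (f (?w ^ k * z) / of_nat n) * (\<Sum>j<n. (?w ^ j) powi (- int k)))"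
    by (subst sum.swap) (simp only: sum_distrib_left)
  also have "\<dots> = (\<Sum>k<n. if k = 0 then f (?w ^ k * z) else 0)"
  proof (rule sum.cong)
    fix k assume k: "k \<in> {..<n}"
    have "int n dvd - int k \<longleftrightarrow> k = 0"
      using k by (auto simp: int_dvd_int_iff dest: dvd_imp_le)
    then show "(f (?w ^ k * z) / of_nat n) * (\<Sum>j<n. (?w ^ j) powi (- int k)) = (if k = 0 then f (?w ^ k * z) else 0)"
      unfolding sum_unit_root_powi[OF n] using n by auto
  qed simp
  also have "\<dots> = f z" using n by simp
  finally show ?thesis by simp
qed

text \<open>
  This identifies the pairing of components in the kernel part with an average. It holds for every
  decomposition of $f$ into invariant components, so none has to be singled out.
\<close>

lemma rot_avg_mult_cnj_decomposition:
  assumes F: "AE z in circle. f z = (\<Sum>i=1..n. z ^ (i - 1) * F i z)"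
    and inv: "\<And>i. i \<in> {1..n} \<Longrightarrow> rot_invariant n (F i)"
  shows "AE z in circle. rot_avg n (\<lambda>z. f z * cnj (\<phi> z)) z = (\<Sum>i=1..n. cnj (component n \<phi> i z) * F i z)"
proof -
  have "AE z in circle. f z * cnj (\<phi> z) = (\<Sum>i=1..n. F i z * (z ^ (i - 1) * cnj (\<phi> z)))"
    using F by eventually_elim (simp add: sum_distrib_right sum_distrib_left mult_ac)
  then have 1: "AE z in circle. rot_avg n (\<lambda>z. f z * cnj (\<phi> z)) z
      = rot_avg n (\<lambda>z. \<Sum>i=1..n. F i z * (z ^ (i - 1) * cnj (\<phi> z))) z"
    by (rule rot_avg_cong_AE)
  have 2: "rot_avg n (\<lambda>z. \<Sum>i=1..n. F i z * (z ^ (i - 1) * cnj (\<phi> z))) z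
      = (\<Sum>i=1..n. rot_avg n (\<lambda>z. F i z * (z ^ (i - 1) * cnj (\<phi> z))) z)" for z
    unfolding rot_avg_def by (subst sum.swap) (simp add: sum_divide_distrib)
  have "AE z in circle. \<forall>i\<in>{1..n}. rot_avg n (\<lambda>z. F i z * (z ^ (i - 1) * cnj (\<phi> z))) z
      = F i z * rot_avg n (\<lambda>z. z ^ (i - 1) * cnj (\<phi> z)) z"
    by (intro AE_finite_allI rot_avg_mult_invariant inv) auto
  moreover have "AE z in circle. \<forall>i\<in>{1..n}. rot_avg n (\<lambda>z. z ^ (i - 1) * cnj (\<phi> z)) z = cnj (component n \<phi> i z)"
  proof (rule AE_circleI, rule ballI)
    fix z :: complex and i assume z: "cmod z = 1" and i: "i \<in> {1..n}"
    have "y ^ (i - 1) = cnj (y powi (1 - int i))" if "cmod y = 1" for y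
    proof -
      have "cnj (y powi (1 - int i)) = y powi (- (1 - int i))" by (rule cnj_powi_circle[OF that])
      also have "- (1 - int i) = int (i - 1)" using i by auto
      finally show ?thesis by simp
    qed
    moreover have "cmod (unit_root n ^ k * z) = 1" for k using z by (simp add: norm_mult)
    ultimately show "rot_avg n (\<lambda>z. z ^ (i - 1) * cnj (\<phi> z)) z = cnj (component n \<phi> i z)"
      unfolding component_def rot_avg_def by (simp del: complex_cnj_power_int complex_cnj_power)
  qed
  ultimately show ?thesis
    using 1
  proof eventually_elim
    case (elim z)
    show ?case unfolding elim(3) 2 by (rule sum.cong) (use elim in \<open>auto simp: mult.commute\<close>)
  qed
qed

lemma component_rot_invariant: "n \<ge> 1 \<Longrightarrow> rot_invariant n (component n f i)"
  unfolding rot_invariant_def component_def by (auto simp: rot_avg_rotate)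

context continuous_rot_sym_norm
begin

text \<open>
  Functions in the closure are a priori only limits of functions of $z^n$; rotation invariance passes
  to the limit, since $\alpha$ is invariant and vanishes only on null functions.
\<close>

lemma Lalpha_pow_rot_invariant:
  assumes h: "h \<in> Lalpha_pow \<alpha> n" and n: "n \<ge> 1" shows "rot_invariant n h"
  unfolding rot_invariant_def AE_all_countable
proof
  fix i
  let ?w = "unit_root n ^ i"
  have hc: "h \<in> calL \<alpha>" using h unfolding Lalpha_pow_def alpha_closure_def by blast
  have hm [measurable]: "h \<in> borel_measurable circle" using hc by (rule calL_measurable)
  define D where "D z = h (?w * z) - h z" for z
  have Dm: "D \<in> borel_measurable circle"
    unfolding D_def[abs_def] by (intro borel_measurable_diff rotate_measurable[OF norm_unit_root_power hm] hm)
  have small: "norm_ext \<alpha> D \<le> ennreal e" if e: "e > 0" for e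
  proof -
    have "ennreal (e/2) > 0" using e by simp
    then obtain b where b: "b \<in> pow_part n Linf" "norm_ext \<alpha> (\<lambda>z. h z - b z) < ennreal (e/2)"
      using h unfolding Lalpha_pow_def alpha_closure_def by blast
    have bm: "b \<in> borel_measurable circle" using b(1) by (auto simp: pow_part_def dest: LinfD)
    define q where "q z = h z - b z" for z
    have qm: "q \<in> borel_measurable circle" unfolding q_def[abs_def] using hm bm by (rule borel_measurable_diff)
    have "AE z in circle. cmod (D z) = cmod (q (?w * z) + (-1) * q z)"
      using pow_part_rotate[OF b(1) n] by eventually_elim (simp add: D_def q_def)
    then have "norm_ext \<alpha> D = norm_ext \<alpha> (\<lambda>z. q (?w * z) + (-1) * q z)" by (rule norm_ext_AE_cong)
    also have "\<dots> \<le> norm_ext \<alpha> (\<lambda>z. q (?w * z)) + norm_ext \<alpha> (\<lambda>z. (-1) * q z)"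
      by (intro norm_ext_triangle rotate_measurable[OF norm_unit_root_power qm]) (use qm in auto)
    also have "norm_ext \<alpha> (\<lambda>z. (-1) * q z) = norm_ext \<alpha> q" by (rule norm_ext_AE_cong) simp
    also have "norm_ext \<alpha> (\<lambda>z. q (?w * z)) \<le> norm_ext \<alpha> q" by (rule norm_ext_rotate_le) simp
    also have "norm_ext \<alpha> q + norm_ext \<alpha> q \<le> ennreal (e/2) + ennreal (e/2)"
      using b(2) unfolding q_def by (intro add_mono) auto
    also have "\<dots> = ennreal e" using e by (subst ennreal_plus[symmetric]) auto
    finally show ?thesis by (simp add: add_right_mono)
  qed
  have "norm_ext \<alpha> D \<le> 0"
  proof (rule ennreal_le_epsilon)
    fix e :: real assume "0 < e"
    then show "norm_ext \<alpha> D \<le> 0 + ennreal e" using small by simp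
  qed
  then have "AE z in circle. D z = 0" by (intro norm_ext_eq_0 Dm) simp
  then show "AE z in circle. h (?w * z) = h z" by eventually_elim (simp add: D_def)
qed

lemma component_Lalpha_pow:
  assumes f: "f \<in> Lalpha \<alpha>" and n: "n \<ge> 1" shows "component n f i \<in> Lalpha_pow \<alpha> n"
proof -
  have fc: "f \<in> calL \<alpha>" by (rule Lalpha_calL[OF f])
  have fm: "f \<in> borel_measurable circle" using fc by (rule calL_measurable)
  let ?p = "\<lambda>z. z powi (1 - int i)"
  have pm: "(\<lambda>z. ?p z * g z) \<in> borel_measurable circle" if "g \<in> borel_measurable circle" for g
    by (rule borel_measurable_times[OF powi_measurable_circle that])
  have le: "norm_ext \<alpha> (component n g i) \<le> norm_ext \<alpha> g" if "g \<in> borel_measurable circle" for g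
  proof -
    have "norm_ext \<alpha> (component n g i) \<le> norm_ext \<alpha> (\<lambda>z. ?p z * g z)"
      unfolding component_def by (rule norm_ext_rot_avg_le[OF pm[OF that] n])
    also have "\<dots> = norm_ext \<alpha> g"
      by (rule norm_ext_AE_cong, rule AE_circleI) (simp add: norm_mult norm_powi_circle)
    finally show ?thesis .
  qed
  have cm: "component n g i \<in> borel_measurable circle" if "g \<in> borel_measurable circle" for g
    unfolding component_def by (rule rot_avg_measurable[OF pm[OF that]])
  show ?thesis
    unfolding Lalpha_pow_def alpha_closure_def
  proof (intro CollectI conjI allI impI)
    show "component n f i \<in> calL \<alpha>"
      using order_le_less_trans[OF le[OF fm]] fc cm[OF fm] by (auto simp: calL_def)
    fix e :: ennreal assume "0 < e"
    then obtain b where b: "b \<in> Linf" "norm_ext \<alpha> (\<lambda>z. f z - b z) < e"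
      using f unfolding Lalpha_def alpha_closure_def by blast
    have bm: "b \<in> borel_measurable circle" by (rule LinfD[OF b(1)])
    have "component n b i \<in> pow_part n Linf"
      unfolding component_def
      by (intro rot_avg_pow_part rot_avg_Linf Linf_mult powi_Linf b n pm[OF bm])
    moreover have "norm_ext \<alpha> (\<lambda>z. component n f i z - component n b i z) < e"
    proof -
      have "(\<lambda>z. component n f i z - component n b i z) = component n (\<lambda>z. f z - b z) i"
        by (simp add: component_def rot_avg_def fun_eq_iff right_diff_distrib sum_subtractf diff_divide_distrib)
      then show ?thesis using le[of "\<lambda>z. f z - b z"] fm bm b(2) by (auto intro: order_le_less_trans)
    qed
    ultimately show "\<exists>g\<in>pow_part n Linf. norm_ext \<alpha> (\<lambda>z. component n f i z - g z) < e" by blast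
  qed
qed

end

section \<open>The wandering vector\<close>

lemma parallelogram_l2sq:
  assumes "f \<in> L2" "g \<in> L2"
  shows "l2sq (\<lambda>z. f z - g z) = 2 * l2sq f + 2 * l2sq g - l2sq (\<lambda>z. f z + g z)"
proof -
  have "l2sq (\<lambda>z. f z - (-1) * g z) = l2sq f - 2 * Re (LINT z|circle. f z * cnj ((-1) * g z)) + l2sq (\<lambda>z. (-1) * g z)"
    by (rule l2sq_diff[OF assms(1) L2_cmult[OF assms(2)]])
  moreover have "l2sq (\<lambda>z. (-1) * g z) = l2sq g" by (simp add: l2sq_def)
  ultimately show ?thesis using l2sq_diff[OF assms] by simp
qed

lemma l2sq_cmult: "l2sq (\<lambda>z. c * f z) = (cmod c)\<^sup>2 * l2sq f"
  by (simp add: l2sq_def norm_mult power_mult_distrib)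

lemma l2sq_power_mult: "l2sq (\<lambda>z. z ^ k * f z) = l2sq f"
  unfolding l2sq_def by (rule Bochner_Integration.integral_cong) (auto simp: norm_mult norm_power)

lemma l2sq_eq_0_iff:
  assumes "f \<in> L2" shows "l2sq f = 0 \<longleftrightarrow> (AE z in circle. f z = 0)"
  unfolding l2sq_def using integral_nonneg_eq_0_iff_AE[OF L2_integrable_sq[OF assms]] by simp

context invariant_subspace
begin

lemma M_power_n_mult: "f \<in> M \<Longrightarrow> (\<lambda>z. z ^ (n * q) * f z) \<in> M"
  by (rule multiplier_mult[OF multiplier_power_n]) auto

text \<open>
  If all dampened functions $h_m f$ were in $z^n M$, then $z^{-n} h_m f$ would be in $M$, and so would
  their dominated limit $z^{-n} f$.
\<close>

lemma exists_bounded_outside_shift: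
  assumes proper: "mult_set (\<lambda>z. z ^ n) M \<noteq> M"
  obtains g where "g \<in> M" "g \<in> Linf" "g \<notin> mult_set (\<lambda>z. z ^ n) M"
proof -
  obtain f where f: "f \<in> M" "f \<notin> mult_set (\<lambda>z. z ^ n) M" using proper inv by blast
  have fm: "f \<in> borel_measurable circle" by (rule M_measurable[OF f(1)])
  obtain h where h: "\<And>m::nat. h m \<in> multipliers" "\<And>m. AE z in circle. cmod (h m z) \<le> 1"
    "\<And>m. (\<lambda>z. h m z * f z) \<in> M \<inter> Linf" "AE z in circle. (\<lambda>m. h m z) \<longlonglongrightarrow> 1"
    by (rule M_bounded_approximation[OF f(1)]) (rule that)
  have "\<exists>m. (\<lambda>z. h m z * f z) \<notin> mult_set (\<lambda>z. z ^ n) M"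
  proof (rule ccontr)
    assume "\<not> ?thesis"
    then have "\<forall>m. \<exists>k\<in>M. AE z in circle. h m z * f z = z ^ n * k z" by (auto simp: mult_set_def)
    then obtain k where k: "\<And>m. k m \<in> M" "\<And>m. AE z in circle. h m z * f z = z ^ n * k m z" by metis
    have keq: "AE z in circle. k m z = z powi (- int n) * (h m z * f z)" for m
      using k(2)[of m] AE_space
    proof eventually_elim
      case (elim z)
      then have "z \<noteq> 0" by auto
      then show ?case unfolding elim(1) by (simp add: power_int_minus)
    qed
    define F where "F z = z powi (- int n) * f z" for z
    have Fm: "F \<in> borel_measurable circle" unfolding F_def[abs_def] by (rule borel_measurable_times[OF powi_measurable_circle fm])
    have "F \<in> M"
    proof (rule M_dominated_limit[OF M_Lalpha[OF f(1)], of k])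
      show "AE z in circle. cmod (k m z) \<le> 1 * cmod (f z)" for m
        using keq[of m] h(2)[of m] AE_space
      proof eventually_elim
        case (elim z)
        have "cmod (k m z) = cmod (h m z) * cmod (f z)"
          using elim(1,3) by (simp add: norm_mult norm_powi_circle)
        also have "\<dots> \<le> 1 * cmod (f z)" by (rule mult_right_mono[OF elim(2)]) simp
        finally show ?case .
      qed
      have "AE z in circle. \<forall>m. k m z = z powi (- int n) * (h m z * f z)"
        unfolding AE_all_countable using keq by blast
      then show "AE z in circle. (\<lambda>m. k m z) \<longlonglongrightarrow> F z"
        using h(4)
      proof eventually_elim
        case (elim z)
        have "(\<lambda>m. z powi (- int n) * (h m z * f z)) \<longlonglongrightarrow> z powi (- int n) * (1 * f z)"
          by (intro tendsto_mult tendsto_const elim)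
        then show ?case unfolding F_def using elim(1) by simp
      qed
    qed (use k Fm in auto)
    moreover have "AE z in circle. f z = z ^ n * F z"
    proof (rule AE_circleI)
      fix z :: complex assume "cmod z = 1"
      then have "z \<noteq> 0" by auto
      then show "f z = z ^ n * F z" by (simp add: F_def power_int_minus)
    qed
    ultimately have "f \<in> mult_set (\<lambda>z. z ^ n) M" using fm by (auto simp: mult_set_def)
    with f show False by simp
  qed
  then show ?thesis using h(3) that by blast
qed

text \<open>
  A sequence that minimizes the $L^2$ distance from $g$ with error $4^{-(i+1)}$ is rapidly Cauchy by the
  parallelogram law.
\<close>

lemma exists_minimizing_limit:
  assumes g: "g \<in> M" "g \<in> Linf"
  obtains m F G where "\<And>i. m i \<in> M \<inter> Linf" "F \<in> L2" "integrable circle G"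
    "AE z in circle. (\<lambda>i. m i z) \<longlonglongrightarrow> F z" "AE z in circle. \<forall>i. cmod (m i z) \<le> G z"
    "\<And>i. l2sq (\<lambda>z. F z - m i z) \<le> (1/4) ^ i"
    "\<And>i u. u \<in> M \<inter> Linf \<Longrightarrow> l2sq (\<lambda>z. g z - z ^ n * m i z) \<le> l2sq (\<lambda>z. g z - z ^ n * u z) + (1/4) ^ Suc i"
proof -
  define N where "N = M \<inter> Linf"
  define Q where "Q u = l2sq (\<lambda>z. g z - z ^ n * u z)" for u
  define d where "d = Inf (Q ` N)"
  have N0: "(\<lambda>z. 0) \<in> N" by (simp add: N_def M_zero const_Linf)
  have Qbdd: "bdd_below (Q ` N)" by (rule bdd_belowI2[of _ 0]) (simp add: Q_def l2sq_nonneg)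
  have Qd: "d \<le> Q u" if "u \<in> N" for u unfolding d_def by (rule cINF_lower[OF Qbdd that])
  have "\<exists>u\<in>N. Q u < d + (1/4) ^ Suc i" for i
  proof -
    have "Inf (Q ` N) < d + (1/4) ^ Suc i" by (simp add: d_def)
    then show ?thesis using N0 by (subst (asm) cINF_less_iff[OF _ Qbdd]) auto
  qed
  then obtain m where m: "\<And>i. m i \<in> N" "\<And>i. Q (m i) < d + (1/4) ^ Suc i" by metis
  have res: "(\<lambda>z. g z - z ^ n * u z) \<in> L2" if "u \<in> N" for u
    using that g by (intro Linf_subset_L2 Linf_diff Linf_mult power_Linf) (auto simp: N_def)
  have C: "l2sq (\<lambda>z. m j z - m i z) \<le> (1/4) ^ i" if "i \<le> j" for i j
  proof -
    define h where "h z = (1/2) * (m i z + m j z)" for z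
    have hN: "h \<in> N" using m(1)[of i] m(1)[of j] unfolding N_def h_def[abs_def]
      by (intro IntI M_cmult M_add Linf_cmult Linf_add) auto
    have "l2sq (\<lambda>z. m j z - m i z) = l2sq (\<lambda>z. z ^ n * (m j z - m i z))" by (rule l2sq_power_mult[symmetric])
    also have "\<dots> = l2sq (\<lambda>z. (g z - z ^ n * m i z) - (g z - z ^ n * m j z))" by (simp add: right_diff_distrib)
    also have "\<dots> = 2 * Q (m i) + 2 * Q (m j) - l2sq (\<lambda>z. (g z - z ^ n * m i z) + (g z - z ^ n * m j z))"
      unfolding Q_def by (rule parallelogram_l2sq[OF res[OF m(1)] res[OF m(1)]])
    also have "l2sq (\<lambda>z. (g z - z ^ n * m i z) + (g z - z ^ n * m j z)) = l2sq (\<lambda>z. 2 * (g z - z ^ n * h z))"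
      by (simp add: h_def algebra_simps)
    also have "\<dots> = 4 * Q h" unfolding Q_def l2sq_cmult by simp
    finally have "l2sq (\<lambda>z. m j z - m i z) \<le> 2 * (1/4) ^ Suc i + 2 * (1/4) ^ Suc j"
      using m(2)[of i] m(2)[of j] Qd[OF hN] by linarith
    moreover have "(1/4::real) ^ j \<le> (1/4) ^ i" using that by (intro power_decreasing) auto
    ultimately show ?thesis unfolding power_Suc by linarith
  qed
  have mL2: "m i \<in> L2" for i using m(1)[of i] by (auto simp: N_def intro: Linf_subset_L2)
  obtain F G where "F \<in> L2" "integrable circle G" "AE z in circle. (\<lambda>k. m k z) \<longlonglongrightarrow> F z"
    "AE z in circle. \<forall>k. cmod (m k z) \<le> G z" "\<And>k. l2sq (\<lambda>z. F z - m k z) \<le> (1/4) ^ k"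
    by (rule L2_rapid_Cauchy[OF mL2 C]) (assumption, rule that)
  moreover have "Q (m i) \<le> Q u + (1/4) ^ Suc i" if "u \<in> N" for i u using m(2)[of i] Qd[OF that] by linarith
  ultimately show ?thesis using that[of m F G] m(1) unfolding N_def Q_def by blast
qed

text \<open>
  Moving $p_i$ in the direction of $w$ by a step of size $t = 2^{-i}$ cannot gain more than the error
  $4^{-(i+1)}$, which forces $|\langle p_i, w \rangle|$ to be of the order of $t$.
\<close>

lemma minimizing_limit_orthogonal:
  fixes p :: "nat \<Rightarrow> complex \<Rightarrow> complex"
  assumes p: "\<And>i. p i \<in> L2" and w: "w \<in> L2" and F: "F \<in> L2" and C: "\<And>i. l2sq (\<lambda>z. F z - p i z) \<le> (1/4) ^ i"
    and min: "\<And>i c. l2sq (p i) \<le> l2sq (\<lambda>z. p i z - c * w z) + (1/4) ^ Suc i"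
  shows "(LINT z|circle. w z * cnj (F z)) = 0"
proof -
  define I where "I i = (LINT z|circle. p i z * cnj (w z))" for i
  have bound: "cmod (I i) \<le> (1 + l2sq w) * (1/2) ^ i" for i
  proof -
    define t where "t = (1/2::real) ^ i"
    have t: "t > 0" by (simp add: t_def)
    define c where "c = of_real t * sgn (I i)"
    have cw: "(\<lambda>z. c * w z) \<in> L2" by (rule L2_cmult[OF w])
    have "(LINT z|circle. p i z * cnj (c * w z)) = cnj c * I i"
      unfolding I_def by (simp add: mult.left_commute)
    also have "\<dots> = of_real (t * cmod (I i))"
      by (cases "I i = 0") (simp_all add: c_def sgn_eq complex_norm_square[symmetric] power2_eq_square field_simps)
    finally have in1: "Re (LINT z|circle. p i z * cnj (c * w z)) = t * cmod (I i)" by simp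
    have "cmod c \<le> t" using t by (cases "I i = 0") (auto simp: c_def norm_mult norm_sgn)
    then have "(cmod c)\<^sup>2 \<le> t\<^sup>2" by (rule power_mono) simp
    then have cw2: "l2sq (\<lambda>z. c * w z) \<le> t\<^sup>2 * l2sq w"
      unfolding l2sq_cmult by (rule mult_right_mono) (rule l2sq_nonneg)
    have "l2sq (p i) \<le> l2sq (\<lambda>z. p i z - c * w z) + (1/4) ^ Suc i" by (rule min)
    also have "l2sq (\<lambda>z. p i z - c * w z) = l2sq (p i) - 2 * (t * cmod (I i)) + l2sq (\<lambda>z. c * w z)"
      unfolding l2sq_diff[OF p cw] in1 ..
    also have "(1/4::real) ^ Suc i \<le> t\<^sup>2"
      by (simp add: t_def power2_eq_square power_mult_distrib[symmetric])
    finally have "2 * (t * cmod (I i)) \<le> t\<^sup>2 * l2sq w + t\<^sup>2" using cw2 by simp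
    then have "t * (2 * cmod (I i)) \<le> t * (t * (1 + l2sq w))" by (simp add: power2_eq_square algebra_simps)
    then have "2 * cmod (I i) \<le> t * (1 + l2sq w)" using t by (simp only: mult_le_cancel_left_pos)
    then have "cmod (I i) \<le> t * (1 + l2sq w)" using norm_ge_zero[of "I i"] by linarith
    then show ?thesis by (simp add: t_def mult.commute)
  qed
  have "I \<longlonglongrightarrow> 0"
  proof (rule Lim_null_comparison)
    show "\<forall>\<^sub>F i in sequentially. norm (I i) \<le> (1 + l2sq w) * (1/2) ^ i" using bound by simp
    show "(\<lambda>i. (1 + l2sq w) * (1/2) ^ i :: real) \<longlonglongrightarrow> 0"
      by (rule tendsto_mult_right_zero) (rule LIMSEQ_power_zero, simp)
  qed
  moreover have "I \<longlonglongrightarrow> (LINT z|circle. F z * cnj (w z))"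
    unfolding I_def[abs_def] by (rule l2_inner_tendsto[OF F p C L2_cnj[OF w]])
  ultimately have "(LINT z|circle. F z * cnj (w z)) = 0" using LIMSEQ_unique by blast
  then have "cnj (LINT z|circle. F z * cnj (w z)) = 0" by simp
  then have "(LINT z|circle. cnj (F z * cnj (w z))) = 0" unfolding Bochner_Integration.integral_cnj .
  then show ?thesis by (simp add: mult.commute)
qed

text \<open>
  Averaging keeps only the frequencies divisible by $n$. At negative ones the coefficients vanish by
  assumption, at positive ones by conjugation, since $|F|^2$ is real.
\<close>

lemma rot_avg_abs_sq_constant:
  assumes F: "F \<in> L2" and orth: "\<And>l. l \<ge> 1 \<Longrightarrow> (LINT z|circle. z ^ (n * l) * F z * cnj (F z)) = 0"
  shows "AE z in circle. rot_avg n (\<lambda>z. F z * cnj (F z)) z = of_real (l2sq F)"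
proof (rule fourier_coeff_eq_imp_AE_eq)
  have i: "integrable circle (\<lambda>z. F z * cnj (F z))" by (rule L2_integrable_mult[OF F L2_cnj[OF F]])
  show "integrable circle (rot_avg n (\<lambda>z. F z * cnj (F z)))" by (rule rot_avg_integrable[OF i])
  show "integrable circle (\<lambda>z. complex_of_real (l2sq F))" by simp
  fix k :: int
  have neg: "fourier_coeff (\<lambda>z. F z * cnj (F z)) (- int (n * l)) = 0" if "l \<ge> 1" for l
    using orth[OF that] by (simp add: fourier_coeff_def mult_ac del: of_nat_mult)
  have sym: "fourier_coeff (\<lambda>z. F z * cnj (F z)) j = cnj (fourier_coeff (\<lambda>z. F z * cnj (F z)) (- j))" for j
    using fourier_coeff_cnj[of "\<lambda>z. F z * cnj (F z)" j] by (simp add: mult.commute)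
  have const: "fourier_coeff (\<lambda>z. complex_of_real (l2sq F)) k = (if k = 0 then of_real (l2sq F) else 0)"
    using fourier_coeff_cmult[of "of_real (l2sq F)" "\<lambda>z. z powi 0" k]
    unfolding fourier_coeff_powi by simp
  show "fourier_coeff (rot_avg n (\<lambda>z. F z * cnj (F z))) k = fourier_coeff (\<lambda>z. complex_of_real (l2sq F)) k"
  proof (cases "int n dvd k \<and> k \<noteq> 0")
    case True
    then obtain q where q: "k = int n * q" "q \<noteq> 0" by (auto simp: dvd_def)
    have "fourier_coeff (\<lambda>z. F z * cnj (F z)) k = 0"
    proof (cases "q > 0")
      case True
      then have "- k = - int (n * nat q)" "nat q \<ge> 1" using q by auto
      then show ?thesis using neg[of "nat q"] sym[of k] by simp
    next
      case False
      then have "k = - int (n * nat (- q))" "nat (- q) \<ge> 1" using q by auto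
      then show ?thesis using neg[of "nat (- q)"] by simp
    qed
    then show ?thesis using True by (simp add: fourier_coeff_rot_avg[OF i n] const)
  next
    case False
    have "fourier_coeff (\<lambda>z. F z * cnj (F z)) 0 = of_real (l2sq F)"
    proof -
      have "fourier_coeff (\<lambda>z. F z * cnj (F z)) 0 = (LINT z|circle. complex_of_real ((cmod (F z))\<^sup>2))"
        unfolding fourier_coeff_def by (simp only: complex_norm_square) simp
      then show ?thesis unfolding l2sq_def integral_complex_of_real .
    qed
    then show ?thesis using False by (auto simp: fourier_coeff_rot_avg[OF i n] const)
  qed
qed

lemma exists_wandering_vector:
  assumes proper: "mult_set (\<lambda>z. z ^ n) M \<noteq> M"
  obtains \<phi> where "\<phi> \<in> M" "\<phi> \<in> Linf" "AE z in circle. rot_avg n (\<lambda>z. \<phi> z * cnj (\<phi> z)) z = 1"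
    "\<And>u. u \<in> M \<inter> Linf \<Longrightarrow> (LINT z|circle. z ^ n * u z * cnj (\<phi> z)) = 0"
proof -
  obtain g where g: "g \<in> M" "g \<in> Linf" "g \<notin> mult_set (\<lambda>z. z ^ n) M"
    by (rule exists_bounded_outside_shift[OF proper]) (rule that)
  obtain m F G where m: "\<And>i. m i \<in> M \<inter> Linf" "F \<in> L2" "integrable circle G"
    "AE z in circle. (\<lambda>i. m i z) \<longlonglongrightarrow> F z" "AE z in circle. \<forall>i. cmod (m i z) \<le> G z"
    "\<And>i. l2sq (\<lambda>z. F z - m i z) \<le> (1/4) ^ i"
    "\<And>i u. u \<in> M \<inter> Linf \<Longrightarrow> l2sq (\<lambda>z. g z - z ^ n * m i z) \<le> l2sq (\<lambda>z. g z - z ^ n * u z) + (1/4) ^ Suc i"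
    by (rule exists_minimizing_limit[OF g(1,2)]) (rule that)
  define p where "p i z = g z - z ^ n * m i z" for i z
  define f where "f z = g z - z ^ n * F z" for z
  have gL2: "g \<in> L2" by (rule Linf_subset_L2[OF g(2)])
  have pM: "p i \<in> M" for i unfolding p_def[abs_def] using m(1)[of i] g by (auto intro: M_diff M_mult_power)
  have pLinf: "p i \<in> Linf" for i
    unfolding p_def[abs_def] using m(1)[of i] g by (intro Linf_diff Linf_mult power_Linf) auto
  have pL2: "p i \<in> L2" for i by (rule Linf_subset_L2[OF pLinf])
  have fL2: "f \<in> L2" unfolding f_def[abs_def] by (intro L2_diff gL2 L2_bounded_mult[OF m(2) power_Linf])
  have fm: "f \<in> borel_measurable circle" by (rule L2D[OF fL2])
  have fp: "l2sq (\<lambda>z. f z - p i z) \<le> (1/4) ^ i" for i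
  proof -
    have "(\<lambda>z. f z - p i z) = (\<lambda>z. (-1) * (z ^ n * (F z - m i z)))" by (simp add: f_def p_def algebra_simps fun_eq_iff)
    then have "l2sq (\<lambda>z. f z - p i z) = l2sq (\<lambda>z. F z - m i z)"
      by (simp only: l2sq_cmult l2sq_power_mult) simp
    then show ?thesis using m(6) by simp
  qed
  have orth: "(LINT z|circle. z ^ n * u z * cnj (f z)) = 0" if u: "u \<in> M \<inter> Linf" for u
  proof (rule minimizing_limit_orthogonal[OF pL2 _ fL2 fp])
    show "(\<lambda>z. z ^ n * u z) \<in> L2" using u by (intro L2_bounded_mult power_Linf Linf_subset_L2) auto
    fix i c
    have "(\<lambda>z. m i z + c * u z) \<in> M \<inter> Linf" using m(1)[of i] u
      by (intro IntI M_add M_cmult Linf_add Linf_cmult) auto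
    from m(7)[OF this, of i]
    show "l2sq (p i) \<le> l2sq (\<lambda>z. p i z - c * (z ^ n * u z)) + (1/4) ^ Suc i"
      by (simp add: p_def[abs_def] algebra_simps)
  qed
  have orth_self: "(LINT z|circle. z ^ (n * l) * f z * cnj (f z)) = 0" if l: "l \<ge> 1" for l
  proof -
    define w where "w z = z ^ (n * l) * cnj (f z)" for z
    have wL2: "w \<in> L2" unfolding w_def[abs_def] by (intro L2_bounded_mult[OF L2_cnj[OF fL2] power_Linf])
    have "(\<lambda>i. LINT z|circle. p i z * w z) \<longlonglongrightarrow> (LINT z|circle. f z * w z)"
      by (rule l2_inner_tendsto[OF fL2 pL2 fp wL2])
    moreover have "(LINT z|circle. p i z * w z) = 0" for i
    proof -
      have e: "n * l = n + n * (l - 1)" using l by (cases l) auto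
      have mem: "(\<lambda>z. z ^ (n * (l - 1)) * p i z) \<in> M \<inter> Linf"
        using M_power_n_mult[OF pM] Linf_mult[OF power_Linf pLinf] by auto
      have eq: "p i z * w z = z ^ n * (z ^ (n * (l - 1)) * p i z) * cnj (f z)" for z
        unfolding w_def e power_add by (simp only: mult_ac)
      show ?thesis unfolding eq by (rule orth[OF mem])
    qed
    ultimately have "(LINT z|circle. f z * w z) = 0" by (simp add: LIMSEQ_const_iff)
    then show ?thesis by (simp add: w_def mult_ac)
  qed
  define c where "c = l2sq f"
  have avg: "AE z in circle. rot_avg n (\<lambda>z. f z * cnj (f z)) z = of_real c"
    unfolding c_def by (rule rot_avg_abs_sq_constant[OF fL2 orth_self])
  have c0: "c \<ge> 0" by (simp add: c_def l2sq_nonneg)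
  \<comment> \<open>$|f|^2$ is one of the $n$ summands of $n\,E(|f|^2) = nc$.\<close>
  have fbd: "AE z in circle. cmod (f z) \<le> sqrt (real n * c)"
    using avg
  proof eventually_elim
    case (elim z)
    define S where "S = (\<Sum>i<n. (cmod (f (unit_root n ^ i * z)))\<^sup>2)"
    have "(cmod (f (unit_root n ^ 0 * z)))\<^sup>2 \<le> S"
      unfolding S_def using n by (intro member_le_sum[of 0]) auto
    then have le: "(cmod (f z))\<^sup>2 \<le> S" by simp
    have "(\<Sum>i<n. f (unit_root n ^ i * z) * cnj (f (unit_root n ^ i * z))) = complex_of_real S"
      by (simp only: S_def of_real_sum complex_norm_square)
    then have "complex_of_real S / of_nat n = of_real c" using elim by (simp only: rot_avg_def)
    then have "complex_of_real S = complex_of_real (real n * c)" using n by (simp add: field_simps)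
    then have "S = real n * c" by (simp only: of_real_eq_iff)
    then show ?case using le by (intro real_le_rsqrt) simp
  qed
  have fLinf: "f \<in> Linf" using fm fbd by (auto simp: Linf_def)
  have fM: "f \<in> M"
  proof -
    obtain D where D: "D > 0" "AE z in circle. cmod (g z) \<le> D" using LinfE[OF g(2)] .
    show ?thesis
    proof (rule M_L1_dominated_limit[of p "\<lambda>z. D + G z"])
      show "AE z in circle. \<forall>i. cmod (p i z) \<le> D + G z"
        using D(2) m(5) AE_space
      proof eventually_elim
        case (elim z)
        show ?case
        proof
          fix i
          have "cmod (p i z) \<le> cmod (g z) + cmod (z ^ n * m i z)" unfolding p_def by (rule norm_triangle_ineq4)
          also have "cmod (z ^ n * m i z) = cmod (m i z)" using elim(3) by (simp add: norm_mult norm_power)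
          finally show "cmod (p i z) \<le> D + G z" using elim(1,2) by (smt (verit))
        qed
      qed
      show "AE z in circle. (\<lambda>i. p i z) \<longlonglongrightarrow> f z"
        using m(4) by eventually_elim (auto simp: p_def f_def intro!: tendsto_intros)
    qed (use pM m(3) Linf_Lalpha[OF fLinf] in auto)
  qed
  \<comment> \<open>Otherwise $g = z^n F$, where the bounded function $F$ is a dominated limit of the $m_i$ and so in $M$.\<close>
  have cpos: "c > 0"
  proof (rule ccontr)
    assume "\<not> c > 0"
    then have "c = 0" using c0 by simp
    then have "AE z in circle. f z = 0" using l2sq_eq_0_iff[OF fL2] by (simp add: c_def)
    then have gF: "AE z in circle. g z = z ^ n * F z" by eventually_elim (simp add: f_def)
    obtain D where D: "D > 0" "AE z in circle. cmod (g z) \<le> D" using LinfE[OF g(2)] .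
    have "AE z in circle. cmod (F z) \<le> D"
      using gF D(2) AE_space by eventually_elim (simp add: norm_mult norm_power)
    then have "F \<in> Linf" using m(2) by (auto simp: Linf_def dest: L2D)
    then have "F \<in> M"
      using m(1) by (intro M_L1_dominated_limit[OF _ m(3,5,4)] Linf_Lalpha) auto
    then have "g \<in> mult_set (\<lambda>z. z ^ n) M"
      using gF LinfD[OF g(2)] by (auto simp: mult_set_def)
    with g(3) show False ..
  qed
  define s where "s = complex_of_real (1 / sqrt c)"
  show ?thesis
  proof (rule that[of "\<lambda>z. s * f z"])
    show "(\<lambda>z. s * f z) \<in> M" by (rule M_cmult[OF fM])
    show "(\<lambda>z. s * f z) \<in> Linf" by (rule Linf_cmult[OF fLinf])
    have ss: "s * cnj s * of_real c = 1"
    proof -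
      have "s * cnj s = of_real ((1 / sqrt c) * (1 / sqrt c))" by (simp only: s_def complex_cnj_complex_of_real of_real_mult)
      also have "(1 / sqrt c) * (1 / sqrt c) = 1 / c" using cpos by (simp add: real_sqrt_mult_self)
      finally show ?thesis using cpos by simp
    qed
    have sc: "rot_avg n (\<lambda>z. s * f z * cnj (s * f z)) z = s * cnj s * rot_avg n (\<lambda>z. f z * cnj (f z)) z" for z
      unfolding rot_avg_def times_divide_eq_right sum_distrib_left by (simp add: mult_ac)
    show "AE z in circle. rot_avg n (\<lambda>z. s * f z * cnj (s * f z)) z = 1"
      using avg by eventually_elim (simp only: sc ss)
    show "(LINT z|circle. z ^ n * u z * cnj (s * f z)) = 0" if u: "u \<in> M \<inter> Linf" for u
    proof -
      have "(LINT z|circle. z ^ n * u z * cnj (s * f z)) = cnj s * (LINT z|circle. z ^ n * u z * cnj (f z))"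
        by (simp add: mult_ac)
      then show ?thesis using orth[OF u] by simp
    qed
  qed
qed

end

section \<open>The direct sum decomposition\<close>

lemma Linf_cnj: "f \<in> Linf \<Longrightarrow> (\<lambda>z. cnj (f z)) \<in> Linf"
  by (auto simp: Linf_def)

text \<open>
  Orthogonality is required only to $z^n u$ with bounded $u$, where it is a statement about $L^2$; this
  reaches all of $M$, because every element of $M$ is an $\alpha$-limit of bounded ones.
\<close>

locale wandering_vector = invariant_subspace +
  fixes \<phi> :: "complex \<Rightarrow> complex"
  assumes phi_M: "\<phi> \<in> M" and phi_Linf: "\<phi> \<in> Linf"
    and phi_unit: "AE z in circle. rot_avg n (\<lambda>z. \<phi> z * cnj (\<phi> z)) z = 1"
    and phi_orth: "\<And>u. u \<in> M \<inter> Linf \<Longrightarrow> (LINT z|circle. z ^ n * u z * cnj (\<phi> z)) = 0"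
begin

definition coordinate :: "(complex \<Rightarrow> complex) \<Rightarrow> complex \<Rightarrow> complex" where
  "coordinate f = rot_avg n (\<lambda>z. f z * cnj (\<phi> z))"

lemma phi_measurable: "\<phi> \<in> borel_measurable circle"
  by (rule LinfD[OF phi_Linf])

lemma mult_cnj_phi_measurable:
  "f \<in> borel_measurable circle \<Longrightarrow> (\<lambda>z. f z * cnj (\<phi> z)) \<in> borel_measurable circle"
  by (intro borel_measurable_times cnj_measurable phi_measurable)

lemma coordinate_measurable: "f \<in> borel_measurable circle \<Longrightarrow> coordinate f \<in> borel_measurable circle"
  unfolding coordinate_def by (intro rot_avg_measurable mult_cnj_phi_measurable)

lemma coordinate_diff: "coordinate (\<lambda>z. f z - g z) z = coordinate f z - coordinate g z"
  by (simp add: coordinate_def rot_avg_def left_diff_distrib sum_subtractf diff_divide_distrib)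

lemma coordinate_cong_AE: "AE z in circle. f z = g z \<Longrightarrow> AE z in circle. coordinate f z = coordinate g z"
  unfolding coordinate_def by (rule rot_avg_cong_AE) (auto elim: eventually_mono)

lemma coordinate_phi_mult:
  assumes h: "rot_invariant n h" shows "AE z in circle. coordinate (\<lambda>z. \<phi> z * h z) z = h z"
proof -
  have "(\<lambda>z. \<phi> z * h z * cnj (\<phi> z)) = (\<lambda>z. h z * (\<phi> z * cnj (\<phi> z)))" by (simp add: mult_ac)
  then show ?thesis
    using rot_avg_mult_invariant[OF h, of "\<lambda>z. \<phi> z * cnj (\<phi> z)"] phi_unit
    unfolding coordinate_def by (auto elim: eventually_elim2)
qed

lemma coordinate_norm_le:
  obtains C where "C > 0" "\<And>f. f \<in> borel_measurable circle \<Longrightarrow> norm_ext \<alpha> (coordinate f) \<le> ennreal C * norm_ext \<alpha> f"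
proof -
  obtain C where C: "C > 0" "AE z in circle. cmod (\<phi> z) \<le> C" using LinfE[OF phi_Linf] .
  have "norm_ext \<alpha> (coordinate f) \<le> ennreal C * norm_ext \<alpha> f" if f: "f \<in> borel_measurable circle" for f
  proof -
    have "norm_ext \<alpha> (coordinate f) \<le> norm_ext \<alpha> (\<lambda>z. f z * cnj (\<phi> z))"
      unfolding coordinate_def by (rule norm_ext_rot_avg_le[OF mult_cnj_phi_measurable[OF f] n])
    also have "\<dots> = norm_ext \<alpha> (\<lambda>z. cnj (\<phi> z) * f z)" by (simp add: mult.commute)
    also have "\<dots> \<le> ennreal C * norm_ext \<alpha> f" by (rule norm_ext_bounded_mult_le) (use C in auto)
    finally show ?thesis .
  qed
  then show ?thesis using that C(1) by blast
qed

lemma coordinate_bounded_Hinf: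
  assumes u: "u \<in> M \<inter> Linf" shows "coordinate u \<in> pow_part n Hinf"
  unfolding coordinate_def
proof (rule rot_avg_pow_part[OF _ _ n])
  have uphi: "(\<lambda>z. u z * cnj (\<phi> z)) \<in> Linf" using u by (intro Linf_mult Linf_cnj phi_Linf) auto
  then show "(\<lambda>z. u z * cnj (\<phi> z)) \<in> borel_measurable circle" by (rule LinfD)
  have i: "integrable circle (\<lambda>z. u z * cnj (\<phi> z))" by (rule L2_integrable[OF Linf_subset_L2[OF uphi]])
  have "fourier_coeff (\<lambda>z. u z * cnj (\<phi> z)) k = 0" if k: "int n dvd k" "k < 0" for k
  proof -
    obtain q where q: "k = int n * q" using k(1) by (auto simp: dvd_def)
    then have q0: "q < 0" using k(2) n by (simp add: mult_less_0_iff)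
    define l where "l = nat (- q)"
    have l: "l \<ge> 1" "- k = int (n * l)" using q q0 by (auto simp: l_def)
    have e: "n * l = n + n * (l - 1)" using l by (cases l) auto
    have mem: "(\<lambda>z. z ^ (n * (l - 1)) * u z) \<in> M \<inter> Linf"
      using M_power_n_mult[of u "l - 1"] Linf_mult[OF power_Linf, of u "n * (l - 1)"] u by auto
    have eq: "u z * cnj (\<phi> z) * z powi int (n * l) = z ^ n * (z ^ (n * (l - 1)) * u z) * cnj (\<phi> z)" for z
      unfolding power_int_of_nat e power_add by (simp only: mult_ac)
    show ?thesis unfolding fourier_coeff_def l(2) eq by (rule phi_orth[OF mem])
  qed
  then show "rot_avg n (\<lambda>z. u z * cnj (\<phi> z)) \<in> Hinf"
    unfolding Hinf_def using rot_avg_Linf[OF uphi] by (auto simp: fourier_coeff_rot_avg[OF i n])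
qed

text \<open>
  Dampened versions $h_m f$ of $f$ are bounded, so their coordinates are in $H^\infty(z^n)$, and they
  converge to $f$ in $\alpha$.
\<close>

lemma coordinate_Halpha_pow:
  assumes f: "f \<in> M" shows "coordinate f \<in> Halpha_pow \<alpha> n"
proof -
  obtain C where C: "C > 0" "\<And>f. f \<in> borel_measurable circle \<Longrightarrow> norm_ext \<alpha> (coordinate f) \<le> ennreal C * norm_ext \<alpha> f"
    by (rule coordinate_norm_le) (rule that)
  have fm: "f \<in> borel_measurable circle" by (rule M_measurable[OF f])
  obtain h where h: "\<And>m::nat. h m \<in> multipliers" "\<And>m. AE z in circle. cmod (h m z) \<le> 1"
    "\<And>m. (\<lambda>z. h m z * f z) \<in> M \<inter> Linf" "AE z in circle. (\<lambda>m. h m z) \<longlonglongrightarrow> 1"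
    by (rule M_bounded_approximation[OF f]) (rule that)
  define D where "D m z = h m z * f z - f z" for m z
  have Dm: "D m \<in> borel_measurable circle" for m
    unfolding D_def[abs_def] using h(3)[of m] by (intro borel_measurable_diff fm M_measurable) auto
  have "(\<lambda>m. norm_ext \<alpha> (D m)) \<longlonglongrightarrow> 0"
  proof (rule norm_ext_dominated_convergence[OF M_Lalpha[OF f] Dm])
    show "AE z in circle. cmod (D m z) \<le> 2 * cmod (f z)" for m
      using h(2)[of m]
    proof eventually_elim
      case (elim z)
      have "cmod (D m z) \<le> cmod (h m z * f z) + cmod (f z)" unfolding D_def by (rule norm_triangle_ineq4)
      also have "cmod (h m z * f z) \<le> 1 * cmod (f z)" unfolding norm_mult by (rule mult_right_mono[OF elim]) simp
      finally show ?case by simp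
    qed
    show "AE z in circle. (\<lambda>m. D m z) \<longlonglongrightarrow> 0"
      using h(4)
    proof eventually_elim
      case (elim z)
      have "(\<lambda>m. h m z * f z - f z) \<longlonglongrightarrow> 1 * f z - f z" by (intro tendsto_intros elim)
      then show ?case by (simp add: D_def)
    qed
  qed
  then have "(\<lambda>m. ennreal C * norm_ext \<alpha> (D m)) \<longlonglongrightarrow> ennreal C * 0"
    by (rule ennreal_tendsto_cmult[rotated]) simp
  then have lim: "(\<lambda>m. ennreal C * norm_ext \<alpha> (D m)) \<longlonglongrightarrow> 0" by simp
  show ?thesis
    unfolding Halpha_pow_def
  proof (rule alpha_closureI_tendsto)
    show "coordinate f \<in> calL \<alpha>"
      using order_le_less_trans[OF C(2)[OF fm]] M_calL[OF f] coordinate_measurable[OF fm]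
      by (simp add: calL_def ennreal_mult_less_top)
    show "coordinate (\<lambda>z. h m z * f z) \<in> pow_part n Hinf" for m by (rule coordinate_bounded_Hinf[OF h(3)])
    have "norm_ext \<alpha> (\<lambda>z. coordinate (\<lambda>z. h m z * f z) z - coordinate f z) \<le> ennreal C * norm_ext \<alpha> (D m)" for m
      using C(2)[OF Dm[of m]] by (simp add: coordinate_diff[abs_def, symmetric] D_def[abs_def] coordinate_diff)
    then show "(\<lambda>m. norm_ext \<alpha> (\<lambda>z. coordinate (\<lambda>z. h m z * f z) z - coordinate f z)) \<longlonglongrightarrow> 0"
      by (intro tendsto_sandwich[OF _ _ tendsto_const lim]) auto
  qed
qed

lemma Halpha_pow_rot_invariant: "h \<in> Halpha_pow \<alpha> n \<Longrightarrow> rot_invariant n h"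
proof (rule Lalpha_pow_rot_invariant[OF _ n])
  assume h: "h \<in> Halpha_pow \<alpha> n"
  have "pow_part n Hinf \<subseteq> pow_part n Linf" by (auto simp: pow_part_def Hinf_def)
  then show "h \<in> Lalpha_pow \<alpha> n"
    using h unfolding Halpha_pow_def Lalpha_pow_def alpha_closure_def by blast
qed

lemma Halpha_pow_calL: "h \<in> Halpha_pow \<alpha> n \<Longrightarrow> h \<in> calL \<alpha>"
  unfolding Halpha_pow_def using alpha_closure_calL by blast

lemma phi_mult_Halpha_pow:
  assumes h: "h \<in> Halpha_pow \<alpha> n" shows "(\<lambda>z. \<phi> z * h z) \<in> M"
proof -
  obtain C where C: "C > 0" "AE z in circle. cmod (\<phi> z) \<le> C" using LinfE[OF phi_Linf] .
  have "\<exists>b\<in>pow_part n Hinf. norm_ext \<alpha> (\<lambda>z. h z - b z) < ennreal (1 / real (Suc k))" for k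
    using h unfolding Halpha_pow_def alpha_closure_def by simp
  then obtain b where b: "\<And>k. b k \<in> pow_part n Hinf" "\<And>k. norm_ext \<alpha> (\<lambda>z. h z - b k z) < ennreal (1 / real (Suc k))"
    by metis
  show ?thesis
  proof (rule M_limit)
    show "(\<lambda>z. \<phi> z * h z) \<in> calL \<alpha>" by (rule calL_bounded_mult[OF Halpha_pow_calL[OF h] phi_Linf])
    show "(\<lambda>z. \<phi> z * b k z) \<in> M" for k by (rule M_mult_Hinf[OF phi_M phi_Linf b(1)])
    have "norm_ext \<alpha> (\<lambda>z. \<phi> z * b k z - \<phi> z * h z) \<le> ennreal (C * (1 / real (Suc k)))" for k
    proof -
      have "norm_ext \<alpha> (\<lambda>z. \<phi> z * b k z - \<phi> z * h z) = norm_ext \<alpha> (\<lambda>z. \<phi> z * (h z - b k z))"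
        unfolding norm_ext_diff_commute[of "\<lambda>z. \<phi> z * b k z"] by (simp add: right_diff_distrib)
      also have "\<dots> \<le> ennreal C * norm_ext \<alpha> (\<lambda>z. h z - b k z)" by (rule norm_ext_bounded_mult_le[OF C(2,1)])
      also have "\<dots> \<le> ennreal C * ennreal (1 / real (Suc k))" using b(2)[of k] by (intro mult_left_mono) auto
      also have "\<dots> = ennreal (C * (1 / real (Suc k)))" using C by (intro ennreal_mult[symmetric]) auto
      finally show ?thesis .
    qed
    then have le: "\<forall>\<^sub>F k in sequentially. norm_ext \<alpha> (\<lambda>z. \<phi> z * b k z - \<phi> z * h z) \<le> ennreal (C * (1 / real (Suc k)))"
      by (rule always_eventually[OF allI])
    have "(\<lambda>k. ennreal (C * (1 / real (Suc k)))) \<longlonglongrightarrow> ennreal (C * 0)"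
      by (intro tendsto_ennrealI tendsto_mult tendsto_const LIMSEQ_Suc[OF lim_1_over_n])
    then have lim: "(\<lambda>k. ennreal (C * (1 / real (Suc k)))) \<longlonglongrightarrow> 0"
      unfolding mult_zero_right ennreal_0 .
    show "(\<lambda>k. norm_ext \<alpha> (\<lambda>z. \<phi> z * b k z - \<phi> z * h z)) \<longlonglongrightarrow> 0"
      by (rule tendsto_sandwich[OF _ le tendsto_const lim]) simp
  qed
qed

lemma phi_decomp: "decomp n (pow_part n L2) \<phi> (component n \<phi>)"
  unfolding decomp_def
proof
  have pL2: "(\<lambda>z. z powi (1 - int i) * \<phi> z) \<in> L2" for i
    by (intro Linf_subset_L2 Linf_mult powi_Linf phi_Linf)
  show "\<forall>i\<in>{1..n}. component n \<phi> i \<in> pow_part n L2"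
    unfolding component_def using pL2 n by (auto intro!: rot_avg_pow_part rot_avg_L2 L2D)
  show "AE z in circle. \<phi> z = (\<Sum>i=1..n. z ^ (i - 1) * component n \<phi> i z)"
    by (rule AE_circleI) (rule component_decomposition[OF n])
qed

lemma coordinate_eq_components:
  assumes "decomp n (Lalpha_pow \<alpha> n) f F"
  shows "AE z in circle. coordinate f z = (\<Sum>i=1..n. cnj (component n \<phi> i z) * F i z)"
  using assms unfolding coordinate_def decomp_def
  by (intro rot_avg_mult_cnj_decomposition Lalpha_pow_rot_invariant[OF _ n]) auto

lemma phi_n_unimodular: "n_unimodular n \<phi>"
proof -
  have "AE z in circle. rot_avg n (\<lambda>z. \<phi> z * cnj (\<phi> z)) z = (\<Sum>i=1..n. cnj (component n \<phi> i z) * component n \<phi> i z)"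
    using phi_decomp unfolding decomp_def
    by (intro rot_avg_mult_cnj_decomposition component_rot_invariant n) auto
  then have "AE z in circle. (\<Sum>i=1..n. (cmod (component n \<phi> i z))\<^sup>2) = 1"
    using phi_unit
  proof eventually_elim
    case (elim z)
    have "complex_of_real (\<Sum>i=1..n. (cmod (component n \<phi> i z))\<^sup>2) = (\<Sum>i=1..n. cnj (component n \<phi> i z) * component n \<phi> i z)"
      by (simp only: of_real_sum complex_norm_square mult.commute)
    also have "\<dots> = 1" using elim by simp
    finally show ?case by (simp only: of_real_eq_1_iff)
  qed
  then show ?thesis unfolding n_unimodular_def using phi_Linf phi_decomp by blast
qed

lemma kernel_part_iff:
  "f \<in> kernel_part \<alpha> n 1 (\<lambda>_. component n \<phi>) M \<longleftrightarrow> f \<in> M \<and> (AE z in circle. coordinate f z = 0)"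
proof safe
  assume "f \<in> kernel_part \<alpha> n 1 (\<lambda>_. component n \<phi>) M"
  then obtain F where f: "f \<in> M" and F: "decomp n (Lalpha_pow \<alpha> n) f F"
    and z: "AE z in circle. (\<Sum>i=1..n. cnj (component n \<phi> i z) * F i z) = 0"
    by (auto simp: kernel_part_def)
  show "f \<in> M" by fact
  show "AE z in circle. coordinate f z = 0"
    using coordinate_eq_components[OF F] z by eventually_elim simp
next
  assume f: "f \<in> M" and z: "AE z in circle. coordinate f z = 0"
  have F: "decomp n (Lalpha_pow \<alpha> n) f (component n f)"
    unfolding decomp_def
    using component_Lalpha_pow[OF M_Lalpha[OF f] n] component_decomposition[OF n, of _ f]
    by (auto intro!: AE_circleI)
  have "AE z in circle. (\<Sum>i=1..n. cnj (component n \<phi> i z) * component n f i z) = 0"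
    using coordinate_eq_components[OF F] z by eventually_elim simp
  with f F show "f \<in> kernel_part \<alpha> n 1 (\<lambda>_. component n \<phi>) M"
    unfolding kernel_part_def by auto
qed

lemma M_direct_sum:
  "alg_direct_sum {0..1}
     (\<lambda>j. if j = 0 then kernel_part \<alpha> n 1 (\<lambda>_. component n \<phi>) M else mult_set \<phi> (Halpha_pow \<alpha> n)) M"
    (is "alg_direct_sum _ ?X M")
proof -
  let ?K = "kernel_part \<alpha> n 1 (\<lambda>_. component n \<phi>) M"
  have set01: "{0..1::nat} = {0, 1}" by auto
  have phiH: "g \<in> M \<and> (\<exists>h. rot_invariant n h \<and> (AE z in circle. g z = \<phi> z * h z) \<and> (AE z in circle. coordinate g z = h z))"
    if g: "g \<in> mult_set \<phi> (Halpha_pow \<alpha> n)" for g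
  proof -
    obtain h where h: "h \<in> Halpha_pow \<alpha> n" "AE z in circle. g z = \<phi> z * h z" and gm: "g \<in> borel_measurable circle"
      using g by (auto simp: mult_set_def)
    have "g \<in> M"
      by (rule M_AE_cong[OF phi_mult_Halpha_pow[OF h(1)] gm]) (use h(2) in \<open>auto elim: eventually_mono\<close>)
    moreover have "AE z in circle. coordinate g z = h z"
      using coordinate_cong_AE[OF h(2)] coordinate_phi_mult[OF Halpha_pow_rot_invariant[OF h(1)]]
      by eventually_elim simp
    ultimately show ?thesis using h Halpha_pow_rot_invariant by blast
  qed
  have sub: "f \<in> borel_measurable circle \<and> (\<exists>g :: nat \<Rightarrow> complex \<Rightarrow> complex. g 0 \<in> ?K \<and> g 1 \<in> mult_set \<phi> (Halpha_pow \<alpha> n) \<and> (AE z in circle. f z = g 0 z + g 1 z))"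
    if f: "f \<in> M" for f
  proof -
    have fm: "f \<in> borel_measurable circle" by (rule M_measurable[OF f])
    define h where "h = coordinate f"
    have h: "h \<in> Halpha_pow \<alpha> n" unfolding h_def by (rule coordinate_Halpha_pow[OF f])
    have ph: "(\<lambda>z. \<phi> z * h z) \<in> M" by (rule phi_mult_Halpha_pow[OF h])
    define g where "g j = (if j = (0::nat) then (\<lambda>z. f z - \<phi> z * h z) else (\<lambda>z. \<phi> z * h z))" for j
    have "AE z in circle. coordinate (\<lambda>z. f z - \<phi> z * h z) z = 0"
      using coordinate_phi_mult[OF Halpha_pow_rot_invariant[OF h]]
      by eventually_elim (simp add: coordinate_diff h_def)
    then have "g 0 \<in> ?K" unfolding kernel_part_iff using M_diff[OF f ph] by (simp add: g_def)
    moreover have "g 1 \<in> mult_set \<phi> (Halpha_pow \<alpha> n)"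
      using M_measurable[OF ph] h by (auto simp: mult_set_def g_def)
    moreover have "AE z in circle. f z = g 0 z + g 1 z" by (simp add: g_def)
    ultimately show ?thesis using fm by blast
  qed
  show ?thesis
    unfolding alg_direct_sum_def set01
  proof (intro conjI allI impI)
    show "M = {f \<in> borel_measurable circle. \<exists>g. (\<forall>i\<in>{0, 1}. g i \<in> ?X i) \<and> (AE z in circle. f z = (\<Sum>i\<in>{0, 1}. g i z))}"
      (is "M = ?S")
    proof
      show "M \<subseteq> ?S" using sub by fastforce
      show "?S \<subseteq> M"
      proof
        fix f assume "f \<in> ?S"
        then obtain g where fm: "f \<in> borel_measurable circle" and g: "g 0 \<in> ?K" "g (1::nat) \<in> mult_set \<phi> (Halpha_pow \<alpha> n)"
          and eq: "AE z in circle. f z = g 0 z + g 1 z" by auto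
        have "g 0 \<in> M" using g(1) unfolding kernel_part_iff by simp
        then have "(\<lambda>z. g 0 z + g 1 z) \<in> M" using phiH[OF g(2)] by (intro M_add) simp_all
        then show "f \<in> M" by (rule M_AE_cong[OF _ fm]) (use eq in \<open>auto elim: eventually_mono\<close>)
      qed
    qed
  next
    fix g h
    assume a: "(\<forall>i\<in>{0, 1}. g i \<in> ?X i) \<and> (\<forall>i\<in>{0, 1}. h i \<in> ?X i) \<and>
        (AE z in circle. (\<Sum>i\<in>{0, 1}. g i z) = (\<Sum>i\<in>{0, 1::nat}. h i z))"
    then have g: "g 0 \<in> ?K" "g 1 \<in> mult_set \<phi> (Halpha_pow \<alpha> n)" and h: "h 0 \<in> ?K" "h 1 \<in> mult_set \<phi> (Halpha_pow \<alpha> n)"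
      and eq: "AE z in circle. g 0 z + g 1 z = h 0 z + h 1 z" by auto
    obtain p where p: "AE z in circle. g 1 z = \<phi> z * p z" "AE z in circle. coordinate (g 1) z = p z"
      using phiH[OF g(2)] by blast
    obtain q where q: "AE z in circle. h 1 z = \<phi> z * q z" "AE z in circle. coordinate (h 1) z = q z"
      using phiH[OF h(2)] by blast
    have "AE z in circle. g 1 z - h 1 z = h 0 z - g 0 z" using eq by eventually_elim (simp add: algebra_simps)
    from coordinate_cong_AE[OF this]
    have "AE z in circle. coordinate (g 1) z - coordinate (h 1) z = coordinate (h 0) z - coordinate (g 0) z"
      by (simp only: coordinate_diff)
    moreover have "AE z in circle. coordinate (g 0) z = 0" "AE z in circle. coordinate (h 0) z = 0"
      using g(1) h(1) unfolding kernel_part_iff by simp_all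
    ultimately have "AE z in circle. p z = q z"
      using p(2) q(2) by eventually_elim simp
    then have 1: "AE z in circle. g 1 z = h 1 z" using p(1) q(1) by eventually_elim simp
    then have 0: "AE z in circle. g 0 z = h 0 z" using eq by eventually_elim simp
    show "\<forall>i\<in>{0, 1}. AE z in circle. g i z = h i z" using 0 1 by auto
  qed
qed

end

theorem theorem3p3:
  fixes \<alpha> :: "(complex \<Rightarrow> complex) \<Rightarrow> real"
    and n :: nat
    and M :: "(complex \<Rightarrow> complex) set"
  assumes "rot_sym_norm \<alpha>"
    and "continuous_norm \<alpha>"
    and "n \<ge> 1"
    and "closed_subspace \<alpha> M"
    and "\<exists>f\<in>M. \<not> (AE z in circle. f z = 0)"
    and "simply_invariant n M"
  shows "\<exists>(r::nat) (\<phi> :: nat \<Rightarrow> complex \<Rightarrow> complex) (A :: nat \<Rightarrow> nat \<Rightarrow> complex \<Rightarrow> complex).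
           1 \<le> r \<and> r \<le> n \<and>
           (\<forall>j\<in>{1..r}. n_unimodular n (\<phi> j) \<and> decomp n (pow_part n L2) (\<phi> j) (A j)) \<and>
           alg_direct_sum {0..r}
             (\<lambda>j. if j = 0 then kernel_part \<alpha> n r A M else mult_set (\<phi> j) (Halpha_pow \<alpha> n)) M"
proof -
  interpret invariant_subspace \<alpha> n M
    using assms by unfold_locales (auto simp: simply_invariant_def)
  have "mult_set (\<lambda>z. z ^ n) M \<noteq> M" using assms by (auto simp: simply_invariant_def)
  then obtain \<phi> where phi: "\<phi> \<in> M" "\<phi> \<in> Linf" "AE z in circle. rot_avg n (\<lambda>z. \<phi> z * cnj (\<phi> z)) z = 1"
    "\<And>u. u \<in> M \<inter> Linf \<Longrightarrow> (LINT z|circle. z ^ n * u z * cnj (\<phi> z)) = 0"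
    by (rule exists_wandering_vector) (rule that)
  interpret wandering_vector \<alpha> n M \<phi>
    by unfold_locales (fact phi)+
  show ?thesis
    using assms(3) phi_n_unimodular phi_decomp M_direct_sum
    by (intro exI[of _ "1::nat"] exI[of _ "\<lambda>_. \<phi>"] exI[of _ "\<lambda>_. component n \<phi>"]) simp
qed

end
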